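(* Let $N,p\ge1$ be integers. The finite $\mathcal W$-algebra $\mathcal W_p(N)=\mathcal W[gl(Np),N.sl(p)]$ is the truncated Yangian $Y(N)_p$: at the classical level, $\mathcal W_p(N)$ and the truncated Poisson Yangian $Y(N)_p$ are isomorphic as Poisson algebras.
   Context: Truncated Poisson Yangian. The Poisson Yangian of $gl(N)$ is the commutative polynomial algebra over $\mathbb C$ in $T^{ij}_n$ ($n\ge1$, $1\le i,j\le N$), with $T^{ij}_0=\delta^{ij}$ and Poisson bracket $$\{T^{ij}_m,T^{kl}_n\}=\sum_{r=0}^{\min(m,n)-1}\left(T^{kj}_rT^{il}_{m+n-r-1}-T^{kj}_{m+n-r-1}T^{il}_r\right).$$ The truncated Poisson Yangian $Y(N)_p$ is its quotient by the ideal generated by all $T^{ij}_n$ with $n>p$. Definition of $\mathcal W_p(N)$ at the classical level. Consider polynomial functions on $Np\times Np$ complex matrices $\mathbb J$, with Poisson bracket normalized by $\{\mathrm{tr}(\lambda\mathbb J),\mathbb J\}=[\lambda,\mathbb J]$ for every constant matrix $\lambda$; in matrix entries, $\{\mathbb J_{\alpha\beta},\mathbb J_{\gamma\delta}\}=\delta_{\beta\gamma}\mathbb J_{\alpha\delta}-\delta_{\alpha\delta}\mathbb J_{\gamma\beta}$. Identify $Np\times Np$ matrices with $gl(N)\otimes gl(p)$. Put $e_-=\sum_{k=1}^{p-1}E_{k+1,k}$, $e_0=\sum_{k=1}^p(\frac{p+1}2-k)E_{k,k}$, $\epsilon_-=1_N\otimes e_-$, $\epsilon_0=1_N\otimes e_0$,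 and for $0\le j\le p-1$ $$M_{j,j}=\sum_{k=1}^{p-j}\frac{(k+j-1)!\,(p-k)!}{(k-1)!\,(p-k-j)!}E_{k,k+j},\qquad M^{jj}_{ab}=E_{ab}\otimes M_{j,j}\quad(1\le a,b\le N).$$ Grade matrices by the eigenvalues of $\mathrm{ad}\,\epsilon_0$. Impose the first class constraints that $\mathbb J-\epsilon_-$ has only components of grade $\ge0$. These constraints generate (through the Poisson bracket) gauge transformations of the constrained matrices, and each gauge orbit contains exactly one matrix in the highest weight gauge $\epsilon_-+\sum_{a,b}\sum_{j=0}^{p-1}W^{ab}_jM^{jj}_{ab}$. The components $W^{ab}_j$ ($0\le j\le p-1$) thus define gauge invariant polynomials on the constraint surface and freely generate the commutative algebra $\mathcal W_p(N)$ of all gauge invariant polynomials. Its Poisson bracket is obtained by extending gauge invariant polynomials to all matrices, taking the bracket above, and restricting to the constraint surface (equivalently, the Dirac bracket). *)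

theory Defs
  imports Complex_Main "HOL-Library.Poly_Mapping" "HOL-Library.FuncSet"
    "HOL-Algebra.Module" "HOL-Algebra.QuotRing"
begin

section \<open>Poisson algebras over the complex numbers\<close>

definition complex_ring :: "complex ring" where
  "complex_ring = \<lparr>carrier = UNIV, mult = (*), one = 1, zero = 0, add = (+)\<rparr>"

record 'a poisson_struct = "(complex, 'a) module" +
  pbracket :: "'a \<Rightarrow> 'a \<Rightarrow> 'a"

locale poisson_algebra = algebra complex_ring P for P (structure) +
  assumes pb_closed:
      "\<lbrakk>x \<in> carrier P; y \<in> carrier P\<rbrakk> \<Longrightarrow> pbracket P x y \<in> carrier P"
    and pb_add:
      "\<lbrakk>x \<in> carrier P; y \<in> carrier P; z \<in> carrier P\<rbrakk>
        \<Longrightarrow> pbracket P (x \<oplus>\<^bsub>P\<^esub> y) z = pbracket P x z \<oplus>\<^bsub>P\<^esub> pbracket P y z"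
    and pb_smult:
      "\<lbrakk>x \<in> carrier P; y \<in> carrier P\<rbrakk>
        \<Longrightarrow> pbracket P (c \<odot>\<^bsub>P\<^esub> x) y = c \<odot>\<^bsub>P\<^esub> pbracket P x y"
    and pb_antisym:
      "\<lbrakk>x \<in> carrier P; y \<in> carrier P\<rbrakk> \<Longrightarrow> pbracket P x y = \<ominus>\<^bsub>P\<^esub> pbracket P y x"
    and pb_leibniz:
      "\<lbrakk>x \<in> carrier P; y \<in> carrier P; z \<in> carrier P\<rbrakk>
        \<Longrightarrow> pbracket P x (y \<otimes>\<^bsub>P\<^esub> z)
          = pbracket P x y \<otimes>\<^bsub>P\<^esub> z \<oplus>\<^bsub>P\<^esub> y \<otimes>\<^bsub>P\<^esub> pbracket P x z"
    and pb_jacobi: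
      "\<lbrakk>x \<in> carrier P; y \<in> carrier P; z \<in> carrier P\<rbrakk>
        \<Longrightarrow> pbracket P x (pbracket P y z) \<oplus>\<^bsub>P\<^esub> pbracket P y (pbracket P z x)
            \<oplus>\<^bsub>P\<^esub> pbracket P z (pbracket P x y) = \<zero>\<^bsub>P\<^esub>"

definition poisson_iso ::
    "('a, 'm) poisson_struct_scheme \<Rightarrow> ('b, 'n) poisson_struct_scheme \<Rightarrow> ('a \<Rightarrow> 'b) set" where
  "poisson_iso P Q = {h \<in> ring_iso P Q.
     (\<forall>c. \<forall>x\<in>carrier P. h (c \<odot>\<^bsub>P\<^esub> x) = c \<odot>\<^bsub>Q\<^esub> h x) \<and>
     (\<forall>x\<in>carrier P. \<forall>y\<in>carrier P. h (pbracket P x y) = pbracket Q (h x) (h y))}"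

definition poisson_isomorphic ::
    "('a, 'm) poisson_struct_scheme \<Rightarrow> ('b, 'n) poisson_struct_scheme \<Rightarrow> bool" where
  "poisson_isomorphic P Q \<longleftrightarrow>
     poisson_algebra P \<and> poisson_algebra Q \<and> poisson_iso P Q \<noteq> {}"

text \<open>The quotient by an ideal, with operations on cosets in the style of
  \<^const>\<open>rcoset_mult\<close>.  The bracket is meaningful when the ideal is a Poisson ideal.\<close>

definition poisson_quot ::
    "('a, 'm) poisson_struct_scheme \<Rightarrow> 'a set \<Rightarrow> 'a set poisson_struct" where
  "poisson_quot P I =
     \<lparr>carrier = carrier (P Quot I), mult = mult (P Quot I), one = one (P Quot I),
      zero = zero (P Quot I), add = add (P Quot I),
      smult = (\<lambda>c A. \<Union>a\<in>A. I +>\<^bsub>P\<^esub> (c \<odot>\<^bsub>P\<^esub> a)),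
      pbracket = (\<lambda>A B. \<Union>a\<in>A. \<Union>b\<in>B. I +>\<^bsub>P\<^esub> pbracket P a b)\<rparr>"


section \<open>Polynomials with a Poisson bracket given on the variables\<close>

type_synonym 'v cpoly = "('v \<Rightarrow>\<^sub>0 nat) \<Rightarrow>\<^sub>0 complex"

definition pconst :: "complex \<Rightarrow> 'v cpoly" where
  "pconst c = Poly_Mapping.single 0 c"

definition pvar :: "'v \<Rightarrow> 'v cpoly" where
  "pvar v = Poly_Mapping.single (Poly_Mapping.single v 1) 1"

definition pvars :: "'v cpoly \<Rightarrow> 'v set" where
  "pvars f = (\<Union>m\<in>Poly_Mapping.keys f. Poly_Mapping.keys m)"

definition peval :: "('v \<Rightarrow> complex) \<Rightarrow> 'v cpoly \<Rightarrow> complex" where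
  "peval x f = (\<Sum>m\<in>Poly_Mapping.keys f. Poly_Mapping.lookup f m *
                  (\<Prod>v\<in>Poly_Mapping.keys m. x v ^ Poly_Mapping.lookup m v))"

definition partial :: "'v \<Rightarrow> 'v cpoly \<Rightarrow> 'v cpoly" where
  "partial v f = (\<Sum>m\<in>Poly_Mapping.keys f.
     Poly_Mapping.single (m - Poly_Mapping.single v 1)
       (of_nat (Poly_Mapping.lookup m v) * Poly_Mapping.lookup f m))"

text \<open>The unique biderivation with the values \<open>\<pi> u v\<close> on pairs of variables.\<close>

definition poly_bracket :: "('v \<Rightarrow> 'v \<Rightarrow> 'v cpoly) \<Rightarrow> 'v cpoly \<Rightarrow> 'v cpoly \<Rightarrow> 'v cpoly" where
  "poly_bracket \<pi> f g = (\<Sum>u\<in>pvars f. \<Sum>v\<in>pvars g. partial u f * partial v g * \<pi> u v)"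

definition poly_poisson :: "'v set \<Rightarrow> ('v \<Rightarrow> 'v \<Rightarrow> 'v cpoly) \<Rightarrow> 'v cpoly poisson_struct" where
  "poly_poisson V \<pi> =
     \<lparr>carrier = {f. pvars f \<subseteq> V}, mult = (*), one = 1, zero = 0, add = (+),
      smult = (\<lambda>c f. pconst c * f), pbracket = poly_bracket \<pi>\<rparr>"


section \<open>The truncated Poisson Yangian\<close>

text \<open>The variable \<open>(n, i, j)\<close> stands for \<open>T^{ij}_n\<close>.\<close>

type_synonym yvar = "nat \<times> nat \<times> nat"

definition yangian_vars :: "nat \<Rightarrow> yvar set" where
  "yangian_vars N = {(n, i, j). 1 \<le> n \<and> i \<in> {1..N} \<and> j \<in> {1..N}}"

definition yangian_T :: "nat \<Rightarrow> nat \<Rightarrow> nat \<Rightarrow> yvar cpoly" where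
  "yangian_T n i j = (if n = 0 then (if i = j then 1 else 0) else pvar (n, i, j))"

definition yangian_gen_bracket :: "yvar \<Rightarrow> yvar \<Rightarrow> yvar cpoly" where
  "yangian_gen_bracket = (\<lambda>(m, i, j) (n, k, l).
     \<Sum>r<min m n. yangian_T r k j * yangian_T (m + n - r - 1) i l
       - yangian_T (m + n - r - 1) k j * yangian_T r i l)"

definition poisson_yangian :: "nat \<Rightarrow> yvar cpoly poisson_struct" where
  "poisson_yangian N = poly_poisson (yangian_vars N) yangian_gen_bracket"

definition truncation_ideal :: "nat \<Rightarrow> nat \<Rightarrow> yvar cpoly set" where
  "truncation_ideal N p =
     Idl\<^bsub>poisson_yangian N\<^esub> {yangian_T n i j | n i j. n > p \<and> i \<in> {1..N} \<and> j \<in> {1..N}}"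

definition truncated_yangian :: "nat \<Rightarrow> nat \<Rightarrow> yvar cpoly set poisson_struct" where
  "truncated_yangian N p = poisson_quot (poisson_yangian N) (truncation_ideal N p)"


section \<open>Matrices in \<open>gl(N) \<otimes> gl(p)\<close> and their grading\<close>

text \<open>A square matrix with rows and columns indexed by a subset of \<open>'i\<close> is a function on
  pairs of indices that vanishes off that subset.  The rows and columns of an
  \<open>Np \<times> Np\<close> matrix are indexed by \<open>(a, k)\<close> with \<open>1 \<le> a \<le> N\<close> and \<open>1 \<le> k \<le> p\<close>,
  which is the identification with \<open>gl(N) \<otimes> gl(p)\<close>.\<close>

type_synonym 'i cmat = "'i \<times> 'i \<Rightarrow> complex"

type_synonym idx = "nat \<times> nat"

definition indices :: "nat \<Rightarrow> nat \<Rightarrow> idx set" where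
  "indices N p = {1..N} \<times> {1..p}"

definition matrices :: "nat \<Rightarrow> nat \<Rightarrow> idx cmat set" where
  "matrices N p = {A. \<forall>x. x \<notin> indices N p \<times> indices N p \<longrightarrow> A x = 0}"

definition munit :: "'i \<Rightarrow> 'i \<Rightarrow> 'i cmat" where
  "munit i j = (\<lambda>(k, l). if k = i \<and> l = j then 1 else 0)"

definition tensor :: "'i cmat \<Rightarrow> 'j cmat \<Rightarrow> ('i \<times> 'j) cmat" where
  "tensor A B = (\<lambda>((a, k), (b, l)). A (a, b) * B (k, l))"

definition commutator :: "nat \<Rightarrow> nat \<Rightarrow> idx cmat \<Rightarrow> idx cmat \<Rightarrow> idx cmat" where
  "commutator N p A B = (\<lambda>(\<alpha>, \<beta>).
     \<Sum>\<gamma>\<in>indices N p. A (\<alpha>, \<gamma>) * B (\<gamma>, \<beta>) - B (\<alpha>, \<gamma>) * A (\<gamma>, \<beta>))"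

definition identity_mat :: "nat \<Rightarrow> nat cmat" where
  "identity_mat N = (\<lambda>x. \<Sum>a=1..N. munit a a x)"

definition e_minus :: "nat \<Rightarrow> nat cmat" where
  "e_minus p = (\<lambda>x. \<Sum>k=1..p-1. munit (k + 1) k x)"

definition e_zero :: "nat \<Rightarrow> nat cmat" where
  "e_zero p = (\<lambda>x. \<Sum>k=1..p. ((of_nat p + 1) / 2 - of_nat k) * munit k k x)"

definition eps_minus :: "nat \<Rightarrow> nat \<Rightarrow> idx cmat" where
  "eps_minus N p = tensor (identity_mat N) (e_minus p)"

definition eps_zero :: "nat \<Rightarrow> nat \<Rightarrow> idx cmat" where
  "eps_zero N p = tensor (identity_mat N) (e_zero p)"

definition grade_space :: "nat \<Rightarrow> nat \<Rightarrow> real \<Rightarrow> idx cmat set" where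
  "grade_space N p s = {A \<in> matrices N p.
     \<forall>x. commutator N p (eps_zero N p) A x = complex_of_real s * A x}"

text \<open>The matrices all of whose components have grade \<open>\<ge> 0\<close>, i.e.\ the finite sums of
  eigenvectors of \<open>ad \<epsilon>\<^sub>0\<close> with eigenvalues \<open>\<ge> 0\<close>.\<close>

definition nonneg_grade :: "nat \<Rightarrow> nat \<Rightarrow> idx cmat set" where
  "nonneg_grade N p = {A. \<exists>S X. finite S \<and> (\<forall>s\<in>S. 0 \<le> s \<and> X s \<in> grade_space N p s) \<and>
     A = (\<lambda>x. \<Sum>s\<in>S. X s x)}"


section \<open>The finite W-algebra\<close>

text \<open>The variable \<open>(\<alpha>, \<beta>)\<close> stands for the matrix entry \<open>J\<^sub>\<alpha>\<^sub>\<beta>\<close>.\<close>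

definition gl_gen_bracket :: "idx \<times> idx \<Rightarrow> idx \<times> idx \<Rightarrow> (idx \<times> idx) cpoly" where
  "gl_gen_bracket = (\<lambda>(\<alpha>, \<beta>) (\<gamma>, \<delta>).
     (if \<beta> = \<gamma> then pvar (\<alpha>, \<delta>) else 0) - (if \<alpha> = \<delta> then pvar (\<gamma>, \<beta>) else 0))"

definition gl_poisson :: "nat \<Rightarrow> nat \<Rightarrow> (idx \<times> idx) cpoly poisson_struct" where
  "gl_poisson N p = poly_poisson (indices N p \<times> indices N p) gl_gen_bracket"

definition constraint_surface :: "nat \<Rightarrow> nat \<Rightarrow> idx cmat set" where
  "constraint_surface N p =
     {J \<in> matrices N p. (\<lambda>x. J x - eps_minus N p x) \<in> nonneg_grade N p}"

text \<open>Since the elementary matrices are eigenvectors of \<open>ad \<epsilon>\<^sub>0\<close>, the components of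
  negative grade of \<open>J - \<epsilon>\<^sub>-\<close> are its entries at the elementary matrices of negative grade;
  see \<open>constraint_surface_iff\<close> below.\<close>

definition constraints :: "nat \<Rightarrow> nat \<Rightarrow> (idx \<times> idx) cpoly set" where
  "constraints N p = {pvar (\<alpha>, \<beta>) - pconst (eps_minus N p (\<alpha>, \<beta>)) | \<alpha> \<beta>.
     \<alpha> \<in> indices N p \<and> \<beta> \<in> indices N p \<and> (\<exists>s<0. munit \<alpha> \<beta> \<in> grade_space N p s)}"

definition on_surface :: "nat \<Rightarrow> nat \<Rightarrow> (idx \<times> idx) cpoly \<Rightarrow> idx cmat \<Rightarrow> complex" where
  "on_surface N p f = restrict (\<lambda>J. peval J f) (constraint_surface N p)"

text \<open>A constraint \<open>\<phi>\<close> generates the infinitesimal gauge transformation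
  \<open>f \<mapsto> {\<phi>, f}\<close>, evaluated on the constraint surface.\<close>

definition gauge_invariant :: "nat \<Rightarrow> nat \<Rightarrow> (idx \<times> idx) cpoly \<Rightarrow> bool" where
  "gauge_invariant N p f \<longleftrightarrow>
     (\<forall>\<phi>\<in>constraints N p. \<forall>J\<in>constraint_surface N p.
        peval J (pbracket (gl_poisson N p) \<phi> f) = 0)"

text \<open>Elements are polynomial functions on the constraint surface, extensional in the sense of
  \<^const>\<open>restrict\<close>.  The bracket of \<open>F\<close> and \<open>G\<close> is the restriction of \<open>{f, g}\<close> for any
  polynomials \<open>f\<close> and \<open>g\<close> on all matrices that extend \<open>F\<close> and \<open>G\<close>; it does not depend on
  the choice because the constraints are first class.\<close>

definition W_algebra :: "nat \<Rightarrow> nat \<Rightarrow> (idx cmat \<Rightarrow> complex) poisson_struct" where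
  "W_algebra N p =
     \<lparr>carrier = on_surface N p ` {f \<in> carrier (gl_poisson N p). gauge_invariant N p f},
      mult = (\<lambda>F G. restrict (\<lambda>J. F J * G J) (constraint_surface N p)),
      one = restrict (\<lambda>J. 1) (constraint_surface N p),
      zero = restrict (\<lambda>J. 0) (constraint_surface N p),
      add = (\<lambda>F G. restrict (\<lambda>J. F J + G J) (constraint_surface N p)),
      smult = (\<lambda>c F. restrict (\<lambda>J. c * F J) (constraint_surface N p)),
      pbracket = (\<lambda>F G. THE H. \<exists>f g. f \<in> carrier (gl_poisson N p) \<and> g \<in> carrier (gl_poisson N p) \<and>
         on_surface N p f = F \<and> on_surface N p g = G \<and>
         H = on_surface N p (pbracket (gl_poisson N p) f g))\<rparr>"


subsection \<open>The defining bracket, the grading and the constraints in coordinates\<close>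

lemma pvars_pvar: "pvars (pvar v) = {v}"
  by (simp add: pvars_def pvar_def)

lemma partial_pvar: "partial v (pvar v) = 1"
  by (simp add: partial_def pvar_def)

lemma poly_bracket_pvar: "poly_bracket \<pi> (pvar u) (pvar v) = \<pi> u v"
  by (simp add: poly_bracket_def pvars_pvar partial_pvar)

lemma e_zero_apply:
  "e_zero p (k, l) = (if k = l \<and> k \<in> {1..p} then (of_nat p + 1) / 2 - of_nat k else 0)"
proof -
  have "e_zero p (k, l) =
      (\<Sum>m=1..p. if m = k then (if k = l then (of_nat p + 1) / 2 - of_nat k else 0) else 0)"
    unfolding e_zero_def munit_def by (intro sum.cong) auto
  then show ?thesis by simp
qed

lemma identity_mat_apply: "identity_mat N (a, b) = (if a = b \<and> a \<in> {1..N} then 1 else 0)"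
proof -
  have "identity_mat N (a, b) = (\<Sum>m=1..N. if m = a then (if a = b then 1 else 0) else 0)"
    unfolding identity_mat_def munit_def by (intro sum.cong) auto
  then show ?thesis by simp
qed

lemma eps_zero_apply:
  "eps_zero N p (\<alpha>, \<beta>) =
     (if \<alpha> = \<beta> \<and> \<alpha> \<in> indices N p then (of_nat p + 1) / 2 - of_nat (snd \<alpha>) else 0)"
  by (cases \<alpha>; cases \<beta>)
     (auto simp: eps_zero_def tensor_def e_zero_apply identity_mat_apply indices_def)

lemma commutator_eps_zero:
  assumes "A \<in> matrices N p"
  shows "commutator N p (eps_zero N p) A (\<alpha>, \<beta>) =
           complex_of_real (real (snd \<beta>) - real (snd \<alpha>)) * A (\<alpha>, \<beta>)"
proof (cases "\<alpha> \<in> indices N p \<and> \<beta> \<in> indices N p")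
  case True
  have fin: "finite (indices N p)" by (simp add: indices_def)
  have "commutator N p (eps_zero N p) A (\<alpha>, \<beta>) =
      (\<Sum>\<gamma>\<in>indices N p. eps_zero N p (\<alpha>, \<gamma>) * A (\<gamma>, \<beta>))
      - (\<Sum>\<gamma>\<in>indices N p. A (\<alpha>, \<gamma>) * eps_zero N p (\<gamma>, \<beta>))"
    by (simp add: commutator_def sum_subtractf)
  also have "(\<Sum>\<gamma>\<in>indices N p. eps_zero N p (\<alpha>, \<gamma>) * A (\<gamma>, \<beta>)) =
      (\<Sum>\<gamma>\<in>indices N p. if \<gamma> = \<alpha> then ((of_nat p + 1) / 2 - of_nat (snd \<alpha>)) * A (\<alpha>, \<beta>) else 0)"
    using True by (intro sum.cong) (auto simp: eps_zero_apply)
  also have "\<dots> = ((of_nat p + 1) / 2 - of_nat (snd \<alpha>)) * A (\<alpha>, \<beta>)"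
    using fin True by simp
  also have "(\<Sum>\<gamma>\<in>indices N p. A (\<alpha>, \<gamma>) * eps_zero N p (\<gamma>, \<beta>)) =
      (\<Sum>\<gamma>\<in>indices N p. if \<gamma> = \<beta> then ((of_nat p + 1) / 2 - of_nat (snd \<beta>)) * A (\<alpha>, \<beta>) else 0)"
    using True by (intro sum.cong) (auto simp: eps_zero_apply)
  also have "\<dots> = ((of_nat p + 1) / 2 - of_nat (snd \<beta>)) * A (\<alpha>, \<beta>)"
    using fin True by simp
  finally show ?thesis by (simp add: algebra_simps)
next
  case False
  then have z: "A (\<alpha>, \<beta>) = 0" using assms by (auto simp: matrices_def simp del: split_paired_All)
  have "eps_zero N p (\<alpha>, \<gamma>) * A (\<gamma>, \<beta>) - A (\<alpha>, \<gamma>) * eps_zero N p (\<gamma>, \<beta>) = 0" for \<gamma>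
  proof (cases "\<alpha> \<in> indices N p")
    case True
    with False have "\<beta> \<notin> indices N p" by blast
    moreover from this have "A (\<gamma>, \<beta>) = 0"
      using assms by (auto simp: matrices_def simp del: split_paired_All)
    ultimately show ?thesis by (auto simp: eps_zero_apply)
  next
    case False
    then have "A (\<alpha>, \<gamma>) = 0"
      using assms by (auto simp: matrices_def simp del: split_paired_All)
    with False show ?thesis by (simp add: eps_zero_apply)
  qed
  then show ?thesis by (simp add: commutator_def z)
qed

lemma munit_grade_space:
  assumes "\<alpha> \<in> indices N p" "\<beta> \<in> indices N p"
  shows "munit \<alpha> \<beta> \<in> grade_space N p s \<longleftrightarrow> s = real (snd \<beta>) - real (snd \<alpha>)"
proof -
  have m: "munit \<alpha> \<beta> \<in> matrices N p" using assms by (auto simp: matrices_def munit_def)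
  have "munit \<alpha> \<beta> \<in> grade_space N p s \<longleftrightarrow>
      (\<forall>\<gamma> \<delta>. complex_of_real (real (snd \<delta>) - real (snd \<gamma>)) * munit \<alpha> \<beta> (\<gamma>, \<delta>)
        = complex_of_real s * munit \<alpha> \<beta> (\<gamma>, \<delta>))"
    using m commutator_eps_zero[OF m] by (simp add: grade_space_def split_paired_All)
  also have "\<dots> \<longleftrightarrow> complex_of_real (real (snd \<beta>) - real (snd \<alpha>)) = complex_of_real s"
    by (cases \<alpha>; cases \<beta>) (auto simp: munit_def)
  also have "\<dots> \<longleftrightarrow> s = real (snd \<beta>) - real (snd \<alpha>)"
    using of_real_eq_iff by metis
  finally show ?thesis .
qed

lemma nonneg_grade_iff:
  "A \<in> nonneg_grade N p \<longleftrightarrow>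
     A \<in> matrices N p \<and> (\<forall>\<alpha> \<beta>. snd \<beta> < snd \<alpha> \<longrightarrow> A (\<alpha>, \<beta>) = 0)"
proof
  assume "A \<in> nonneg_grade N p"
  then obtain S X where S: "finite S" "\<And>s. s \<in> S \<Longrightarrow> 0 \<le> s \<and> X s \<in> grade_space N p s"
    and A: "A = (\<lambda>x. \<Sum>s\<in>S. X s x)" unfolding nonneg_grade_def by blast
  have "X s (\<alpha>, \<beta>) = 0" if "snd \<beta> < snd \<alpha>" "s \<in> S" for s \<alpha> \<beta>
  proof -
    have "X s \<in> matrices N p" and
      "commutator N p (eps_zero N p) (X s) (\<alpha>, \<beta>) = complex_of_real s * X s (\<alpha>, \<beta>)"
      using S(2)[OF that(2)] unfolding grade_space_def by blast+
    then have "complex_of_real (real (snd \<beta>) - real (snd \<alpha>)) * X s (\<alpha>, \<beta>)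
        = complex_of_real s * X s (\<alpha>, \<beta>)"
      using commutator_eps_zero by metis
    moreover have "real (snd \<beta>) - real (snd \<alpha>) \<noteq> s"
      using S(2)[OF that(2)] that(1) by auto
    ultimately show ?thesis by (metis mult_right_cancel of_real_eq_iff)
  qed
  moreover have "A \<in> matrices N p"
    using S(2) unfolding A matrices_def grade_space_def by (auto intro!: sum.neutral)
  ultimately show "A \<in> matrices N p \<and> (\<forall>\<alpha> \<beta>. snd \<beta> < snd \<alpha> \<longrightarrow> A (\<alpha>, \<beta>) = 0)"
    unfolding A by (auto intro!: sum.neutral)
next
  assume R: "A \<in> matrices N p \<and> (\<forall>\<alpha> \<beta>. snd \<beta> < snd \<alpha> \<longrightarrow> A (\<alpha>, \<beta>) = 0)"
  define X where
    "X s = (\<lambda>x :: idx \<times> idx. if real (snd (snd x)) - real (snd (fst x)) = s then A x else 0)" for s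
  define S where "S = real ` {0..p}"
  have "X s \<in> grade_space N p s" for s
  proof -
    have m: "X s \<in> matrices N p" using R by (auto simp: matrices_def X_def)
    show ?thesis unfolding grade_space_def
      using m commutator_eps_zero[OF m] by (auto simp: X_def split_paired_All)
  qed
  moreover have "A x = (\<Sum>s\<in>S. X s x)" for x
  proof (cases "A x = 0")
    case True
    then have "X s x = 0" for s by (simp add: X_def)
    with True show ?thesis by simp
  next
    case False
    obtain a k b l where x: "x = ((a, k), (b, l))" by (metis prod.exhaust)
    have "k \<le> l" using R False x by (metis not_le snd_conv)
    moreover have "l \<le> p" using R False x by (auto simp: matrices_def indices_def)
    ultimately have "real l - real k \<in> S" unfolding S_def
      by (intro image_eqI[of _ _ "l - k"]) (auto simp: of_nat_diff)
    moreover have "finite S" by (simp add: S_def)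
    ultimately show ?thesis by (simp add: X_def x)
  qed
  moreover have "finite S" "\<forall>s\<in>S. 0 \<le> s" by (auto simp: S_def)
  ultimately show "A \<in> nonneg_grade N p" unfolding nonneg_grade_def by blast
qed

lemma pconst_0: "pconst 0 = 0"
  by (simp add: pconst_def)

lemma peval_pvar_minus_pconst: "peval x (pvar v - pconst c) = x v - c"
proof (cases "c = 0")
  case True
  then show ?thesis by (simp add: pconst_0 peval_def pvar_def)
next
  case False
  let ?m = "Poly_Mapping.single v (1::nat)" and ?f = "pvar v - pconst c"
  have ne: "?m \<noteq> 0" by (metis lookup_single_eq lookup_zero zero_neq_one)
  have l: "Poly_Mapping.lookup ?f m = (if m = ?m then 1 else if m = 0 then - c else 0)" for m
    using ne by (auto simp: lookup_minus pvar_def pconst_def lookup_single when_def)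
  have k: "Poly_Mapping.keys ?f = {?m, 0}"
    using False by (auto simp: in_keys_iff l split: if_splits)
  show ?thesis unfolding peval_def k l using ne by simp
qed

lemma constraint_surface_iff:
  "J \<in> constraint_surface N p \<longleftrightarrow>
     J \<in> matrices N p \<and> (\<forall>\<phi>\<in>constraints N p. peval J \<phi> = 0)"
proof -
  have e: "eps_minus N p \<in> matrices N p"
    unfolding matrices_def eps_minus_def tensor_def
    by (force simp: identity_mat_apply indices_def e_minus_def munit_def
        intro!: sum.neutral split: if_splits)
  have *: "(\<exists>s<0. munit \<alpha> \<beta> \<in> grade_space N p s) \<longleftrightarrow> snd \<beta> < snd \<alpha>"
    if "\<alpha> \<in> indices N p" "\<beta> \<in> indices N p" for \<alpha> \<beta>
    using munit_grade_space[OF that] by auto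
  have "(\<forall>\<phi>\<in>constraints N p. peval J \<phi> = 0) \<longleftrightarrow>
      (\<forall>\<alpha>\<in>indices N p. \<forall>\<beta>\<in>indices N p. snd \<beta> < snd \<alpha> \<longrightarrow> J (\<alpha>, \<beta>) - eps_minus N p (\<alpha>, \<beta>) = 0)"
    (is "?L \<longleftrightarrow> ?R")
  proof
    assume L: ?L
    show ?R
    proof (intro ballI impI)
      fix \<alpha> \<beta> assume a: "\<alpha> \<in> indices N p" "\<beta> \<in> indices N p" "snd \<beta> < snd \<alpha>"
      then have "pvar (\<alpha>, \<beta>) - pconst (eps_minus N p (\<alpha>, \<beta>)) \<in> constraints N p"
        unfolding constraints_def using * by blast
      then show "J (\<alpha>, \<beta>) - eps_minus N p (\<alpha>, \<beta>) = 0"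
        using L peval_pvar_minus_pconst by metis
    qed
  next
    assume R: ?R
    show ?L
    proof
      fix \<phi> assume "\<phi> \<in> constraints N p"
      then obtain \<alpha> \<beta> where "\<phi> = pvar (\<alpha>, \<beta>) - pconst (eps_minus N p (\<alpha>, \<beta>))"
        "\<alpha> \<in> indices N p" "\<beta> \<in> indices N p" "snd \<beta> < snd \<alpha>"
        unfolding constraints_def using * by blast
      then show "peval J \<phi> = 0" using R by (simp add: peval_pvar_minus_pconst)
    qed
  qed
  moreover have "(\<lambda>x. J x - eps_minus N p x) \<in> nonneg_grade N p \<longleftrightarrow> ?R" if "J \<in> matrices N p"
  proof -
    have out: "J (\<alpha>, \<beta>) - eps_minus N p (\<alpha>, \<beta>) = 0"
      if "\<not> (\<alpha> \<in> indices N p \<and> \<beta> \<in> indices N p)" for \<alpha> \<beta>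
      using \<open>J \<in> matrices N p\<close> e that
      by (auto simp: matrices_def simp del: split_paired_All)
    moreover have "(\<lambda>x. J x - eps_minus N p x) \<in> matrices N p"
      using that e unfolding matrices_def by simp
    ultimately show ?thesis unfolding nonneg_grade_iff by blast
  qed
  ultimately show ?thesis unfolding constraint_surface_def by blast
qed

end

theory Submission
  imports Defs "HOL-Analysis.Derivative" "HOL-Computational_Algebra.Formal_Power_Series"
begin

text \<open>
  The entries of the resolvents \<open>R(u) = (u - J)\<^sup>-\<^sup>1\<close> satisfy
  \<open>(u - v) {R\<^sub>a\<^sub>b(u), R\<^sub>c\<^sub>d(v)} = R\<^sub>c\<^sub>b(u) R\<^sub>a\<^sub>d(v) - R\<^sub>c\<^sub>b(v) R\<^sub>a\<^sub>d(u)\<close>, which is the Yangian relation.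
  The lower left \<open>N \<times> N\<close> block of \<open>R(u)\<close> is gauge invariant, and on the constraint surface it is
  \<open>u\<^sup>-\<^sup>p S(u)\<close> for a series \<open>S(u) = 1 + O(u\<^sup>-\<^sup>1)\<close>.  Inverting a solution of the relation and replacing
  \<open>u\<close> by \<open>- u\<close> gives another solution, so \<open>T(u) = S(- u)\<^sup>-\<^sup>1\<close> defines a Poisson homomorphism
  from the Yangian to the \<open>W\<close>-algebra.

  Every gauge orbit meets the slice of block companion matrices, whose only free entries are in the
  last block column.  On this slice \<open>S(u)\<^sup>-\<^sup>1\<close> is a polynomial of degree \<open>p\<close> in \<open>u\<^sup>-\<^sup>1\<close>, and up to sign
  its coefficients are the free entries.  Hence the homomorphism is onto, and its kernel is the
  truncation ideal.  The Jacobi identity is only checked for the matrix entries: the truncated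
  Yangian inherits it through the isomorphism.
\<close>


section \<open>Polynomials\<close>

text \<open>Elements of the W-algebra are functions on the surface, but their bracket is computed
  from extensions off it. The leading coefficient of S is the identity only on the surface, so
  treating it as a constant must be justified: on the surface, a bracket with a gauge invariant
  polynomial does not see a polynomial that vanishes there. The relation for S and for its inverse X
  is therefore proved at each point \<open>J\<close> separately. There the series have complex
  coefficients and no bracket of series is left; what remains are the numbers {S, S}, {S, X} and {X,
  X}, linked by the Leibniz rule for S X = 1. This suffices to carry the relation from S to X. S is
  inverted because its own coefficients need not terminate: on a companion matrix they satisfy a
  linear recursion of length p, and X consists of the coefficients of that recursion. Companion
  matrices are chosen as the slice, rather than highest weight matrices, because their coordinates
  are then the generators up to sign. Surjectivity and the kernel thereby reduce to substituting one
  set of variables for the other.\<close>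

lemma cpoly_sum_singles: "f = (\<Sum>m\<in>Poly_Mapping.keys f. Poly_Mapping.single m (Poly_Mapping.lookup f m))"
proof (rule poly_mapping_eqI)
  fix k
  show "Poly_Mapping.lookup f k =
    Poly_Mapping.lookup (\<Sum>m\<in>Poly_Mapping.keys f. Poly_Mapping.single m (Poly_Mapping.lookup f m)) k"
    by (simp add: lookup_sum lookup_single when_def in_keys_iff)
qed

text \<open>The monomial case is limited to the support of \<open>f\<close>, so that a bound on
  \<open>pvars f\<close> reaches every monomial that occurs.\<close>

lemma cpoly_monomial_induct [case_names zero single add]:
  fixes f :: "'v cpoly"
  assumes z: "P 0"
    and s: "\<And>m a. m \<in> Poly_Mapping.keys f \<Longrightarrow> P (Poly_Mapping.single m a)"
    and a: "\<And>f g. P f \<Longrightarrow> P g \<Longrightarrow> P (f + g)"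
  shows "P f"
proof -
  have "P (\<Sum>m\<in>K. Poly_Mapping.single m (Poly_Mapping.lookup f m))"
    if "finite K" "K \<subseteq> Poly_Mapping.keys f" for K
    using that by (induction rule: finite_induct) (auto intro: z s a)
  from this[of "Poly_Mapping.keys f"] show ?thesis
    by (subst cpoly_sum_singles) simp
qed

lemma pconst_1: "pconst 1 = 1"
  by (simp add: pconst_def)

lemma pconst_mult: "pconst (c * d) = pconst c * pconst d"
  by (simp add: pconst_def mult_single)

lemma pconst_add: "pconst (c + d) = pconst c + pconst d"
  by (simp add: pconst_def single_add)

lemma pconst_mult_single: "pconst c * Poly_Mapping.single m a = Poly_Mapping.single m (c * a)"
  by (simp add: pconst_def mult_single)

lemma keys_monomial_add:
  fixes m n :: "'v \<Rightarrow>\<^sub>0 nat"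
  shows "Poly_Mapping.keys (m + n) = Poly_Mapping.keys m \<union> Poly_Mapping.keys n"
  by (auto simp: in_keys_iff lookup_add)

lemma pvars_zero [simp]: "pvars 0 = {}"
  and pvars_one [simp]: "pvars 1 = {}"
  by (simp_all add: pvars_def)

lemma pvars_pconst [simp]: "pvars (pconst c) = {}"
  by (simp add: pvars_def pconst_def)

lemma pvars_uminus [simp]: "pvars (- f) = pvars f"
  by (simp add: pvars_def in_keys_iff)

lemma pvars_add: "pvars (f + g) \<subseteq> pvars f \<union> pvars g"
  using keys_add[of f g] by (fastforce simp: pvars_def)

lemma pvars_diff: "pvars (f - g) \<subseteq> pvars f \<union> pvars g"
  using pvars_add[of f "- g"] by simp

lemma pvars_mult: "pvars (f * g) \<subseteq> pvars f \<union> pvars g"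
proof
  fix v assume "v \<in> pvars (f * g)"
  then obtain m where m: "m \<in> Poly_Mapping.keys (f * g)" "v \<in> Poly_Mapping.keys m"
    by (auto simp: pvars_def)
  then obtain a b where "a \<in> Poly_Mapping.keys f" "b \<in> Poly_Mapping.keys g" "m = a + b"
    using keys_mult[of f g] by blast
  then show "v \<in> pvars f \<union> pvars g" using m(2) by (auto simp: pvars_def keys_monomial_add)
qed

lemma pvars_sum: "(\<And>i. i \<in> A \<Longrightarrow> pvars (f i) \<subseteq> V) \<Longrightarrow> pvars (sum f A) \<subseteq> V"
  by (induction A rule: infinite_finite_induct) (use pvars_add in \<open>fastforce+\<close>)

lemma finite_pvars [simp]: "finite (pvars f)"
  by (simp add: pvars_def)

lemma pvar_power: "pvar v ^ k = Poly_Mapping.single (Poly_Mapping.single v k) 1"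
proof (induction k)
  case (Suc k)
  then show ?case by (simp add: pvar_def mult_single flip: single_add)
qed simp

lemma single_monomial_prod:
  fixes m :: "'v \<Rightarrow>\<^sub>0 nat"
  shows "Poly_Mapping.single m a = pconst a * (\<Prod>v\<in>Poly_Mapping.keys m. pvar v ^ Poly_Mapping.lookup m v)"
proof -
  have *: "(\<Prod>v\<in>K. pvar v ^ Poly_Mapping.lookup m v) =
      Poly_Mapping.single (\<Sum>v\<in>K. Poly_Mapping.single v (Poly_Mapping.lookup m v)) 1" if "finite K" for K
    using that by (induction rule: finite_induct) (simp_all add: pvar_power mult_single)
  have "(\<Sum>v\<in>Poly_Mapping.keys m. Poly_Mapping.single v (Poly_Mapping.lookup m v)) = m"
    by (rule poly_mapping_eqI) (simp add: lookup_sum lookup_single when_def in_keys_iff)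
  then show ?thesis by (simp add: * pconst_mult_single)
qed

lemma cpoly_induct [consumes 1, case_names const var add mult]:
  fixes f :: "'v cpoly"
  assumes V: "pvars f \<subseteq> V"
    and c: "\<And>c. P (pconst c)" and v: "\<And>v. v \<in> V \<Longrightarrow> P (pvar v)"
    and a: "\<And>f g. \<lbrakk>pvars f \<subseteq> V; pvars g \<subseteq> V; P f; P g\<rbrakk> \<Longrightarrow> P (f + g)"
    and m: "\<And>f g. \<lbrakk>pvars f \<subseteq> V; pvars g \<subseteq> V; P f; P g\<rbrakk> \<Longrightarrow> P (f * g)"
  shows "P f"
proof -
  \<comment> \<open>The variable bound is carried along with \<open>P\<close>, because the rules for
    sums and products require it of both operands.\<close>
  let ?Q = "\<lambda>f. pvars f \<subseteq> V \<and> P f"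
  have cQ: "?Q (pconst c)" for c using c by simp
  have mQ: "?Q (f * g)" if "?Q f" "?Q g" for f g using m that pvars_mult[of f g] by blast
  have aQ: "?Q (f + g)" if "?Q f" "?Q g" for f g using a that pvars_add[of f g] by blast
  have pQ: "?Q (f ^ k)" if "?Q f" for f k
    by (induction k) (use cQ[of 1] mQ that in \<open>auto simp: pconst_1\<close>)
  have prQ: "?Q (\<Prod>v\<in>K. g v ^ k v)" if "finite K" "\<And>v. v \<in> K \<Longrightarrow> ?Q (g v)"
    for K and g :: "'v \<Rightarrow> 'v cpoly" and k
    using that
  proof (induction rule: finite_induct)
    case empty
    then show ?case using cQ[of 1] by (simp add: pconst_1)
  next
    case (insert x F)
    have "?Q (g x ^ k x)" using insert by (intro pQ) simp
    moreover have "?Q (\<Prod>v\<in>F. g v ^ k v)" using insert by simp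
    ultimately show ?case using insert(1,2) mQ by simp
  qed
  have "?Q f"
  proof (induction f rule: cpoly_monomial_induct)
    case zero
    then show ?case using cQ[of 0] by (simp add: pconst_0)
  next
    case (single m a)
    then have "w \<in> V" if "w \<in> Poly_Mapping.keys m" for w using V that by (auto simp: pvars_def)
    then have "?Q (pvar w)" if "w \<in> Poly_Mapping.keys m" for w using v that by (simp add: pvars_pvar)
    then show ?case unfolding single_monomial_prod by (intro mQ cQ prQ) auto
  qed (use aQ in blast)
  then show ?thesis ..
qed

section \<open>Evaluation and substitution as ring homomorphisms\<close>

definition psubst :: "('v \<Rightarrow> 'w cpoly) \<Rightarrow> 'v cpoly \<Rightarrow> 'w cpoly" where
  "psubst \<sigma> f = (\<Sum>m\<in>Poly_Mapping.keys f. pconst (Poly_Mapping.lookup f m) *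
                  (\<Prod>v\<in>Poly_Mapping.keys m. \<sigma> v ^ Poly_Mapping.lookup m v))"

text \<open>Natural exponents cannot cancel, so the support of \<open>m + n\<close> is the union of
  the two supports, and both products extend to it by factors with exponent 0.\<close>

lemma monomial_value_add:
  fixes x :: "'v \<Rightarrow> 'b::comm_monoid_mult" and m n :: "'v \<Rightarrow>\<^sub>0 nat"
  shows "(\<Prod>v\<in>Poly_Mapping.keys (m + n). x v ^ Poly_Mapping.lookup (m + n) v) =
    (\<Prod>v\<in>Poly_Mapping.keys m. x v ^ Poly_Mapping.lookup m v) *
    (\<Prod>v\<in>Poly_Mapping.keys n. x v ^ Poly_Mapping.lookup n v)"
proof -
  have *: "(\<Prod>v\<in>Poly_Mapping.keys m. x v ^ Poly_Mapping.lookup m v) =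
      (\<Prod>v\<in>Poly_Mapping.keys (m + n). x v ^ Poly_Mapping.lookup m v)"
    by (rule prod.mono_neutral_left) (auto simp: keys_monomial_add in_keys_iff)
  have **: "(\<Prod>v\<in>Poly_Mapping.keys n. x v ^ Poly_Mapping.lookup n v) =
      (\<Prod>v\<in>Poly_Mapping.keys (m + n). x v ^ Poly_Mapping.lookup n v)"
    by (rule prod.mono_neutral_left) (auto simp: keys_monomial_add in_keys_iff)
  show ?thesis unfolding * ** by (simp add: prod.distrib lookup_add power_add)
qed

lemma peval_add: "peval x (f + g) = peval x f + peval x g"
  unfolding peval_def
  by (rule setsum_keys_plus_distrib[where f = "\<lambda>m c. c * (\<Prod>v\<in>Poly_Mapping.keys m. x v ^ Poly_Mapping.lookup m v)"])
    (simp_all add: distrib_right)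

lemma psubst_add: "psubst \<sigma> (f + g) = psubst \<sigma> f + psubst \<sigma> g"
  unfolding psubst_def
  by (rule setsum_keys_plus_distrib[where f = "\<lambda>m c. pconst c * (\<Prod>v\<in>Poly_Mapping.keys m. \<sigma> v ^ Poly_Mapping.lookup m v)"])
    (simp_all add: distrib_right pconst_add pconst_0)

lemma peval_zero [simp]: "peval x 0 = 0"
  by (simp add: peval_def)

lemma psubst_zero [simp]: "psubst \<sigma> 0 = 0"
  by (simp add: psubst_def)

lemma peval_single:
  "peval x (Poly_Mapping.single m a) = a * (\<Prod>v\<in>Poly_Mapping.keys m. x v ^ Poly_Mapping.lookup m v)"
  by (simp add: peval_def)

lemma psubst_single:
  "psubst \<sigma> (Poly_Mapping.single m a) = pconst a * (\<Prod>v\<in>Poly_Mapping.keys m. \<sigma> v ^ Poly_Mapping.lookup m v)"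
  by (simp add: psubst_def pconst_0)

lemma peval_mult: "peval x (f * g) = peval x f * peval x g"
proof (induction f rule: cpoly_monomial_induct)
  case (single m a)
  show ?case
  proof (induction g rule: cpoly_monomial_induct)
    case (single n b)
    show ?case by (simp add: mult_single peval_single monomial_value_add algebra_simps)
  qed (simp_all add: distrib_left peval_add)
qed (simp_all add: distrib_right peval_add)

lemma psubst_mult: "psubst \<sigma> (f * g) = psubst \<sigma> f * psubst \<sigma> g"
proof (induction f rule: cpoly_monomial_induct)
  case (single m a)
  show ?case
  proof (induction g rule: cpoly_monomial_induct)
    case (single n b)
    show ?case by (simp add: mult_single psubst_single monomial_value_add pconst_mult algebra_simps)
  qed (simp_all add: distrib_left psubst_add)
qed (simp_all add: distrib_right psubst_add)

lemma peval_pconst [simp]: "peval x (pconst c) = c"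
  by (simp add: peval_single pconst_def)

lemma psubst_pconst [simp]: "psubst \<sigma> (pconst c) = pconst c"
  unfolding pconst_def[of c] psubst_single by (simp add: pconst_def)

lemma peval_one [simp]: "peval x 1 = 1"
  using peval_pconst[of x 1] by (simp add: pconst_1)

lemma psubst_one [simp]: "psubst \<sigma> 1 = 1"
  using psubst_pconst[of \<sigma> 1] by (simp add: pconst_1)

lemma peval_pvar [simp]: "peval x (pvar v) = x v"
  by (simp add: pvar_def peval_single)

lemma psubst_pvar [simp]: "psubst \<sigma> (pvar v) = \<sigma> v"
  by (simp add: pvar_def psubst_single pconst_1)

lemma peval_uminus: "peval x (- f) = - peval x f"
  using peval_add[of x f "- f"] by (simp add: eq_neg_iff_add_eq_0 add.commute)

lemma peval_diff: "peval x (f - g) = peval x f - peval x g"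
  using peval_add[of x f "- g"] by (simp add: peval_uminus)

lemma psubst_uminus: "psubst \<sigma> (- f) = - psubst \<sigma> f"
  using psubst_add[of \<sigma> f "- f"] by (simp add: eq_neg_iff_add_eq_0 add.commute)

lemma psubst_diff: "psubst \<sigma> (f - g) = psubst \<sigma> f - psubst \<sigma> g"
  using psubst_add[of \<sigma> f "- g"] by (simp add: psubst_uminus)

lemma peval_sum: "peval x (sum f A) = (\<Sum>i\<in>A. peval x (f i))"
  by (induction A rule: infinite_finite_induct) (simp_all add: peval_add)

lemmas peval_simps = peval_add peval_mult peval_uminus peval_diff peval_sum

lemma peval_psubst: "peval x (psubst \<sigma> f) = peval (\<lambda>v. peval x (\<sigma> v)) f"
  using subset_UNIV[of "pvars f"]
  by (induction rule: cpoly_induct) (simp_all add: peval_simps psubst_add psubst_mult)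

lemma peval_cong: "(\<And>v. v \<in> pvars f \<Longrightarrow> x v = y v) \<Longrightarrow> peval x f = peval y f"
  unfolding peval_def by (intro sum.cong arg_cong2[where f = "(*)"] prod.cong) (fastforce simp: pvars_def)+

lemma pvars_psubst:
  assumes "pvars f \<subseteq> V" "\<And>v. v \<in> V \<Longrightarrow> pvars (\<sigma> v) \<subseteq> W"
  shows "pvars (psubst \<sigma> f) \<subseteq> W"
  using assms(1)
proof (induction rule: cpoly_induct)
  case (add f g)
  then show ?case using pvars_add[of "psubst \<sigma> f" "psubst \<sigma> g"] by (auto simp: psubst_add)
next
  case (mult f g)
  then show ?case using pvars_mult[of "psubst \<sigma> f" "psubst \<sigma> g"] by (auto simp: psubst_mult)
qed (use assms(2) in auto)


subsection \<open>Partial derivatives\<close>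

lemma partial_add: "partial v (f + g) = partial v f + partial v g"
  unfolding partial_def
  by (rule setsum_keys_plus_distrib[where f = "\<lambda>m c. Poly_Mapping.single (m - Poly_Mapping.single v 1)
       (of_nat (Poly_Mapping.lookup m v) * c)"])
    (simp_all add: distrib_left single_add)

lemma partial_zero [simp]: "partial v 0 = 0"
  by (simp add: partial_def)

lemma partial_single: "partial v (Poly_Mapping.single m a) =
    Poly_Mapping.single (m - Poly_Mapping.single v 1) (of_nat (Poly_Mapping.lookup m v) * a)"
  by (simp add: partial_def)

lemma partial_mult: "partial v (f * g) = partial v f * g + f * partial v g"
proof (induction f rule: cpoly_monomial_induct)
  case (single m a)
  show ?case
  proof (induction g rule: cpoly_monomial_induct)
    case (single n b)
    \<comment> \<open>Subtraction of exponents is truncated at 0, so this needs \<open>v\<close> to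
      occur in \<open>m\<close>. When it does not, the coefficient of the derivative is 0 and the
      wrong monomial is harmless.\<close>
    have *: "(m + n) - Poly_Mapping.single v 1 = (m - Poly_Mapping.single v 1) + n"
      if "Poly_Mapping.lookup m v \<noteq> 0" for m n :: "'a \<Rightarrow>\<^sub>0 nat"
      using that by (intro poly_mapping_eqI) (auto simp: lookup_minus lookup_add lookup_single when_def)
    have 1: "partial v (Poly_Mapping.single m a) * Poly_Mapping.single n b =
        Poly_Mapping.single (m + n - Poly_Mapping.single v 1) (of_nat (Poly_Mapping.lookup m v) * (a * b))"
      by (cases "Poly_Mapping.lookup m v = 0") (simp_all add: partial_single mult_single *[simplified] mult.assoc)
    have 2: "Poly_Mapping.single m a * partial v (Poly_Mapping.single n b) =
        Poly_Mapping.single (m + n - Poly_Mapping.single v 1) (of_nat (Poly_Mapping.lookup n v) * (a * b))"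
      by (cases "Poly_Mapping.lookup n v = 0")
        (simp_all add: partial_single mult_single *[of n m, simplified, unfolded add.commute[of n m]] algebra_simps)
    show ?case unfolding 1 2
      by (simp add: mult_single partial_single lookup_add algebra_simps flip: single_add)
  qed (simp_all add: distrib_left partial_add)
qed (simp_all add: distrib_right partial_add)

lemma partial_pconst [simp]: "partial v (pconst c) = 0"
  by (simp add: pconst_def partial_single)

lemma partial_pvar_if: "partial v (pvar w) = (if v = w then 1 else 0)"
  by (auto simp: partial_def pvar_def lookup_single when_def)

lemma partial_notin_pvars: "v \<notin> pvars f \<Longrightarrow> partial v f = 0"
  unfolding partial_def by (rule sum.neutral) (auto simp: pvars_def in_keys_iff)

lemma pvars_partial: "pvars (partial v f) \<subseteq> pvars f"
  unfolding partial_def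
proof (rule pvars_sum)
  fix m assume "m \<in> Poly_Mapping.keys f"
  moreover have "Poly_Mapping.keys (m - Poly_Mapping.single v 1) \<subseteq> Poly_Mapping.keys m"
    by (auto simp: in_keys_iff lookup_minus)
  ultimately show "pvars (Poly_Mapping.single (m - Poly_Mapping.single v 1)
      (of_nat (Poly_Mapping.lookup m v) * Poly_Mapping.lookup f m)) \<subseteq> pvars f"
    by (auto simp: pvars_def split: if_splits)
qed

lemma lookup_partial:
  "Poly_Mapping.lookup (partial v f) m =
     of_nat (Suc (Poly_Mapping.lookup m v)) * Poly_Mapping.lookup f (m + Poly_Mapping.single v 1)"
proof (induction f rule: cpoly_monomial_induct)
  case (single n a)
  have "(n - Poly_Mapping.single v 1 = m \<and> Poly_Mapping.lookup n v \<noteq> 0) \<longleftrightarrow> n = m + Poly_Mapping.single v 1"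
    by (auto simp: poly_mapping_eq_iff fun_eq_iff lookup_minus lookup_add lookup_single when_def split: if_splits)
  then show ?case
    by (auto simp: partial_single lookup_single when_def lookup_add)
qed (simp_all add: partial_add lookup_add distrib_left)

text \<open>The chain rule along a curve. It is the bridge from functions to algebra: constancy or
  vanishing along a line or a gauge orbit becomes a statement about \<open>partial\<close>, and
  conversely.\<close>

lemma has_field_derivative_peval:
  assumes V: "finite V" "pvars f \<subseteq> V"
    and x: "\<And>v. v \<in> V \<Longrightarrow> ((\<lambda>t. x t v) has_field_derivative x' v) (at t)"
  shows "((\<lambda>t. peval (x t) f) has_field_derivative (\<Sum>v\<in>V. peval (x t) (partial v f) * x' v)) (at t)"
  using V(2)
proof (induction rule: cpoly_induct)
  case (var v)
  then have "(\<Sum>u\<in>V. peval (x t) (partial u (pvar v)) * x' u) = x' v"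
    using V(1) by (simp add: partial_pvar_if if_distrib[of "peval _"] if_distrib[of "\<lambda>c. c * _"] cong: if_cong)
  then show ?case using x[OF var] by simp
next
  case (add f g)
  from DERIV_add[OF add(3,4)] show ?case
    by (simp add: peval_add partial_add algebra_simps sum.distrib)
next
  case (mult f g)
  have "(\<Sum>v\<in>V. peval (x t) (partial v (f * g)) * x' v) =
      (\<Sum>v\<in>V. peval (x t) (partial v f) * x' v) * peval (x t) g +
      (\<Sum>v\<in>V. peval (x t) (partial v g) * x' v) * peval (x t) f"
    by (simp add: peval_simps partial_mult algebra_simps sum.distrib sum_distrib_left sum_distrib_right)
  with DERIV_mult[OF mult(3,4)] show ?case by (simp add: peval_mult)
qed simp

text \<open>Induction on the degree of the monomial. Up to a positive integer factor, a coefficient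
  of \<open>f\<close> is a coefficient of lower degree in a partial derivative, which again vanishes
  everywhere; degree 0 is evaluation at the origin.\<close>

lemma peval_eq_zero_imp_eq_zero:
  fixes f :: "'v cpoly"
  assumes "\<And>x. peval x f = 0"
  shows "f = 0"
proof -
  have "Poly_Mapping.lookup f m = 0" if "\<And>x. peval x f = 0" for m and f :: "'v cpoly"
    using that
  proof (induction "\<Sum>v\<in>Poly_Mapping.keys m. Poly_Mapping.lookup m v" arbitrary: m f)
    case 0
    then have "m = 0" by (auto simp: in_keys_iff poly_mapping_eq_iff fun_eq_iff)
    have "peval (\<lambda>v. 0) f = (\<Sum>m\<in>Poly_Mapping.keys f. if m = 0 then Poly_Mapping.lookup f 0 else 0)"
      unfolding peval_def
    proof (intro sum.cong refl)
      fix n :: "'v \<Rightarrow>\<^sub>0 nat"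
      show "Poly_Mapping.lookup f n * (\<Prod>v\<in>Poly_Mapping.keys n. 0 ^ Poly_Mapping.lookup n v) =
          (if n = 0 then Poly_Mapping.lookup f 0 else 0)"
      proof (cases "n = 0")
        case False
        then have "Poly_Mapping.keys n \<noteq> {}" by simp
        then show ?thesis using False by (auto simp: in_keys_iff[of _ n] power_0_left prod_zero_iff)
      qed simp
    qed
    then show ?case using 0(2) \<open>m = 0\<close> by (simp add: in_keys_iff split: if_splits)
  next
    case (Suc d)
    then obtain v where v: "v \<in> Poly_Mapping.keys m"
      by (metis nat.distinct(1) sum.empty equals0I)
    define n where "n = m - Poly_Mapping.single v 1"
    have m: "m = n + Poly_Mapping.single v 1"
      using v by (intro poly_mapping_eqI) (auto simp: n_def lookup_add lookup_minus lookup_single when_def in_keys_iff)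
    have "(\<Sum>w\<in>Poly_Mapping.keys m. Poly_Mapping.lookup m w) =
        (\<Sum>w\<in>Poly_Mapping.keys m. Poly_Mapping.lookup n w) + (\<Sum>w\<in>Poly_Mapping.keys m. if w = v then 1 else 0)"
      unfolding m lookup_add sum.distrib by (simp add: lookup_single when_def eq_commute)
    also have "(\<Sum>w\<in>Poly_Mapping.keys m. Poly_Mapping.lookup n w) = (\<Sum>w\<in>Poly_Mapping.keys n. Poly_Mapping.lookup n w)"
      by (rule sum.mono_neutral_right) (auto simp: m keys_monomial_add in_keys_iff)
    finally have d: "d = (\<Sum>w\<in>Poly_Mapping.keys n. Poly_Mapping.lookup n w)"
      using Suc(2) v by simp
    have "peval x (partial v f) = 0" for x
    proof -
      have "((\<lambda>t. peval (x(v := t)) f) has_field_derivative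
          (\<Sum>w\<in>insert v (pvars f). peval (x(v := x v)) (partial w f) * (if w = v then 1 else 0))) (at (x v))"
        by (rule has_field_derivative_peval) (auto simp: fun_upd_apply)
      moreover have "(\<lambda>t. peval (x(v := t)) f) = (\<lambda>t. 0)" using Suc(3) by simp
      ultimately have "(\<Sum>w\<in>insert v (pvars f). peval (x(v := x v)) (partial w f) * (if w = v then 1 else 0)) = 0"
        using DERIV_const[of 0 "at (x v)"] DERIV_unique by metis
      then show ?thesis by (simp add: if_distrib cong: if_cong)
    qed
    from Suc(1)[OF d this] have "of_nat (Suc (Poly_Mapping.lookup n v)) * Poly_Mapping.lookup f m = 0"
      unfolding lookup_partial m by simp
    then show ?case using of_nat_neq_0 by (metis mult_eq_0_iff)
  qed
  then show ?thesis using assms by (intro poly_mapping_eqI) simp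
qed


subsection \<open>Brackets determined by the variables\<close>

text \<open>Cancellation can make \<open>pvars (f + g)\<close> or \<open>pvars (f * g)\<close>
  smaller than the union. Enlarging the index sets lets brackets of different polynomials be
  compared as sums over the same set.\<close>

lemma poly_bracket_superset:
  assumes "finite U" "finite V" "pvars f \<subseteq> U" "pvars g \<subseteq> V"
  shows "poly_bracket \<pi> f g = (\<Sum>u\<in>U. \<Sum>v\<in>V. partial u f * partial v g * \<pi> u v)"
proof -
  have "(\<Sum>u\<in>U. \<Sum>v\<in>V. partial u f * partial v g * \<pi> u v) =
      (\<Sum>u\<in>U. \<Sum>v\<in>pvars g. partial u f * partial v g * \<pi> u v)"
    using assms by (intro sum.cong refl sum.mono_neutral_right) (auto simp: partial_notin_pvars)
  also have "\<dots> = (\<Sum>u\<in>pvars f. \<Sum>v\<in>pvars g. partial u f * partial v g * \<pi> u v)"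
    using assms by (intro sum.mono_neutral_right) (auto simp: partial_notin_pvars)
  finally show ?thesis by (simp add: poly_bracket_def)
qed

lemma poly_bracket_add_left: "poly_bracket \<pi> (f + g) h = poly_bracket \<pi> f h + poly_bracket \<pi> g h"
proof -
  let ?U = "pvars f \<union> pvars g"
  have *: "poly_bracket \<pi> k h = (\<Sum>u\<in>?U. \<Sum>v\<in>pvars h. partial u k * partial v h * \<pi> u v)"
    if "k \<in> {f, g, f + g}" for k
    using that pvars_add[of f g] by (intro poly_bracket_superset) auto
  show ?thesis by (simp add: * partial_add distrib_right sum.distrib)
qed

lemma poly_bracket_add_right: "poly_bracket \<pi> h (f + g) = poly_bracket \<pi> h f + poly_bracket \<pi> h g"
proof -
  let ?V = "pvars f \<union> pvars g"
  have *: "poly_bracket \<pi> h k = (\<Sum>u\<in>pvars h. \<Sum>v\<in>?V. partial u h * partial v k * \<pi> u v)"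
    if "k \<in> {f, g, f + g}" for k
    using that pvars_add[of f g] by (intro poly_bracket_superset) auto
  show ?thesis by (simp add: * partial_add distrib_right distrib_left sum.distrib)
qed

lemma poly_bracket_mult_left:
  "poly_bracket \<pi> (f * g) h = poly_bracket \<pi> f h * g + f * poly_bracket \<pi> g h"
proof -
  let ?U = "pvars f \<union> pvars g"
  have *: "poly_bracket \<pi> k h = (\<Sum>u\<in>?U. \<Sum>v\<in>pvars h. partial u k * partial v h * \<pi> u v)"
    if "k \<in> {f, g, f * g}" for k
    using that pvars_mult[of f g] by (intro poly_bracket_superset) auto
  show ?thesis
    by (simp add: * partial_mult algebra_simps sum.distrib sum_distrib_left)
qed

lemma poly_bracket_mult_right:
  "poly_bracket \<pi> h (f * g) = poly_bracket \<pi> h f * g + f * poly_bracket \<pi> h g"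
proof -
  let ?V = "pvars f \<union> pvars g"
  have *: "poly_bracket \<pi> h k = (\<Sum>u\<in>pvars h. \<Sum>v\<in>?V. partial u h * partial v k * \<pi> u v)"
    if "k \<in> {f, g, f * g}" for k
    using that pvars_mult[of f g] by (intro poly_bracket_superset) auto
  show ?thesis
    by (simp add: * partial_mult algebra_simps sum.distrib sum_distrib_left)
qed

lemma poly_bracket_const [simp]:
  "poly_bracket \<pi> (pconst c) f = 0" "poly_bracket \<pi> f (pconst c) = 0"
  by (simp_all add: poly_bracket_def)

lemma poly_bracket_zero [simp]: "poly_bracket \<pi> 0 f = 0" "poly_bracket \<pi> f 0 = 0"
  by (simp_all add: poly_bracket_def)

lemma poly_bracket_one [simp]: "poly_bracket \<pi> 1 f = 0" "poly_bracket \<pi> f 1 = 0"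
  by (simp_all add: poly_bracket_def)

lemma poly_bracket_uminus_left: "poly_bracket \<pi> (- f) g = - poly_bracket \<pi> f g"
  using poly_bracket_add_left[of \<pi> f "- f" g] by (simp add: eq_neg_iff_add_eq_0 add.commute)

lemma poly_bracket_uminus_right: "poly_bracket \<pi> f (- g) = - poly_bracket \<pi> f g"
  using poly_bracket_add_right[of \<pi> f g "- g"] by (simp add: eq_neg_iff_add_eq_0 add.commute)

lemma poly_bracket_diff_left: "poly_bracket \<pi> (f - g) h = poly_bracket \<pi> f h - poly_bracket \<pi> g h"
  using poly_bracket_add_left[of \<pi> f "- g" h] by (simp add: poly_bracket_uminus_left)

lemma poly_bracket_diff_right: "poly_bracket \<pi> h (f - g) = poly_bracket \<pi> h f - poly_bracket \<pi> h g"
  using poly_bracket_add_right[of \<pi> h f "- g"] by (simp add: poly_bracket_uminus_right)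

lemma poly_bracket_sum_left: "poly_bracket \<pi> (sum f A) g = (\<Sum>i\<in>A. poly_bracket \<pi> (f i) g)"
  by (induction A rule: infinite_finite_induct) (simp_all add: poly_bracket_add_left)

lemma poly_bracket_sum_right: "poly_bracket \<pi> g (sum f A) = (\<Sum>i\<in>A. poly_bracket \<pi> g (f i))"
  by (induction A rule: infinite_finite_induct) (simp_all add: poly_bracket_add_right)

lemmas poly_bracket_simps = poly_bracket_add_left poly_bracket_add_right
  poly_bracket_mult_left poly_bracket_mult_right poly_bracket_uminus_left poly_bracket_uminus_right
  poly_bracket_diff_left poly_bracket_diff_right poly_bracket_sum_left poly_bracket_sum_right

lemma poly_bracket_pvar_left:
  assumes "finite V" "pvars g \<subseteq> V"
  shows "poly_bracket \<pi> (pvar u) g = (\<Sum>v\<in>V. partial v g * \<pi> u v)"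
  using poly_bracket_superset[of "{u}" V "pvar u" g \<pi>] assms by (simp add: pvars_pvar partial_pvar)

lemma poly_bracket_expand_left:
  assumes "finite U" "pvars f \<subseteq> U"
  shows "poly_bracket \<pi> f g = (\<Sum>u\<in>U. partial u f * poly_bracket \<pi> (pvar u) g)"
  using assms poly_bracket_superset[of U "pvars g" f g \<pi>]
  by (simp add: poly_bracket_pvar_left[of "pvars g"] sum_distrib_left mult.assoc)

lemma poly_bracket_psubst_left:
  assumes U: "finite U" and "pvars f \<subseteq> U"
  shows "poly_bracket \<pi> (psubst \<sigma> f) h = (\<Sum>u\<in>U. psubst \<sigma> (partial u f) * poly_bracket \<pi> (\<sigma> u) h)"
  using assms(2)
proof (induction rule: cpoly_induct)
  case (var v)
  then show ?case using U
    by (simp add: partial_pvar_if if_distrib[of "psubst _"] if_distrib[of "\<lambda>c. c * _"] cong: if_cong)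
qed (simp_all add: psubst_add psubst_mult poly_bracket_simps partial_add partial_mult
    algebra_simps sum.distrib sum_distrib_left)

lemma poly_bracket_psubst_right:
  assumes U: "finite U" and "pvars f \<subseteq> U"
  shows "poly_bracket \<pi> h (psubst \<sigma> f) = (\<Sum>u\<in>U. psubst \<sigma> (partial u f) * poly_bracket \<pi> h (\<sigma> u))"
  using assms(2)
proof (induction rule: cpoly_induct)
  case (var v)
  then show ?case using U
    by (simp add: partial_pvar_if if_distrib[of "psubst _"] if_distrib[of "\<lambda>c. c * _"] cong: if_cong)
qed (simp_all add: psubst_add psubst_mult poly_bracket_simps partial_add partial_mult
    algebra_simps sum.distrib sum_distrib_left)

text \<open>Hence a substitution respects two brackets as soon as it does so on pairs of
  variables.\<close>

lemma poly_bracket_psubst: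
  "poly_bracket \<pi> (psubst \<sigma> f) (psubst \<sigma> g) =
     (\<Sum>u\<in>pvars f. \<Sum>v\<in>pvars g.
        psubst \<sigma> (partial u f) * psubst \<sigma> (partial v g) * poly_bracket \<pi> (\<sigma> u) (\<sigma> v))"
  unfolding poly_bracket_psubst_left[OF finite_pvars order_refl, of \<pi> \<sigma> f "psubst \<sigma> g"]
  by (simp add: poly_bracket_psubst_right[of "pvars g" g] sum_distrib_left mult.assoc)

lemma pvars_poly_bracket:
  assumes "\<And>u v. \<lbrakk>u \<in> V; v \<in> V\<rbrakk> \<Longrightarrow> pvars (\<pi> u v) \<subseteq> V" "pvars f \<subseteq> V" "pvars g \<subseteq> V"
  shows "pvars (poly_bracket \<pi> f g) \<subseteq> V"
  unfolding poly_bracket_def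
proof (intro pvars_sum)
  fix u v assume "u \<in> pvars f" "v \<in> pvars g"
  then have "pvars (\<pi> u v) \<subseteq> V" using assms by blast
  moreover have "pvars (partial u f) \<subseteq> V" "pvars (partial v g) \<subseteq> V"
    by (rule order_trans[OF pvars_partial], rule assms)+
  ultimately show "pvars (partial u f * partial v g * \<pi> u v) \<subseteq> V"
    using pvars_mult[of "partial u f * partial v g" "\<pi> u v"] pvars_mult[of "partial u f" "partial v g"]
    by blast
qed

lemma poly_bracket_antisym:
  assumes "\<And>u v. \<pi> u v = - \<pi> v u"
  shows "poly_bracket \<pi> f g = - poly_bracket \<pi> g f"
proof -
  have "poly_bracket \<pi> f g = (\<Sum>v\<in>pvars g. \<Sum>u\<in>pvars f. partial u f * partial v g * \<pi> u v)"
    unfolding poly_bracket_def by (rule sum.swap)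
  also have "\<dots> = (\<Sum>v\<in>pvars g. \<Sum>u\<in>pvars f. - (partial v g * partial u f * \<pi> v u))"
    by (intro sum.cong refl) (subst assms, simp add: mult.commute)
  finally show ?thesis by (simp add: poly_bracket_def sum_negf)
qed

text \<open>The Jacobiator is a derivation in its first argument: the four mixed terms cancel
  pairwise by antisymmetry. Its cyclic symmetry brings each argument in turn to the first place, so
  its values on variables decide.\<close>

lemma poly_bracket_jacobi:
  fixes \<pi> :: "'v \<Rightarrow> 'v \<Rightarrow> 'v cpoly"
  assumes anti: "\<And>u v. \<pi> u v = - \<pi> v u"
    and jac: "\<And>u v w. poly_bracket \<pi> (pvar u) (\<pi> v w) + poly_bracket \<pi> (pvar v) (\<pi> w u)
        + poly_bracket \<pi> (pvar w) (\<pi> u v) = 0"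
  shows "poly_bracket \<pi> f (poly_bracket \<pi> g h) + poly_bracket \<pi> g (poly_bracket \<pi> h f)
        + poly_bracket \<pi> h (poly_bracket \<pi> f g) = 0"
proof -
  let ?B = "poly_bracket \<pi>"
  define J where "J f g h = ?B f (?B g h) + ?B g (?B h f) + ?B h (?B f g)" for f g h
  have cyc: "J f g h = J g h f" for f g h by (simp add: J_def algebra_simps)
  have ind: "J f g h = 0" if "\<And>u. J (pvar u) g h = 0" for f g h
    using subset_UNIV[of "pvars f"]
  proof (induction rule: cpoly_induct)
    case (mult f k)
    have a: "?B f' g' = - ?B g' f'" for f' g' by (rule poly_bracket_antisym) (rule anti)
    have "J (f * k) g h = J f g h * k + f * J k g h
        + (?B h f * ?B g k + ?B g f * ?B h k + ?B f g * ?B h k + ?B h f * ?B k g)"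
      by (simp add: J_def poly_bracket_simps algebra_simps)
    also have "\<dots> = 0" using mult a[of g f] a[of k g] by simp
    finally show ?case .
  next
    case (add f k)
    have "J (f + k) g h = J f g h + J k g h" by (simp add: J_def poly_bracket_simps algebra_simps)
    then show ?case using add by simp
  qed (use that in \<open>simp_all add: J_def\<close>)
  have 1: "J (pvar u) (pvar v) (pvar w) = 0" for u v w
    using jac by (simp add: J_def poly_bracket_pvar)
  have 2: "J (pvar u) (pvar v) h = 0" for u v h
    using ind[of "pvar u" "pvar v" h] 1 cyc by metis
  have 3: "J (pvar u) g h = 0" for u g h
    using ind[of h "pvar u" g] 2 cyc by metis
  show ?thesis using ind[of g h f] 3 by (simp add: J_def)
qed


section \<open>Structural facts about Poisson algebras\<close>

lemma cring_complex_ring: "cring complex_ring"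
  by (rule cringI[OF abelian_groupI comm_monoidI])
    (auto simp: complex_ring_def algebra_simps intro: exI[of _ "- _"])

lemma cring_cong:
  assumes R: "cring R" and same: "carrier Q = carrier R" "monoid.mult Q = monoid.mult R"
    "monoid.one Q = monoid.one R" "ring.zero Q = ring.zero R" "ring.add Q = ring.add R"
  shows "cring Q"
proof -
  interpret R: cring R by fact
  show ?thesis
    by (rule cringI[OF abelian_groupI comm_monoidI])
      (auto simp: same R.a_assoc R.m_assoc R.l_distr intro: R.a_comm R.m_comm R.add.l_inv_ex)
qed

lemma algebra_poly_poisson: "algebra complex_ring (poly_poisson V \<pi>)"
proof -
  have neg: "\<exists>g. pvars g \<subseteq> V \<and> f + g = 0" if "pvars f \<subseteq> V" for f :: "'a cpoly"
    using that by (intro exI[of _ "- f"]) simp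
  have add: "pvars (f + g) \<subseteq> V" and mult: "pvars (f * g) \<subseteq> V"
    if "pvars f \<subseteq> V" "pvars g \<subseteq> V" for f g :: "'a cpoly"
    using that pvars_add[of f g] pvars_mult[of f g] by blast+
  have pc: "pvars (pconst c) \<subseteq> V" for c :: complex by simp
  have cr: "cring (poly_poisson V \<pi>)"
    by (rule cringI[OF abelian_groupI comm_monoidI])
      (simp_all add: poly_poisson_def algebra_simps add mult neg)
  show ?thesis
    by (rule algebraI[OF cring_complex_ring cr])
      (auto simp: poly_poisson_def complex_ring_def pconst_add pconst_mult pconst_1 algebra_simps
        dest: subsetD[OF mult[OF _ pc]])
qed

text \<open>Every axiom is an equation in \<open>Q\<close>, and the injective map \<open>h\<close>
  turns it into the same axiom of \<open>P\<close>.\<close>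

lemma poisson_algebra_transport:
  fixes P :: "('a, 'm) poisson_struct_scheme" and Q :: "('b, 'n) poisson_struct_scheme"
  assumes P: "poisson_algebra P" and Q: "cring Q" and h: "h \<in> ring_iso Q P"
    and smult: "\<And>c x. x \<in> carrier Q \<Longrightarrow> c \<odot>\<^bsub>Q\<^esub> x \<in> carrier Q \<and> h (c \<odot>\<^bsub>Q\<^esub> x) = c \<odot>\<^bsub>P\<^esub> h x"
    and bracket: "\<And>x y. \<lbrakk>x \<in> carrier Q; y \<in> carrier Q\<rbrakk>
      \<Longrightarrow> pbracket Q x y \<in> carrier Q \<and> h (pbracket Q x y) = pbracket P (h x) (h y)"
  shows "poisson_algebra Q"
proof -
  interpret P: poisson_algebra P by fact
  interpret Q: cring Q by fact
  interpret h: ring_hom_ring Q P h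
    using h P.ring_axioms Q.ring_axioms by (intro ring_hom_ringI2) (auto simp: ring_iso_def)
  have inj: "x = y" if "h x = h y" "x \<in> carrier Q" "y \<in> carrier Q" for x y
    using h that by (auto simp: ring_iso_def bij_betw_def inj_on_def)
  note [simp] = smult bracket
  have UN: "c \<in> carrier complex_ring" for c by (simp add: complex_ring_def)
  have alg: "algebra complex_ring Q"
  proof (rule algebraI[OF cring_complex_ring Q])
    show "a \<odot>\<^bsub>Q\<^esub> x \<in> carrier Q" if "x \<in> carrier Q" for a x using that by simp
  qed (rule inj; simp add: UN P.smult_l_distr P.smult_r_distr P.smult_assoc1 P.smult_assoc2)+
  have "poisson_algebra_axioms Q"
  proof
    show "pbracket Q x y \<in> carrier Q" if "x \<in> carrier Q" "y \<in> carrier Q" for x y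
      using that by simp
    show "pbracket Q x y = \<ominus>\<^bsub>Q\<^esub> pbracket Q y x" if "x \<in> carrier Q" "y \<in> carrier Q" for x y
      using that P.pb_antisym[of "h x" "h y"] by (intro inj) simp_all
  qed (rule inj; simp add: UN P.pb_add P.pb_smult P.pb_leibniz P.pb_jacobi)+
  with alg show ?thesis by (simp add: poisson_algebra_def)
qed

text \<open>Only the image of \<open>\<psi>\<close> is assumed to be a Poisson algebra; the axioms for the quotient are
  pulled back from it.\<close>

lemma poisson_isomorphic_poisson_quot:
  fixes P :: "('a, 'm) poisson_struct_scheme" and W :: "('b, 'n) poisson_struct_scheme"
  assumes W: "poisson_algebra W" and P: "cring P"
    and hom: "\<psi> \<in> ring_hom P W" and surj: "\<psi> ` carrier P = carrier W"
    and ker: "a_kernel P W \<psi> = I"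
    and smult: "\<And>c x. x \<in> carrier P \<Longrightarrow> c \<odot>\<^bsub>P\<^esub> x \<in> carrier P \<and> \<psi> (c \<odot>\<^bsub>P\<^esub> x) = c \<odot>\<^bsub>W\<^esub> \<psi> x"
    and bracket: "\<And>x y. \<lbrakk>x \<in> carrier P; y \<in> carrier P\<rbrakk>
      \<Longrightarrow> pbracket P x y \<in> carrier P \<and> \<psi> (pbracket P x y) = pbracket W (\<psi> x) (\<psi> y)"
  shows "poisson_isomorphic W (poisson_quot P I)"
proof -
  interpret W: poisson_algebra W by fact
  interpret P: cring P by fact
  interpret \<psi>: ring_hom_ring P W \<psi>
    using hom W.ring_axioms P.ring_axioms by (intro ring_hom_ringI2)
  let ?Q = "poisson_quot P I"
  define g where "g X = the_elem (\<psi> ` X)" for X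
  have ideal: "ideal I P" using \<psi>.kernel_is_ideal ker by simp
  interpret ideal I P by (rule ideal)
  have same: "carrier ?Q = carrier (P Quot I)" "monoid.mult ?Q = monoid.mult (P Quot I)"
    "monoid.one ?Q = monoid.one (P Quot I)" "ring.zero ?Q = ring.zero (P Quot I)"
    "ring.add ?Q = ring.add (P Quot I)"
    by (simp_all add: poisson_quot_def)
  have iso: "g \<in> ring_iso (P Quot I) W"
    using \<psi>.FactRing_iso_set[OF surj] ker by (simp add: g_def[abs_def])
  then have isoQ: "g \<in> ring_iso ?Q W" by (simp add: ring_iso_def ring_hom_def same)
  have Qr: "cring (P Quot I)" by (rule quotient_is_cring[OF P])
  then have Q: "cring ?Q" by (rule cring_cong) (simp_all add: same)
  have gI: "g (I +>\<^bsub>P\<^esub> a) = \<psi> a" if "a \<in> carrier P" for a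
    using \<psi>.the_elem_simp[OF that] by (simp add: g_def ker)
  have carr: "\<exists>a\<in>carrier P. A = I +>\<^bsub>P\<^esub> a" if "A \<in> carrier ?Q" for A
    using that by (auto simp: same FactRing_def A_RCOSETS_def')
  have carrI: "I +>\<^bsub>P\<^esub> a \<in> carrier ?Q" if "a \<in> carrier P" for a
    using that by (auto simp: same FactRing_def A_RCOSETS_def')
  have inj: "x = y" if "g x = g y" "x \<in> carrier ?Q" "y \<in> carrier ?Q" for x y
    using isoQ that by (auto simp: ring_iso_def bij_betw_def inj_on_def)
  have mem: "a' \<in> carrier P \<and> \<psi> a' = \<psi> a" if "a' \<in> I +>\<^bsub>P\<^esub> a" "a \<in> carrier P" for a a'
  proof -
    have "a' \<in> carrier P" using that P.a_r_coset_subset_G[OF a_subset] by blast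
    moreover have "I +>\<^bsub>P\<^esub> a' = I +>\<^bsub>P\<^esub> a"
      using P.a_repr_independence[OF that a_subgroup] by simp
    ultimately show ?thesis using gI that(2) by metis
  qed
  have self: "a \<in> I +>\<^bsub>P\<^esub> a" if "a \<in> carrier P" for a using a_rcos_self that by simp
  \<comment> \<open>In \<open>poisson_quot\<close> this operation is a union over representatives.
    All of them have the same image under \<open>\<psi>\<close>, and \<open>g\<close> is injective,
    so the union is over one and the same coset. The bracket is treated alike below.\<close>
  have smultQ: "c \<odot>\<^bsub>?Q\<^esub> (I +>\<^bsub>P\<^esub> a) = I +>\<^bsub>P\<^esub> (c \<odot>\<^bsub>P\<^esub> a)" if a: "a \<in> carrier P" for c a
  proof -
    have "I +>\<^bsub>P\<^esub> (c \<odot>\<^bsub>P\<^esub> a') = I +>\<^bsub>P\<^esub> (c \<odot>\<^bsub>P\<^esub> a)" if "a' \<in> I +>\<^bsub>P\<^esub> a" for a'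
      using mem[OF that a] smult[of a' c] smult[of a c] a by (intro inj) (auto simp: gI carrI)
    then have "(\<Union>a'\<in>I +>\<^bsub>P\<^esub> a. I +>\<^bsub>P\<^esub> (c \<odot>\<^bsub>P\<^esub> a')) = (\<Union>a'\<in>I +>\<^bsub>P\<^esub> a. I +>\<^bsub>P\<^esub> (c \<odot>\<^bsub>P\<^esub> a))"
      by (rule SUP_cong[OF refl])
    also have "\<dots> = I +>\<^bsub>P\<^esub> (c \<odot>\<^bsub>P\<^esub> a)" using self[OF a] by blast
    finally show ?thesis by (simp add: poisson_quot_def)
  qed
  have bracketQ: "pbracket ?Q (I +>\<^bsub>P\<^esub> a) (I +>\<^bsub>P\<^esub> b) = I +>\<^bsub>P\<^esub> (pbracket P a b)"
    if ab: "a \<in> carrier P" "b \<in> carrier P" for a b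
  proof -
    have "I +>\<^bsub>P\<^esub> (pbracket P a' b') = I +>\<^bsub>P\<^esub> (pbracket P a b)"
      if "a' \<in> I +>\<^bsub>P\<^esub> a" "b' \<in> I +>\<^bsub>P\<^esub> b" for a' b'
      using mem[OF that(1) ab(1)] mem[OF that(2) ab(2)] bracket[of a' b'] bracket[of a b] ab
      by (intro inj) (auto simp: gI carrI)
    then have "(\<Union>a'\<in>I +>\<^bsub>P\<^esub> a. \<Union>b'\<in>I +>\<^bsub>P\<^esub> b. I +>\<^bsub>P\<^esub> pbracket P a' b') =
        (\<Union>a'\<in>I +>\<^bsub>P\<^esub> a. \<Union>b'\<in>I +>\<^bsub>P\<^esub> b. I +>\<^bsub>P\<^esub> pbracket P a b)"
      by (intro SUP_cong[OF refl])
    also have "\<dots> = I +>\<^bsub>P\<^esub> pbracket P a b" using self[OF ab(1)] self[OF ab(2)] by blast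
    finally show ?thesis by (simp add: poisson_quot_def)
  qed
  have sm: "c \<odot>\<^bsub>?Q\<^esub> x \<in> carrier ?Q \<and> g (c \<odot>\<^bsub>?Q\<^esub> x) = c \<odot>\<^bsub>W\<^esub> g x" if "x \<in> carrier ?Q" for c x
    using carr[OF that] smult by (auto simp: smultQ gI carrI)
  have br: "pbracket ?Q x y \<in> carrier ?Q \<and> g (pbracket ?Q x y) = pbracket W (g x) (g y)"
    if "x \<in> carrier ?Q" "y \<in> carrier ?Q" for x y
    using carr[OF that(1)] carr[OF that(2)] bracket by (auto simp: bracketQ gI carrI)
  have PQ: "poisson_algebra ?Q"
    by (rule poisson_algebra_transport[OF W Q isoQ]) (use sm br in blast)+
  define h where "h = inv_into (carrier ?Q) g"
  have h: "h \<in> ring_iso W ?Q"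
    using ring_iso_set_sym[OF _ isoQ] Q by (auto simp: h_def cring_def)
  have bij: "bij_betw g (carrier ?Q) (carrier W)" using isoQ by (simp add: ring_iso_def)
  have hc: "h x \<in> carrier ?Q" and gh: "g (h x) = x" if "x \<in> carrier W" for x
    using that bij by (auto simp: h_def bij_betw_def inv_into_into f_inv_into_f)
  have "h \<in> poisson_iso W ?Q"
    unfolding poisson_iso_def
  proof (intro CollectI conjI allI ballI)
    show "h (c \<odot>\<^bsub>W\<^esub> x) = c \<odot>\<^bsub>?Q\<^esub> h x" if "x \<in> carrier W" for c x
      using sm[OF hc[OF that], of c] hc gh that W.smult_closed[of c x]
      by (intro inj) (auto simp: complex_ring_def)
    show "h (pbracket W x y) = pbracket ?Q (h x) (h y)" if "x \<in> carrier W" "y \<in> carrier W" for x y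
      using br[OF hc[OF that(1)] hc[OF that(2)]] hc gh that W.pb_closed[of x y]
      by (intro inj) auto
  qed (rule h)
  then show ?thesis using W PQ by (auto simp: poisson_isomorphic_def)
qed


section \<open>Inverting a solution of the Yangian relations\<close>

unbundle no vec_syntax
unbundle fps_syntax

text \<open>Read S, X as taken at u and the primed letters at v. The arrays \<open>bss\<close>,
  \<open>bsx\<close>, \<open>bxx\<close> stand for {S(u), S(v)}, {S(u), X(v)}, {X(u), X(v)};
  \<open>L1\<close> and \<open>L2\<close> are the Leibniz expansions of {S(u), S(v) X(v)} = 0 and
  {S(u) X(u), X(v)} = 0. Each use of one of them contributes a minus sign; the final sign is
  negative because contraction with the inverses also exchanges the two quadratic terms.\<close>

lemma inverse_bracket_relation:
  fixes S X S' X' :: "nat \<Rightarrow> nat \<Rightarrow> 'a::comm_ring_1"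
    and bss bsx bxx :: "nat \<Rightarrow> nat \<Rightarrow> nat \<Rightarrow> nat \<Rightarrow> 'a"
  assumes I: "finite I" "i \<in> I" "j \<in> I" "k \<in> I" "l \<in> I"
    and SX: "\<And>i j. \<lbrakk>i \<in> I; j \<in> I\<rbrakk> \<Longrightarrow> (\<Sum>q\<in>I. S i q * X q j) = (if i = j then 1 else 0)"
    and XS: "\<And>i j. \<lbrakk>i \<in> I; j \<in> I\<rbrakk> \<Longrightarrow> (\<Sum>q\<in>I. X i q * S q j) = (if i = j then 1 else 0)"
    and SX': "\<And>i j. \<lbrakk>i \<in> I; j \<in> I\<rbrakk> \<Longrightarrow> (\<Sum>q\<in>I. S' i q * X' q j) = (if i = j then 1 else 0)"
    and XS': "\<And>i j. \<lbrakk>i \<in> I; j \<in> I\<rbrakk> \<Longrightarrow> (\<Sum>q\<in>I. X' i q * S' q j) = (if i = j then 1 else 0)"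
    and L1: "\<And>i j k l. \<lbrakk>i \<in> I; j \<in> I; k \<in> I; l \<in> I\<rbrakk> \<Longrightarrow>
        (\<Sum>q\<in>I. S' k q * bsx i j q l + bss i j k q * X' q l) = 0"
    and L2: "\<And>i j k l. \<lbrakk>i \<in> I; j \<in> I; k \<in> I; l \<in> I\<rbrakk> \<Longrightarrow>
        (\<Sum>q\<in>I. S i q * bxx q j k l + bsx i q k l * X q j) = 0"
    and R: "\<And>i j k l. \<lbrakk>i \<in> I; j \<in> I; k \<in> I; l \<in> I\<rbrakk> \<Longrightarrow>
        c * bss i j k l = w * (S k j * S' i l - S' k j * S i l)"
  shows "c * bxx i j k l = - w * (X k j * X' i l - X' k j * X i l)"
proof -
  let ?\<delta> = "\<lambda>i j. if i = j then 1 else 0 :: 'a"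
  have L1': "(\<Sum>q\<in>I. S' k q * bsx i j q l) = - (\<Sum>q\<in>I. bss i j k q * X' q l)"
    if "i \<in> I" "j \<in> I" "k \<in> I" "l \<in> I" for i j k l
    using L1[OF that] by (simp add: sum.distrib eq_neg_iff_add_eq_0)
  have L2': "(\<Sum>q\<in>I. S i q * bxx q j k l) = - (\<Sum>q\<in>I. bsx i q k l * X q j)"
    if "i \<in> I" "j \<in> I" "k \<in> I" "l \<in> I" for i j k l
    using L2[OF that] by (simp add: sum.distrib eq_neg_iff_add_eq_0)
  \<comment> \<open>\<open>L1\<close> multiplied by X(v) from the left gives {S(u), X(v)} = - X(v)
    {S(u), S(v)} X(v). In each quadratic term one of the two contractions pairs S(v) with X(v) and
    collapses to a Kronecker delta.\<close>
  have sx: "c * bsx i j k l = - w * ((\<Sum>q\<in>I. X' k q * S q j) * ?\<delta> i l - ?\<delta> k j * (\<Sum>r\<in>I. S i r * X' r l))"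
    if ijkl: "i \<in> I" "j \<in> I" "k \<in> I" "l \<in> I" for i j k l
  proof -
    have "bsx i j k l = (\<Sum>r\<in>I. ?\<delta> k r * bsx i j r l)"
      using I ijkl by (simp add: if_distrib[of "\<lambda>c. c * _"] cong: if_cong)
    also have "\<dots> = (\<Sum>r\<in>I. (\<Sum>q\<in>I. X' k q * S' q r) * bsx i j r l)"
      using ijkl by (intro sum.cong refl) (simp add: XS')
    also have "\<dots> = (\<Sum>q\<in>I. X' k q * (\<Sum>r\<in>I. S' q r * bsx i j r l))"
      unfolding sum_distrib_left sum_distrib_right by (subst sum.swap) (simp add: mult.assoc)
    also have "\<dots> = (\<Sum>q\<in>I. X' k q * (- (\<Sum>r\<in>I. bss i j q r * X' r l)))"
      using ijkl by (intro sum.cong refl) (simp only: L1')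
    finally have "c * bsx i j k l = - (\<Sum>q\<in>I. \<Sum>r\<in>I. X' k q * X' r l * (c * bss i j q r))"
      by (simp add: sum_distrib_left sum_negf mult_ac)
    also have "\<dots> = - (\<Sum>q\<in>I. \<Sum>r\<in>I. X' k q * X' r l * (w * (S q j * S' i r - S' q j * S i r)))"
      using ijkl by (intro arg_cong[of _ _ uminus] sum.cong refl) (simp add: R)
    also have "\<dots> = - w * ((\<Sum>q\<in>I. X' k q * S q j) * (\<Sum>r\<in>I. S' i r * X' r l)
        - (\<Sum>q\<in>I. X' k q * S' q j) * (\<Sum>r\<in>I. S i r * X' r l))"
      unfolding sum_product right_diff_distrib sum_distrib_left[of w] sum_subtractf mult_minus_left
        minus_diff_minus
      by (intro arg_cong[of _ _ uminus] arg_cong2[where f = minus] sum.cong refl; simp only: mult_ac)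
    finally show ?thesis using ijkl by (simp add: SX' XS')
  qed
  have "bxx i j k l = (\<Sum>r\<in>I. ?\<delta> i r * bxx r j k l)"
    using I by (simp add: if_distrib[of "\<lambda>c. c * _"] cong: if_cong)
  also have "\<dots> = (\<Sum>r\<in>I. (\<Sum>q\<in>I. X i q * S q r) * bxx r j k l)"
    using I by (intro sum.cong refl) (simp add: XS)
  also have "\<dots> = (\<Sum>q\<in>I. X i q * (\<Sum>r\<in>I. S q r * bxx r j k l))"
    unfolding sum_distrib_left sum_distrib_right by (subst sum.swap) (simp add: mult.assoc)
  also have "\<dots> = (\<Sum>q\<in>I. X i q * (- (\<Sum>r\<in>I. bsx q r k l * X r j)))"
    using I by (intro sum.cong refl) (simp only: L2')
  finally have "c * bxx i j k l = - (\<Sum>q\<in>I. \<Sum>r\<in>I. X i q * X r j * (c * bsx q r k l))"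
    by (simp add: sum_distrib_left sum_negf mult_ac)
  also have "\<dots> = - (\<Sum>q\<in>I. \<Sum>r\<in>I. X i q * X r j *
      (- w * ((\<Sum>a\<in>I. X' k a * S a r) * ?\<delta> q l - ?\<delta> k r * (\<Sum>b\<in>I. S q b * X' b l))))"
    using I by (intro arg_cong[of _ _ uminus] sum.cong refl) (simp only: sx)
  also have "\<dots> = w * (\<Sum>q\<in>I. \<Sum>r\<in>I. X i q * X r j *
      ((\<Sum>a\<in>I. X' k a * S a r) * ?\<delta> q l - ?\<delta> k r * (\<Sum>b\<in>I. S q b * X' b l)))"
    by (simp only: mult_minus_left mult_minus_right sum_negf minus_minus sum_distrib_left[of w] mult.left_commute[of w])
  also have "\<dots> = w * ((\<Sum>q\<in>I. X i q * ?\<delta> q l) * (\<Sum>r\<in>I. (\<Sum>a\<in>I. X' k a * S a r) * X r j)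
      - (\<Sum>q\<in>I. X i q * (\<Sum>b\<in>I. S q b * X' b l)) * (\<Sum>r\<in>I. ?\<delta> k r * X r j))"
    unfolding sum_product right_diff_distrib sum_subtractf sum_distrib_left[of w]
    by (intro arg_cong2[where f = minus] sum.cong refl; simp only: mult_ac)
  also have "(\<Sum>q\<in>I. X i q * ?\<delta> q l) = X i l"
    using I by (simp add: if_distrib[of "\<lambda>c. _ * c"] cong: if_cong)
  also have "(\<Sum>r\<in>I. ?\<delta> k r * X r j) = X k j"
    using I by (simp add: if_distrib[of "\<lambda>c. c * _"] cong: if_cong)
  also have "(\<Sum>r\<in>I. (\<Sum>a\<in>I. X' k a * S a r) * X r j) = (\<Sum>a\<in>I. X' k a * (\<Sum>r\<in>I. S a r * X r j))"
    unfolding sum_distrib_left sum_distrib_right by (subst sum.swap) (simp add: mult.assoc)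
  also have "\<dots> = (\<Sum>a\<in>I. X' k a * ?\<delta> a j)" using I by (intro sum.cong refl) (simp add: SX)
  also have "\<dots> = X' k j" using I by (simp add: if_distrib[of "\<lambda>c. _ * c"] cong: if_cong)
  also have "(\<Sum>q\<in>I. X i q * (\<Sum>b\<in>I. S q b * X' b l)) = (\<Sum>b\<in>I. (\<Sum>q\<in>I. X i q * S q b) * X' b l)"
    unfolding sum_distrib_left sum_distrib_right by (subst sum.swap) (simp add: mult.assoc)
  also have "\<dots> = (\<Sum>b\<in>I. ?\<delta> i b * X' b l)" using I by (intro sum.cong refl) (simp add: XS)
  also have "\<dots> = X' i l" using I by (simp add: if_distrib[of "\<lambda>c. c * _"] cong: if_cong)
  finally show ?thesis by (simp add: algebra_simps)
qed

section \<open>Matrices of formal power series\<close>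

text \<open>The constant term of \<open>F\<close> is the identity matrix. Once the lower
  coefficients of \<open>Z\<close> are known to vanish, the coefficient of degree n in the product
  is that of \<open>Z\<close>.\<close>

lemma fps_matrix_left_cancel:
  fixes F Z :: "nat \<Rightarrow> nat \<Rightarrow> complex fps"
  assumes I: "finite I" and F0: "\<And>i j. \<lbrakk>i \<in> I; j \<in> I\<rbrakk> \<Longrightarrow> F i j $ 0 = (if i = j then 1 else 0)"
    and FZ: "\<And>i j. \<lbrakk>i \<in> I; j \<in> I\<rbrakk> \<Longrightarrow> (\<Sum>q\<in>I. F i q * Z q j) = 0"
    and ij: "i \<in> I" "j \<in> I"
  shows "Z i j = 0"
proof (rule fps_ext)
  fix n show "Z i j $ n = 0 $ n"
    using ij(1)
  proof (induction n arbitrary: i rule: less_induct)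
    case (less n)
    have "0 = (\<Sum>q\<in>I. F i q * Z q j) $ n" using FZ less(2) ij(2) by simp
    also have "\<dots> = (\<Sum>q\<in>I. \<Sum>a=0..n. F i q $ a * Z q j $ (n - a))"
      by (simp add: fps_sum_nth fps_mult_nth)
    also have "\<dots> = (\<Sum>q\<in>I. (if i = q then 1 else 0) * Z q j $ n)"
    proof (intro sum.cong refl)
      fix q assume q: "q \<in> I"
      have "(\<Sum>a=0..n. F i q $ a * Z q j $ (n - a)) = (\<Sum>a\<in>{0}. F i q $ a * Z q j $ (n - a))"
        using less(1)[OF _ q] by (intro sum.mono_neutral_right) auto
      then show "(\<Sum>a=0..n. F i q $ a * Z q j $ (n - a)) = (if i = q then 1 else 0) * Z q j $ n"
        using F0[OF less(2) q] by simp
    qed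
    also have "\<dots> = Z i j $ n"
      using I less(2) by (simp add: if_distrib[of "\<lambda>c. c * _"] cong: if_cong)
    finally show ?case by simp
  qed
qed

text \<open>From S X = 1 follows S (X S - 1) = 0, and S can be cancelled.\<close>

lemma fps_matrix_left_inverse:
  fixes S X :: "nat \<Rightarrow> nat \<Rightarrow> complex fps"
  assumes I: "finite I" and S0: "\<And>i j. \<lbrakk>i \<in> I; j \<in> I\<rbrakk> \<Longrightarrow> S i j $ 0 = (if i = j then 1 else 0)"
    and SX: "\<And>i j. \<lbrakk>i \<in> I; j \<in> I\<rbrakk> \<Longrightarrow> (\<Sum>q\<in>I. S i q * X q j) = (if i = j then 1 else 0)"
    and ij: "i \<in> I" "j \<in> I"
  shows "(\<Sum>q\<in>I. X i q * S q j) = (if i = j then 1 else 0)"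
proof -
  define Z where "Z i j = (\<Sum>q\<in>I. X i q * S q j) - (if i = j then 1 else 0)" for i j
  have SZ: "(\<Sum>q\<in>I. S i q * Z q j) = 0" if ij: "i \<in> I" "j \<in> I" for i j
  proof -
    have "(\<Sum>q\<in>I. S i q * (\<Sum>r\<in>I. X q r * S r j)) = (\<Sum>r\<in>I. (\<Sum>q\<in>I. S i q * X q r) * S r j)"
      unfolding sum_distrib_left sum_distrib_right by (subst sum.swap) (simp add: mult.assoc)
    also have "\<dots> = (\<Sum>r\<in>I. (if i = r then 1 else 0) * S r j)"
      using ij by (intro sum.cong refl) (simp add: SX)
    also have "\<dots> = S i j" using I ij by (simp add: if_distrib[of "\<lambda>c. c * _"] cong: if_cong)
    moreover have "(\<Sum>q\<in>I. S i q * (if q = j then 1 else 0)) = S i j"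
      using I ij by (simp add: if_distrib[of "\<lambda>c. _ * c"] cong: if_cong)
    ultimately show ?thesis by (simp add: Z_def right_diff_distrib sum_subtractf)
  qed
  have "Z i j = 0"
    by (rule fps_matrix_left_cancel[where F = S and I = I]) (use I S0 SZ ij in auto)
  then show ?thesis by (simp add: Z_def)
qed

text \<open>A series in one variable, viewed as a series in the first of two variables; the embedding
  as a series in the second variable is \<^const>\<open>fps_const\<close>.\<close>

definition fps_lift :: "complex fps \<Rightarrow> complex fps fps" where
  "fps_lift F = Abs_fps (\<lambda>m. fps_const (F $ m))"

lemma fps_lift_nth [simp]: "fps_lift F $ m = fps_const (F $ m)"
  by (simp add: fps_lift_def)

lemma fps_const_sum: "fps_const (sum f A) = (\<Sum>a\<in>A. fps_const (f a))"
  by (induction A rule: infinite_finite_induct) (simp_all flip: fps_const_add)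

lemma fps_lift_mult: "fps_lift (F * G) = fps_lift F * fps_lift G"
  by (rule fps_ext) (simp add: fps_mult_nth fps_const_sum)

lemma fps_lift_sum: "fps_lift (sum f A) = (\<Sum>a\<in>A. fps_lift (f a))"
  by (rule fps_ext) (simp add: fps_sum_nth fps_const_sum)

lemma fps_lift_delta: "fps_lift (if P then 1 else 0) = (if P then 1 else 0)"
  by (rule fps_ext) (simp add: fps_one_nth)

lemma inverse_yangian_relation:
  fixes S X :: "nat \<Rightarrow> nat \<Rightarrow> complex fps"
    and bss bsx bxx :: "nat \<Rightarrow> nat \<Rightarrow> nat \<Rightarrow> nat \<Rightarrow> nat \<Rightarrow> nat \<Rightarrow> complex"
  assumes I: "finite I" "i \<in> I" "j \<in> I" "k \<in> I" "l \<in> I"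
    and S0: "\<And>i j. \<lbrakk>i \<in> I; j \<in> I\<rbrakk> \<Longrightarrow> S i j $ 0 = (if i = j then 1 else 0)"
    and SX: "\<And>i j. \<lbrakk>i \<in> I; j \<in> I\<rbrakk> \<Longrightarrow> (\<Sum>q\<in>I. S i q * X q j) = (if i = j then 1 else 0)"
    and L1: "\<And>m n i j k l. \<lbrakk>i \<in> I; j \<in> I; k \<in> I; l \<in> I\<rbrakk> \<Longrightarrow>
        (\<Sum>q\<in>I. \<Sum>a=0..n. S k q $ a * bsx m i j (n - a) q l + bss m i j a k q * X q l $ (n - a)) = 0"
    and L2: "\<And>m n i j k l. \<lbrakk>i \<in> I; j \<in> I; k \<in> I; l \<in> I\<rbrakk> \<Longrightarrow>
        (\<Sum>q\<in>I. \<Sum>a=0..m. S i q $ a * bxx (m - a) q j n k l + bsx a i q n k l * X q j $ (m - a)) = 0"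
    and b0: "\<And>n i j k l. \<lbrakk>i \<in> I; j \<in> I; k \<in> I; l \<in> I\<rbrakk> \<Longrightarrow> bss 0 i j n k l = 0"
      "\<And>m i j k l. \<lbrakk>i \<in> I; j \<in> I; k \<in> I; l \<in> I\<rbrakk> \<Longrightarrow> bss m i j 0 k l = 0"
    and R: "\<And>m n i j k l. \<lbrakk>i \<in> I; j \<in> I; k \<in> I; l \<in> I\<rbrakk> \<Longrightarrow>
        bss (Suc m) i j n k l - bss m i j (Suc n) k l = S k j $ m * S i l $ n - S k j $ n * S i l $ m"
  shows "bxx (Suc m) i j n k l - bxx m i j (Suc n) k l = - (X k j $ m * X i l $ n - X k j $ n * X i l $ m)"
proof -
  define G :: "(nat \<Rightarrow> nat \<Rightarrow> nat \<Rightarrow> nat \<Rightarrow> nat \<Rightarrow> nat \<Rightarrow> complex) \<Rightarrow> nat \<Rightarrow> nat \<Rightarrow> nat \<Rightarrow> nat \<Rightarrow> complex fps fps"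
    where "G b i j k l = Abs_fps (\<lambda>m. Abs_fps (\<lambda>n. b m i j n k l))" for b i j k l
  have G: "G b i j k l $ m $ n = b m i j n k l" for b i j k l m n by (simp add: G_def)
  \<comment> \<open>In the variables x = 1/u (the outer \<open>fps_X\<close>) and y = 1/v (its
    counterpart \<open>fps_const fps_X\<close>) one has u - v = (y - x) / (x y). Clearing the
    denominator leaves the factor c = y - x on the bracket and w = x y on the right side.\<close>
  define c :: "complex fps fps" where "c = fps_const fps_X - fps_X"
  define w :: "complex fps fps" where "w = fps_X * fps_const fps_X"
  have c: "(c * F) $ m $ n = (if n = 0 then 0 else F $ m $ (n - 1)) - (if m = 0 then 0 else F $ (m - 1) $ n)"
    for F m n by (simp add: c_def left_diff_distrib)
  have w: "(w * F) $ m $ n = (if m = 0 \<or> n = 0 then 0 else F $ (m - 1) $ (n - 1))" for F m n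
    by (simp add: w_def mult.assoc)
  have XS: "(\<Sum>q\<in>I. X i q * S q j) = (if i = j then 1 else 0)" if "i \<in> I" "j \<in> I" for i j
    using fps_matrix_left_inverse[OF I(1) S0 SX that] .
  have "c * G bxx i j k l = - w * (fps_lift (X k j) * fps_const (X i l) - fps_const (X k j) * fps_lift (X i l))"
  proof (rule inverse_bracket_relation[where S = "\<lambda>i j. fps_lift (S i j)" and S' = "\<lambda>i j. fps_const (S i j)"
        and X = "\<lambda>i j. fps_lift (X i j)" and X' = "\<lambda>i j. fps_const (X i j)" and bss = "G bss" and bsx = "G bsx",
        OF I])
    fix i j assume ij: "i \<in> I" "j \<in> I"
    show "(\<Sum>q\<in>I. fps_lift (S i q) * fps_lift (X q j)) = (if i = j then 1 else 0)"
      using SX[OF ij] by (simp add: fps_lift_delta flip: fps_lift_mult fps_lift_sum)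
    show "(\<Sum>q\<in>I. fps_lift (X i q) * fps_lift (S q j)) = (if i = j then 1 else 0)"
      using XS[OF ij] by (simp add: fps_lift_delta flip: fps_lift_mult fps_lift_sum)
    show "(\<Sum>q\<in>I. fps_const (S i q) * fps_const (X q j)) = (if i = j then 1 else 0)"
      using SX[OF ij] by (simp flip: fps_const_sum)
    show "(\<Sum>q\<in>I. fps_const (X i q) * fps_const (S q j)) = (if i = j then 1 else 0)"
      using XS[OF ij] by (simp flip: fps_const_sum)
    fix k l assume kl: "k \<in> I" "l \<in> I"
    show "(\<Sum>q\<in>I. fps_const (S k q) * G bsx i j q l + G bss i j k q * fps_const (X q l)) = 0"
      by (intro fps_ext) (use L1[OF ij kl] in \<open>simp add: fps_sum_nth fps_mult_nth[where 'a = complex] G sum.distrib\<close>)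
    show "(\<Sum>q\<in>I. fps_lift (S i q) * G bxx q j k l + G bsx i q k l * fps_lift (X q j)) = 0"
      by (intro fps_ext) (use L2[OF ij kl] in
        \<open>simp add: fps_sum_nth fps_mult_nth[of "fps_lift _"] fps_mult_nth[of _ "fps_lift _"] G sum.distrib\<close>)
    show "c * G bss i j k l = w * (fps_lift (S k j) * fps_const (S i l) - fps_const (S k j) * fps_lift (S i l))"
    proof (intro fps_ext)
      fix m n
      \<comment> \<open>\<open>R\<close> governs the coefficients with m and n positive. If m or n
        is 0, the factor x y makes the right side vanish, and \<open>b0\<close> does the same for
        the left side.\<close>
      show "(c * G bss i j k l) $ m $ n =
          (w * (fps_lift (S k j) * fps_const (S i l) - fps_const (S k j) * fps_lift (S i l))) $ m $ n"
        using R[OF ij kl, of "m - 1" "n - 1"] b0[OF ij kl]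
        by (cases m; cases n) (simp_all add: c w G mult.commute del: fps_mult_nth_0)
    qed
  qed
  then have "(c * G bxx i j k l) $ Suc m $ Suc n =
      - (w * (fps_lift (X k j) * fps_const (X i l) - fps_const (X k j) * fps_lift (X i l))) $ Suc m $ Suc n"
    by simp
  then show ?thesis by (simp add: c w G mult.commute)
qed

text \<open>The relation moves one unit between the indices of \<open>b\<close>. Lowering the first
  index to 0 gives the sum over r < m. Lowering the second one, with the antisymmetry of
  \<open>c\<close>, gives the same summand over r < n; the shorter of the two sums is the Yangian
  formula.\<close>

lemma yangian_telescope:
  fixes b c :: "nat \<Rightarrow> nat \<Rightarrow> complex"
  assumes b0: "\<And>n. b 0 n = 0" "\<And>m. b m 0 = 0"
    and c: "\<And>m n. c m n = - c n m"
    and R: "\<And>m n. b (Suc m) n - b m (Suc n) = c m n"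
  shows "b m n = (\<Sum>r<min m n. c r (m + n - r - 1))"
proof -
  have 1: "b m n = (\<Sum>r<m. c r (m + n - r - 1))" for m n
  proof (induction m arbitrary: n)
    case (Suc m)
    have "b (Suc m) n = c m n + b m (Suc n)" using R[of m n] by (simp add: algebra_simps)
    then show ?case by (simp add: Suc)
  qed (simp add: b0)
  have 2: "b m n = (\<Sum>r<n. c r (m + n - r - 1))" for m n
  proof (induction n arbitrary: m)
    case (Suc n)
    have "b m (Suc n) = b (Suc m) n + c n m" using R[of m n] c[of m n] by (simp add: algebra_simps)
    then show ?case by (simp add: Suc)
  qed (simp add: b0)
  show ?thesis using 1[of m n] 2[of m n] by (simp add: min_def)
qed


unbundle no fps_syntax

section \<open>The Poisson algebra of matrix entries\<close>

abbreviation gl_vars :: "nat \<Rightarrow> nat \<Rightarrow> (idx \<times> idx) set" where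
  "gl_vars N p \<equiv> indices N p \<times> indices N p"

abbreviation gl_bracket :: "(idx \<times> idx) cpoly \<Rightarrow> (idx \<times> idx) cpoly \<Rightarrow> (idx \<times> idx) cpoly" where
  "gl_bracket \<equiv> poly_bracket gl_gen_bracket"

lemma finite_indices [simp]: "finite (indices N p)"
  by (simp add: indices_def)

lemma gl_gen_bracket_antisym: "gl_gen_bracket u v = - gl_gen_bracket v u"
  by (cases u; cases v) (simp add: gl_gen_bracket_def)

lemma gl_gen_bracket_jacobi:
  "gl_bracket (pvar u) (gl_gen_bracket v w) + gl_bracket (pvar v) (gl_gen_bracket w u)
    + gl_bracket (pvar w) (gl_gen_bracket u v) = 0"
proof -
  \<comment> \<open>Kronecker deltas written as constant polynomials turn the case distinctions on
    indices into one identity of commutative algebra.\<close>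
  define D :: "idx \<Rightarrow> idx \<Rightarrow> (idx \<times> idx) cpoly" where "D x y = (if x = y then 1 else 0)" for x y
  have gen: "gl_gen_bracket (a, b) (c, d) = D b c * pvar (a, d) - D a d * pvar (c, b)" for a b c d
    by (simp add: gl_gen_bracket_def D_def)
  have const: "gl_bracket f (D x y) = 0" for f x y by (simp add: D_def)
  have sym: "D x y = D y x" for x y by (simp add: D_def)
  obtain a b where u: "u = (a, b)" by (cases u)
  obtain c d where v: "v = (c, d)" by (cases v)
  obtain e f where w: "w = (e, f)" by (cases w)
  show ?thesis
    unfolding u v w gen poly_bracket_simps const poly_bracket_pvar
    by (simp add: sym[of c b] sym[of e d] sym[of a f] sym[of c f] sym[of d a] sym[of e b] algebra_simps)
qed

lemma gl_bracket_antisym: "gl_bracket f g = - gl_bracket g f"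
  by (rule poly_bracket_antisym) (rule gl_gen_bracket_antisym)

lemma gl_bracket_jacobi:
  "gl_bracket f (gl_bracket g h) + gl_bracket g (gl_bracket h f) + gl_bracket h (gl_bracket f g) = 0"
  by (rule poly_bracket_jacobi) (rule gl_gen_bracket_antisym gl_gen_bracket_jacobi)+

lemma pvars_gl_bracket:
  assumes "pvars f \<subseteq> gl_vars N p" "pvars g \<subseteq> gl_vars N p"
  shows "pvars (gl_bracket f g) \<subseteq> gl_vars N p"
proof (rule pvars_poly_bracket[OF _ assms])
  fix u v assume uv: "u \<in> gl_vars N p" "v \<in> gl_vars N p"
  obtain a b c d where [simp]: "u = (a, b)" "v = (c, d)" by (metis surj_pair)
  show "pvars (gl_gen_bracket u v) \<subseteq> gl_vars N p"
    using uv by (auto simp: gl_gen_bracket_def pvars_pvar dest!: subsetD[OF pvars_diff] split: if_splits)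
qed

section \<open>Powers of the generic matrix\<close>

fun mat_power :: "nat \<Rightarrow> nat \<Rightarrow> nat \<Rightarrow> idx \<Rightarrow> idx \<Rightarrow> (idx \<times> idx) cpoly" where
  "mat_power N p 0 \<alpha> \<beta> = (if \<alpha> = \<beta> then 1 else 0)"
| "mat_power N p (Suc n) \<alpha> \<beta> = (\<Sum>\<gamma>\<in>indices N p. mat_power N p n \<alpha> \<gamma> * pvar (\<gamma>, \<beta>))"

lemma mat_power_Suc_left:
  assumes "\<alpha> \<in> indices N p" "\<beta> \<in> indices N p"
  shows "mat_power N p (Suc n) \<alpha> \<beta> = (\<Sum>\<gamma>\<in>indices N p. pvar (\<alpha>, \<gamma>) * mat_power N p n \<gamma> \<beta>)"
  using assms(2)
proof (induction n arbitrary: \<beta>)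
  case 0
  then show ?case using assms(1)
    by (simp add: if_distrib[of "\<lambda>c. _ * c"] if_distrib[of "\<lambda>c. c * _"] cong: if_cong)
next
  case (Suc n)
  have "mat_power N p (Suc (Suc n)) \<alpha> \<beta> =
      (\<Sum>\<delta>\<in>indices N p. (\<Sum>\<gamma>\<in>indices N p. pvar (\<alpha>, \<gamma>) * mat_power N p n \<gamma> \<delta>) * pvar (\<delta>, \<beta>))"
    using Suc.IH by (subst mat_power.simps) (intro sum.cong refl, simp)
  also have "\<dots> = (\<Sum>\<gamma>\<in>indices N p. pvar (\<alpha>, \<gamma>) * (\<Sum>\<delta>\<in>indices N p. mat_power N p n \<gamma> \<delta> * pvar (\<delta>, \<beta>)))"
    unfolding sum_distrib_left sum_distrib_right by (subst sum.swap) (simp add: mult.assoc)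
  finally show ?case by simp
qed

lemma pvars_mat_power:
  "\<lbrakk>\<alpha> \<in> indices N p; \<beta> \<in> indices N p\<rbrakk> \<Longrightarrow> pvars (mat_power N p n \<alpha> \<beta>) \<subseteq> gl_vars N p"
proof (induction n arbitrary: \<beta>)
  case (Suc n)
  have "pvars (mat_power N p n \<alpha> \<gamma> * pvar (\<gamma>, \<beta>)) \<subseteq> gl_vars N p" if "\<gamma> \<in> indices N p" for \<gamma>
    using pvars_mult[of "mat_power N p n \<alpha> \<gamma>" "pvar (\<gamma>, \<beta>)"] Suc.IH[OF Suc.prems(1) that] Suc.prems that
    by (auto simp: pvars_pvar)
  then show ?case unfolding mat_power.simps by (rule pvars_sum)
qed simp

lemma gl_bracket_pvar_pvar:
  "gl_bracket (pvar (a, b)) (pvar (c, d)) = (if b = c then pvar (a, d) else 0) - (if a = d then pvar (c, b) else 0)"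
  by (simp add: poly_bracket_pvar gl_gen_bracket_def)

text \<open>Bracketing with a matrix entry is an infinitesimal conjugation, so it acts on the
  entries of a power exactly as on the entries of the matrix.\<close>

lemma gl_bracket_pvar_mat_power:
  assumes "a \<in> indices N p" "b \<in> indices N p"
  shows "gl_bracket (pvar (a, b)) (mat_power N p n c d) =
    (if b = c then mat_power N p n a d else 0) - (if a = d then mat_power N p n c b else 0)"
proof (induction n arbitrary: d)
  case (Suc n)
  let ?M = "mat_power N p n" and ?I = "indices N p"
  have "gl_bracket (pvar (a, b)) (mat_power N p (Suc n) c d) =
     (\<Sum>x\<in>?I. gl_bracket (pvar (a, b)) (?M c x) * pvar (x, d) +
       ?M c x * gl_bracket (pvar (a, b)) (pvar (x, d)))"
    by (simp add: poly_bracket_simps)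
  also have "\<dots> = (\<Sum>x\<in>?I. (if b = c then ?M a x * pvar (x, d) else 0)
      - (if a = x then ?M c b * pvar (x, d) else 0)
      + (if b = x then ?M c x * pvar (a, d) else 0) - (if a = d then ?M c x * pvar (x, b) else 0))"
    by (intro sum.cong refl) (simp add: Suc.IH gl_bracket_pvar_pvar algebra_simps)
  also have "\<dots> = (if b = c then mat_power N p (Suc n) a d else 0)
      - (if a = d then mat_power N p (Suc n) c b else 0)"
    using assms by (simp add: sum.distrib sum_subtractf)
  finally show ?case .
qed simp

text \<open>This is the expansion in \<open>u\<close> and \<open>v\<close> of the bracket of two entries of the resolvents
  \<open>(u - J)\<^sup>-\<^sup>1\<close> and \<open>(v - J)\<^sup>-\<^sup>1\<close>.\<close>

lemma gl_bracket_mat_power: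
  assumes "a \<in> indices N p" "b \<in> indices N p" "c \<in> indices N p" "d \<in> indices N p"
  shows "gl_bracket (mat_power N p (Suc m) a b) (mat_power N p n c d)
       - gl_bracket (mat_power N p m a b) (mat_power N p (Suc n) c d)
     = mat_power N p m c b * mat_power N p n a d - mat_power N p m a d * mat_power N p n c b"
  using assms(2)
proof (induction m arbitrary: b)
  case 0
  have "mat_power N p (Suc 0) a b = pvar (a, b)"
    using assms(1) by (simp add: if_distrib[of "\<lambda>c. c * _"] cong: if_cong)
  moreover have "gl_bracket (mat_power N p 0 a b) f = 0" for f by simp
  ultimately show ?case
    by (simp only: gl_bracket_pvar_mat_power[OF assms(1) 0]) simp
next
  case (Suc m)
  let ?M = "mat_power N p" and ?I = "indices N p"
  have exp: "gl_bracket (?M (Suc k) a b) f =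
      (\<Sum>x\<in>?I. gl_bracket (?M k a x) f * pvar (x, b) + ?M k a x * gl_bracket (pvar (x, b)) f)" for k f
    by (simp add: poly_bracket_simps)
  have D: "gl_bracket (pvar (x, b)) (?M k c d) = (if b = c then ?M k x d else 0) - (if x = d then ?M k c b else 0)"
    if "x \<in> ?I" for x k
    by (rule gl_bracket_pvar_mat_power[OF that Suc.prems])
  have "gl_bracket (?M (Suc (Suc m)) a b) (?M n c d) - gl_bracket (?M (Suc m) a b) (?M (Suc n) c d) =
     (\<Sum>x\<in>?I. (gl_bracket (?M (Suc m) a x) (?M n c d) - gl_bracket (?M m a x) (?M (Suc n) c d)) * pvar (x, b)
       + (?M (Suc m) a x * gl_bracket (pvar (x, b)) (?M n c d)
         - ?M m a x * gl_bracket (pvar (x, b)) (?M (Suc n) c d)))"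
    unfolding exp[of "Suc m"] exp[of m] by (simp only: sum_subtractf[symmetric]) (simp only: algebra_simps)
  also have "\<dots> = (\<Sum>x\<in>?I. (?M m c x * ?M n a d - ?M m a d * ?M n c x) * pvar (x, b)
       + (?M (Suc m) a x * ((if b = c then ?M n x d else 0) - (if x = d then ?M n c b else 0))
         - ?M m a x * ((if b = c then ?M (Suc n) x d else 0) - (if x = d then ?M (Suc n) c b else 0))))"
    by (intro sum.cong refl) (simp only: Suc.IH D)
  also have "\<dots> = (\<Sum>x\<in>?I. ?M m c x * pvar (x, b) * ?M n a d - ?M m a d * (?M n c x * pvar (x, b))
      + (if b = c then ?M (Suc m) a x * ?M n x d - ?M m a x * ?M (Suc n) x d else 0)
      - (if x = d then ?M (Suc m) a x * ?M n c b else 0)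
      + (if x = d then ?M m a x * ?M (Suc n) c b else 0))"
  proof (intro sum.cong refl)
    fix x
    show "(?M m c x * ?M n a d - ?M m a d * ?M n c x) * pvar (x, b)
       + (?M (Suc m) a x * ((if b = c then ?M n x d else 0) - (if x = d then ?M n c b else 0))
         - ?M m a x * ((if b = c then ?M (Suc n) x d else 0) - (if x = d then ?M (Suc n) c b else 0))) =
      ?M m c x * pvar (x, b) * ?M n a d - ?M m a d * (?M n c x * pvar (x, b))
      + (if b = c then ?M (Suc m) a x * ?M n x d - ?M m a x * ?M (Suc n) x d else 0)
      - (if x = d then ?M (Suc m) a x * ?M n c b else 0)
      + (if x = d then ?M m a x * ?M (Suc n) c b else 0)"
      by (cases "b = c"; cases "x = d") (simp_all add: algebra_simps del: mat_power.simps)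
  qed
  also have "\<dots> = (\<Sum>x\<in>?I. ?M m c x * pvar (x, b)) * ?M n a d - ?M m a d * (\<Sum>x\<in>?I. ?M n c x * pvar (x, b))
      + (if b = c then (\<Sum>x\<in>?I. ?M (Suc m) a x * ?M n x d) - (\<Sum>x\<in>?I. ?M m a x * ?M (Suc n) x d) else 0)
      - (\<Sum>x\<in>?I. if x = d then ?M (Suc m) a x * ?M n c b else 0)
      + (\<Sum>x\<in>?I. if x = d then ?M m a x * ?M (Suc n) c b else 0)"
    by (cases "b = c") (simp_all only: sum.distrib sum_subtractf sum_distrib_left sum_distrib_right
        if_True if_False simp_thms sum.neutral_const)
  \<comment> \<open>Both sums are the entry at \<open>(a, d)\<close> of the power m + n + 1, so the
    terms conditioned on \<open>b = c\<close> cancel.\<close>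
  also have "(\<Sum>x\<in>?I. ?M (Suc m) a x * ?M n x d) = (\<Sum>x\<in>?I. ?M m a x * ?M (Suc n) x d)"
  proof -
    have "(\<Sum>x\<in>?I. ?M (Suc m) a x * ?M n x d) = (\<Sum>y\<in>?I. ?M m a y * (\<Sum>x\<in>?I. pvar (y, x) * ?M n x d))"
      unfolding mat_power.simps sum_distrib_left sum_distrib_right by (subst sum.swap) (simp add: mult.assoc)
    also have "\<dots> = (\<Sum>x\<in>?I. ?M m a x * ?M (Suc n) x d)"
      using assms by (intro sum.cong refl) (simp only: mat_power_Suc_left)
    finally show ?thesis .
  qed
  finally show ?case using assms(4) by (simp add: algebra_simps)
qed


section \<open>The constraint surface and gauge invariant polynomials\<close>

lemma e_minus_apply:
  "e_minus p (k, l) = (if k = Suc l \<and> l \<in> {1..p-1} then 1 else 0)"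
proof -
  have "e_minus p (k, l) = (\<Sum>m=1..p-1. if m = l then (if k = Suc l then 1 else 0) else 0)"
    unfolding e_minus_def munit_def by (intro sum.cong) auto
  then show ?thesis by simp
qed

lemma eps_minus_apply:
  "eps_minus N p (\<alpha>, \<beta>) =
     (if \<alpha> \<in> indices N p \<and> \<beta> \<in> indices N p \<and> fst \<alpha> = fst \<beta> \<and> snd \<alpha> = Suc (snd \<beta>) then 1 else 0)"
  by (cases \<alpha>; cases \<beta>)
    (auto simp: eps_minus_def tensor_def identity_mat_apply e_minus_apply indices_def)

lemma mem_constraint_surface_iff:
  "J \<in> constraint_surface N p \<longleftrightarrow> J \<in> matrices N p \<and>
     (\<forall>\<alpha>\<in>indices N p. \<forall>\<beta>\<in>indices N p. snd \<beta> < snd \<alpha> \<longrightarrow>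
        J (\<alpha>, \<beta>) = (if fst \<alpha> = fst \<beta> \<and> snd \<alpha> = Suc (snd \<beta>) then 1 else 0))"
proof (cases "J \<in> matrices N p")
  case True
  have z: "J (\<alpha>, \<beta>) = 0" "eps_minus N p (\<alpha>, \<beta>) = 0"
    if "\<not> (\<alpha> \<in> indices N p \<and> \<beta> \<in> indices N p)" for \<alpha> \<beta>
    using True that by (auto simp: matrices_def eps_minus_apply simp del: split_paired_All)
  then have m: "(\<lambda>x. J x - eps_minus N p x) \<in> matrices N p"
    by (auto simp: matrices_def)
  have "J \<in> constraint_surface N p \<longleftrightarrow>
      (\<forall>\<alpha> \<beta>. snd \<beta> < snd \<alpha> \<longrightarrow> J (\<alpha>, \<beta>) = eps_minus N p (\<alpha>, \<beta>))"
    using True m unfolding constraint_surface_def nonneg_grade_iff by simp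
  also have "\<dots> \<longleftrightarrow> (\<forall>\<alpha>\<in>indices N p. \<forall>\<beta>\<in>indices N p. snd \<beta> < snd \<alpha> \<longrightarrow> J (\<alpha>, \<beta>) = eps_minus N p (\<alpha>, \<beta>))"
    using z by metis
  finally show ?thesis using True by (simp add: eps_minus_apply)
qed (simp add: constraint_surface_def)

lemma constraint_surface_entry:
  assumes "J \<in> constraint_surface N p" "\<alpha> \<in> indices N p" "\<beta> \<in> indices N p" "snd \<beta> < snd \<alpha>"
  shows "J (\<alpha>, \<beta>) = (if fst \<alpha> = fst \<beta> \<and> snd \<alpha> = Suc (snd \<beta>) then 1 else 0)"
  using assms by (simp add: mem_constraint_surface_iff)

lemma pbracket_gl_poisson [simp]: "pbracket (gl_poisson N p) = gl_bracket"
  by (simp add: gl_poisson_def poly_poisson_def)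

lemma carrier_gl_poisson [simp]: "carrier (gl_poisson N p) = {f. pvars f \<subseteq> gl_vars N p}"
  by (simp add: gl_poisson_def poly_poisson_def)

text \<open>The constant in a constraint has zero bracket with everything, so only the bare entries
  of negative grade remain.\<close>

lemma gauge_invariant_iff:
  "gauge_invariant N p f \<longleftrightarrow>
     (\<forall>\<alpha>\<in>indices N p. \<forall>\<beta>\<in>indices N p. snd \<beta> < snd \<alpha> \<longrightarrow>
        (\<forall>J\<in>constraint_surface N p. peval J (gl_bracket (pvar (\<alpha>, \<beta>)) f) = 0))"
proof -
  have *: "(\<exists>s<0. munit \<alpha> \<beta> \<in> grade_space N p s) \<longleftrightarrow> snd \<beta> < snd \<alpha>"
    if "\<alpha> \<in> indices N p" "\<beta> \<in> indices N p" for \<alpha> \<beta>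
    using munit_grade_space[OF that] by auto
  have c: "constraints N p = {pvar (\<alpha>, \<beta>) - pconst (eps_minus N p (\<alpha>, \<beta>)) | \<alpha> \<beta>.
     \<alpha> \<in> indices N p \<and> \<beta> \<in> indices N p \<and> snd \<beta> < snd \<alpha>}"
    unfolding constraints_def using * by blast
  show ?thesis unfolding gauge_invariant_def c pbracket_gl_poisson
    by (fastforce simp: poly_bracket_diff_left)
qed

lemma gauge_invariantD:
  "\<lbrakk>gauge_invariant N p f; \<alpha> \<in> indices N p; \<beta> \<in> indices N p; snd \<beta> < snd \<alpha>; J \<in> constraint_surface N p\<rbrakk>
    \<Longrightarrow> peval J (gl_bracket (pvar (\<alpha>, \<beta>)) f) = 0"
  by (simp add: gauge_invariant_iff)

lemma gauge_invariant_pconst [simp]: "gauge_invariant N p (pconst c)"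
  by (simp add: gauge_invariant_iff)

lemma gauge_invariant_zero [simp]: "gauge_invariant N p 0"
  using gauge_invariant_pconst[of N p 0] by (simp add: pconst_0)

lemma gauge_invariant_one [simp]: "gauge_invariant N p 1"
  using gauge_invariant_pconst[of N p 1] by (simp add: pconst_1)

lemma gauge_invariant_add: "\<lbrakk>gauge_invariant N p f; gauge_invariant N p g\<rbrakk> \<Longrightarrow> gauge_invariant N p (f + g)"
  by (simp add: gauge_invariant_iff poly_bracket_simps peval_simps)

lemma gauge_invariant_uminus: "gauge_invariant N p f \<Longrightarrow> gauge_invariant N p (- f)"
  by (simp add: gauge_invariant_iff poly_bracket_simps peval_simps)

lemma gauge_invariant_mult: "\<lbrakk>gauge_invariant N p f; gauge_invariant N p g\<rbrakk> \<Longrightarrow> gauge_invariant N p (f * g)"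
  by (simp add: gauge_invariant_iff poly_bracket_simps peval_simps)

lemma gauge_invariant_sum: "(\<And>i. i \<in> A \<Longrightarrow> gauge_invariant N p (f i)) \<Longrightarrow> gauge_invariant N p (sum f A)"
  by (induction A rule: infinite_finite_induct) (auto intro: gauge_invariant_add)

text \<open>This is the first class property. The bracket of two entries of negative grade consists
  of entries of grade at most -2, and there the surface prescribes the value 0.\<close>

lemma gauge_invariant_constraint:
  assumes "\<gamma> \<in> indices N p" "\<delta> \<in> indices N p" "snd \<delta> < snd \<gamma>"
  shows "gauge_invariant N p (pvar (\<gamma>, \<delta>))"
  unfolding gauge_invariant_iff
proof (intro ballI impI)
  fix \<alpha> \<beta> J
  assume *: "\<alpha> \<in> indices N p" "\<beta> \<in> indices N p" "snd \<beta> < snd \<alpha>" and J: "J \<in> constraint_surface N p"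
  have "J (\<alpha>, \<delta>) = 0" if "\<beta> = \<gamma>"
    using constraint_surface_entry[OF J *(1) assms(2)] * assms that by auto
  moreover have "J (\<gamma>, \<beta>) = 0" if "\<alpha> = \<delta>"
    using constraint_surface_entry[OF J assms(1) *(2)] * assms that by auto
  ultimately show "peval J (gl_bracket (pvar (\<alpha>, \<beta>)) (pvar (\<gamma>, \<delta>))) = 0"
    by (simp add: gl_bracket_pvar_pvar peval_simps)
qed

text \<open>At a point of the surface, the directions along the surface do not see \<open>h\<close>, and the remaining
  ones are the constraints, whose brackets with \<open>g\<close> vanish.\<close>

lemma gl_bracket_vanishing:
  assumes h: "pvars h \<subseteq> gl_vars N p" "\<And>J. J \<in> constraint_surface N p \<Longrightarrow> peval J h = 0"
    and g: "gauge_invariant N p g" and J: "J \<in> constraint_surface N p"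
  shows "peval J (gl_bracket h g) = 0"
proof -
  have "peval J (partial u h * gl_bracket (pvar u) g) = 0" if u: "u \<in> gl_vars N p" for u
  proof -
    obtain \<alpha> \<beta> where ab: "u = (\<alpha>, \<beta>)" by (cases u)
    show ?thesis
    proof (cases "snd \<beta> < snd \<alpha>")
      case True
      then show ?thesis using gauge_invariantD[OF g _ _ True J] u by (simp add: peval_mult ab)
    next
      case False
      \<comment> \<open>An entry on or above the block diagonal is free on the surface, so the whole
        line through \<open>J\<close> in this direction stays inside it.\<close>
      have "J(u := t) \<in> constraint_surface N p" for t
        using J u False by (auto simp: mem_constraint_surface_iff matrices_def ab)
      then have "(\<lambda>t. peval (J(u := t)) h) = (\<lambda>t. 0)" using h(2) by simp
      moreover have "((\<lambda>t. peval (J(u := t)) h) has_field_derivative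
          (\<Sum>v\<in>gl_vars N p. peval (J(u := J u)) (partial v h) * (if v = u then 1 else 0))) (at (J u))"
        using h(1) by (intro has_field_derivative_peval) (auto simp: fun_upd_apply)
      ultimately have "((\<lambda>t. 0) has_field_derivative
          (\<Sum>v\<in>gl_vars N p. peval (J(u := J u)) (partial v h) * (if v = u then 1 else 0))) (at (J u))"
        by simp
      from DERIV_unique[OF this DERIV_const]
      have "(\<Sum>v\<in>gl_vars N p. peval (J(u := J u)) (partial v h) * (if v = u then 1 else 0)) = 0" .
      then have "peval J (partial u h) = 0" using u by (simp add: if_distrib cong: if_cong)
      then show ?thesis by (simp add: peval_mult)
    qed
  qed
  then show ?thesis
    using poly_bracket_expand_left[of "gl_vars N p" h gl_gen_bracket g] h(1) by (simp add: peval_sum)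
qed

text \<open>A constraint entry is itself gauge invariant, so it can take the place of
  \<open>g\<close> in \<open>gl_bracket_vanishing\<close>.\<close>

lemma gauge_invariant_vanishing:
  assumes "pvars h \<subseteq> gl_vars N p" "\<And>J. J \<in> constraint_surface N p \<Longrightarrow> peval J h = 0"
  shows "gauge_invariant N p h"
  unfolding gauge_invariant_iff
proof (intro ballI impI)
  fix \<alpha> \<beta> J
  assume *: "\<alpha> \<in> indices N p" "\<beta> \<in> indices N p" "snd \<beta> < snd \<alpha>" and J: "J \<in> constraint_surface N p"
  show "peval J (gl_bracket (pvar (\<alpha>, \<beta>)) h) = 0"
    using gl_bracket_vanishing[OF assms gauge_invariant_constraint[OF *] J]
    by (subst gl_bracket_antisym) (simp add: peval_uminus)
qed

text \<open>By Jacobi, {\<phi>, {f, g}} is a combination of {{\<phi>, f}, g} and {{\<phi>, g}, f}.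
  The inner brackets vanish on the surface, hence so do their brackets with a gauge invariant
  polynomial.\<close>

lemma gauge_invariant_gl_bracket:
  assumes f: "pvars f \<subseteq> gl_vars N p" "gauge_invariant N p f"
    and g: "pvars g \<subseteq> gl_vars N p" "gauge_invariant N p g"
  shows "gauge_invariant N p (gl_bracket f g)"
  unfolding gauge_invariant_iff
proof (intro ballI impI)
  fix \<alpha> \<beta> J
  assume *: "\<alpha> \<in> indices N p" "\<beta> \<in> indices N p" "snd \<beta> < snd \<alpha>" and J: "J \<in> constraint_surface N p"
  let ?\<phi> = "pvar (\<alpha>, \<beta>)"
  have v: "pvars ?\<phi> \<subseteq> gl_vars N p" using * by (simp add: pvars_pvar)
  have 1: "peval J (gl_bracket (gl_bracket ?\<phi> f) g) = 0"
    by (rule gl_bracket_vanishing[OF pvars_gl_bracket[OF v f(1)] gauge_invariantD[OF f(2) *] g(2) J])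
  have 2: "peval J (gl_bracket (gl_bracket ?\<phi> g) f) = 0"
    by (rule gl_bracket_vanishing[OF pvars_gl_bracket[OF v g(1)] gauge_invariantD[OF g(2) *] f(2) J])
  have "gl_bracket ?\<phi> (gl_bracket f g) = gl_bracket (gl_bracket ?\<phi> f) g - gl_bracket (gl_bracket ?\<phi> g) f"
    using gl_bracket_jacobi[of ?\<phi> f g] gl_bracket_antisym[of "gl_bracket ?\<phi> f" g]
      gl_bracket_antisym[of "gl_bracket ?\<phi> g" f] gl_bracket_antisym[of g ?\<phi>]
    by (simp add: poly_bracket_simps algebra_simps)
  then show "peval J (gl_bracket ?\<phi> (gl_bracket f g)) = 0" using 1 2 by (simp add: peval_diff)
qed

section \<open>The W-algebra as a Poisson algebra\<close>

lemma on_surface_eq_iff: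
  "on_surface N p f = on_surface N p g \<longleftrightarrow> (\<forall>J\<in>constraint_surface N p. peval J f = peval J g)"
  by (auto simp: on_surface_def restrict_def fun_eq_iff)

lemma carrier_W_algebra:
  "carrier (W_algebra N p) = on_surface N p ` {f. pvars f \<subseteq> gl_vars N p \<and> gauge_invariant N p f}"
  by (simp add: W_algebra_def Collect_conj_eq)

lemma W_algebra_ops:
  "on_surface N p f \<otimes>\<^bsub>W_algebra N p\<^esub> on_surface N p g = on_surface N p (f * g)"
  "\<one>\<^bsub>W_algebra N p\<^esub> = on_surface N p 1"
  "\<zero>\<^bsub>W_algebra N p\<^esub> = on_surface N p 0"
  "on_surface N p f \<oplus>\<^bsub>W_algebra N p\<^esub> on_surface N p g = on_surface N p (f + g)"
  "c \<odot>\<^bsub>W_algebra N p\<^esub> on_surface N p f = on_surface N p (pconst c * f)"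
  by (auto simp: W_algebra_def on_surface_def restrict_def fun_eq_iff peval_simps)

text \<open>The definite description in \<open>W_algebra\<close> ranges over all extensions of the
  two functions. Two extensions differ by a polynomial vanishing on the surface, and replacing them
  one after the other changes the bracket only by terms that vanish there.\<close>

lemma pbracket_W_algebra:
  assumes f: "pvars f \<subseteq> gl_vars N p" "gauge_invariant N p f"
    and g: "pvars g \<subseteq> gl_vars N p" "gauge_invariant N p g"
  shows "pbracket (W_algebra N p) (on_surface N p f) (on_surface N p g) = on_surface N p (gl_bracket f g)"
proof -
  have unique: "on_surface N p (gl_bracket f' g') = on_surface N p (gl_bracket f g)"
    if f': "pvars f' \<subseteq> gl_vars N p" "on_surface N p f' = on_surface N p f"
      and g': "pvars g' \<subseteq> gl_vars N p" "on_surface N p g' = on_surface N p g" for f' g'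
    unfolding on_surface_eq_iff
  proof
    fix J assume J: "J \<in> constraint_surface N p"
    have df: "pvars (f' - f) \<subseteq> gl_vars N p" and dg: "pvars (g' - g) \<subseteq> gl_vars N p"
      using f(1) f'(1) g(1) g'(1) pvars_diff[of f' f] pvars_diff[of g' g] by blast+
    have zf: "peval K (f' - f) = 0" and zg: "peval K (g' - g) = 0" if "K \<in> constraint_surface N p" for K
      using f'(2) g'(2) that by (simp_all add: on_surface_eq_iff peval_diff)
    \<comment> \<open>The extension \<open>g'\<close> is only known to agree with \<open>g\<close>
      on the surface; it inherits gauge invariance because the difference vanishes there.\<close>
    have "gauge_invariant N p (g + (g' - g))"
      by (intro gauge_invariant_add g gauge_invariant_vanishing dg zg)
    then have "peval J (gl_bracket (f' - f) g') = 0"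
      by (intro gl_bracket_vanishing[OF df zf _ J]) simp_all
    moreover have "peval J (gl_bracket (g' - g) f) = 0"
      by (intro gl_bracket_vanishing[OF dg zg f(2) J])
    moreover have "gl_bracket f' g' = gl_bracket f g + gl_bracket (f' - f) g' - gl_bracket (g' - g) f"
      using gl_bracket_antisym[of g' f] gl_bracket_antisym[of g f] by (simp add: poly_bracket_simps)
    ultimately show "peval J (gl_bracket f' g') = peval J (gl_bracket f g)" by (simp add: peval_simps)
  qed
  have "pbracket (W_algebra N p) (on_surface N p f) (on_surface N p g) =
    (THE H. \<exists>f' g'. pvars f' \<subseteq> gl_vars N p \<and> pvars g' \<subseteq> gl_vars N p \<and>
       on_surface N p f' = on_surface N p f \<and> on_surface N p g' = on_surface N p g \<and>
       H = on_surface N p (gl_bracket f' g'))"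
    by (simp add: W_algebra_def)
  also have "\<dots> = on_surface N p (gl_bracket f g)"
  proof (rule the_equality)
    show "\<exists>f' g'. pvars f' \<subseteq> gl_vars N p \<and> pvars g' \<subseteq> gl_vars N p \<and>
       on_surface N p f' = on_surface N p f \<and> on_surface N p g' = on_surface N p g \<and>
       on_surface N p (gl_bracket f g) = on_surface N p (gl_bracket f' g')"
      using f(1) g(1) by (intro exI[of _ f] exI[of _ g] conjI refl)
  next
    fix H assume "\<exists>f' g'. pvars f' \<subseteq> gl_vars N p \<and> pvars g' \<subseteq> gl_vars N p \<and>
       on_surface N p f' = on_surface N p f \<and> on_surface N p g' = on_surface N p g \<and>
       H = on_surface N p (gl_bracket f' g')"
    then show "H = on_surface N p (gl_bracket f g)" by (elim exE conjE) (simp only: unique)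
  qed
  finally show ?thesis .
qed

lemma poisson_algebra_W_algebra: "poisson_algebra (W_algebra N p)"
proof -
  let ?W = "W_algebra N p"
  define C where "C f \<longleftrightarrow> pvars f \<subseteq> gl_vars N p \<and> gauge_invariant N p f" for f
  have closed: "on_surface N p f \<in> carrier ?W" if "C f" for f
    using that by (simp add: carrier_W_algebra C_def)
  have elim: "\<exists>f. x = on_surface N p f \<and> C f" if "x \<in> carrier ?W" for x
    using that by (auto simp: carrier_W_algebra C_def)
  have C: "C (f + g)" "C (f * g)" "C (- f)" "C (pconst c * f)" "C (gl_bracket f g)" "C 0" "C 1"
    if "C f" "C g" for f g c
    using that pvars_add[of f g] pvars_mult[of f g] pvars_mult[of "pconst c" f] pvars_gl_bracket[of f N p g]
    by (auto simp: C_def gauge_invariant_add gauge_invariant_uminus gauge_invariant_mult gauge_invariant_gl_bracket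
        simp del: split_paired_All)
  have C01: "C 0" "C 1" "C (pconst c)" for c by (simp_all add: C_def)
  note C34 = C(3,4)[OF _ C01(1)]
  note ops = W_algebra_ops on_surface_eq_iff peval_simps
  have neg: "on_surface N p (- f) \<oplus>\<^bsub>?W\<^esub> on_surface N p f = \<zero>\<^bsub>?W\<^esub>" for f
    by (simp add: ops)
  have cr: "cring ?W"
  proof (rule cringI[OF abelian_groupI comm_monoidI])
    show "\<exists>y\<in>carrier ?W. y \<oplus>\<^bsub>?W\<^esub> x = \<zero>\<^bsub>?W\<^esub>" if "x \<in> carrier ?W" for x
      using elim[OF that] C(3) neg closed by metis
  qed (auto dest!: elim simp: ops algebra_simps intro!: closed C C01)
  have alg: "algebra complex_ring ?W"
    by (rule algebraI[OF cring_complex_ring cr])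
      (auto dest!: elim simp: ops complex_ring_def algebra_simps intro!: closed C C01)
  interpret W: algebra complex_ring ?W by (rule alg)
  have uminus: "\<ominus>\<^bsub>?W\<^esub> on_surface N p f = on_surface N p (- f)"
    if "C f" for f
    using that by (intro W.minus_equality neg closed C)
  have pb: "pbracket ?W (on_surface N p f) (on_surface N p g) = on_surface N p (gl_bracket f g)"
    if "C f" "C g" for f g using that by (simp add: C_def pbracket_W_algebra)
  have "poisson_algebra_axioms ?W"
  proof
    fix x y z assume "x \<in> carrier ?W" "y \<in> carrier ?W" "z \<in> carrier ?W"
    then obtain f g h where x: "x = on_surface N p f" "C f"
      and y: "y = on_surface N p g" "C g"
      and z: "z = on_surface N p h" "C h"
      using elim by metis
    note xyz = x y z
    show "pbracket ?W (x \<oplus>\<^bsub>?W\<^esub> y) z = pbracket ?W x z \<oplus>\<^bsub>?W\<^esub> pbracket ?W y z"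
      by (simp add: xyz W_algebra_ops pb closed C C34 poly_bracket_simps)
    show "pbracket ?W x (y \<otimes>\<^bsub>?W\<^esub> z) = pbracket ?W x y \<otimes>\<^bsub>?W\<^esub> z \<oplus>\<^bsub>?W\<^esub> y \<otimes>\<^bsub>?W\<^esub> pbracket ?W x z"
      by (simp add: xyz W_algebra_ops pb closed C C34 poly_bracket_simps)
    show "pbracket ?W x (pbracket ?W y z) \<oplus>\<^bsub>?W\<^esub> pbracket ?W y (pbracket ?W z x)
            \<oplus>\<^bsub>?W\<^esub> pbracket ?W z (pbracket ?W x y) = \<zero>\<^bsub>?W\<^esub>"
      by (simp add: xyz W_algebra_ops pb closed C C34 gl_bracket_jacobi)
  next
    fix x y c assume "x \<in> carrier ?W" "y \<in> carrier ?W"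
    then obtain f g where x: "x = on_surface N p f" "C f"
      and y: "y = on_surface N p g" "C g"
      using elim by metis
    note xy = x y
    show "pbracket ?W x y \<in> carrier ?W"
      by (simp add: xy pb closed C C34)
    show "pbracket ?W (c \<odot>\<^bsub>?W\<^esub> x) y = c \<odot>\<^bsub>?W\<^esub> pbracket ?W x y"
      by (simp add: xy W_algebra_ops pb closed C C34 poly_bracket_simps)
    show "pbracket ?W x y = \<ominus>\<^bsub>?W\<^esub> pbracket ?W y x"
      by (simp add: xy pb closed C C34 uminus gl_bracket_antisym[of f g])
  qed
  with alg show ?thesis by (simp add: poisson_algebra_def)
qed


section \<open>Gauge fixing\<close>

text \<open>Conjugation of \<open>J\<close> by \<open>1 + t E\<^sub>\<alpha>\<^sub>\<beta>\<close>, for \<open>\<alpha> \<noteq> \<beta>\<close>.\<close>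

definition elem_conj :: "idx \<Rightarrow> idx \<Rightarrow> complex \<Rightarrow> idx cmat \<Rightarrow> idx cmat" where
  "elem_conj \<alpha> \<beta> t J = (\<lambda>(\<gamma>, \<delta>). J (\<gamma>, \<delta>) + (if \<gamma> = \<alpha> then t * J (\<beta>, \<delta>) else 0)
     - (if \<delta> = \<beta> then t * J (\<gamma>, \<alpha>) else 0) - (if \<gamma> = \<alpha> \<and> \<delta> = \<beta> then t ^ 2 * J (\<beta>, \<alpha>) else 0))"

text \<open>For a target entry below the block diagonal, the terms added in row \<alpha> or column
  \<beta> come from entries at least two blocks below it, where \<open>J\<close> is 0.\<close>

lemma elem_conj_constraint_surface:
  assumes J: "J \<in> constraint_surface N p" and ab: "\<alpha> \<in> indices N p" "\<beta> \<in> indices N p" "snd \<alpha> < snd \<beta>"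
  shows "elem_conj \<alpha> \<beta> t J \<in> constraint_surface N p"
  unfolding mem_constraint_surface_iff
proof (intro conjI ballI impI)
  have m: "J (\<gamma>, \<delta>) = 0" if "\<not> (\<gamma> \<in> indices N p \<and> \<delta> \<in> indices N p)" for \<gamma> \<delta>
    using J that by (auto simp: mem_constraint_surface_iff matrices_def simp del: split_paired_All)
  show "elem_conj \<alpha> \<beta> t J \<in> matrices N p"
    unfolding matrices_def
  proof (intro CollectI allI impI)
    fix x assume "x \<notin> gl_vars N p"
    moreover obtain \<gamma> \<delta> where x: "x = (\<gamma>, \<delta>)" by (cases x)
    ultimately show "elem_conj \<alpha> \<beta> t J x = 0" using ab by (auto simp: elem_conj_def m)
  qed
  fix \<gamma> \<delta> assume *: "\<gamma> \<in> indices N p" "\<delta> \<in> indices N p" "snd \<delta> < snd \<gamma>"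
  have "J (\<beta>, \<delta>) = 0" if "\<gamma> = \<alpha>"
    using constraint_surface_entry[OF J ab(2) *(2)] ab(3) *(3) that by auto
  moreover have "J (\<gamma>, \<alpha>) = 0" if "\<delta> = \<beta>"
    using constraint_surface_entry[OF J *(1) ab(1)] ab(3) *(3) that by auto
  moreover have "\<not> (\<gamma> = \<alpha> \<and> \<delta> = \<beta>)" using ab(3) *(3) by auto
  ultimately have "elem_conj \<alpha> \<beta> t J (\<gamma>, \<delta>) = J (\<gamma>, \<delta>)" by (simp add: elem_conj_def)
  then show "elem_conj \<alpha> \<beta> t J (\<gamma>, \<delta>) = (if fst \<gamma> = fst \<delta> \<and> snd \<gamma> = Suc (snd \<delta>) then 1 else 0)"
    using constraint_surface_entry[OF J *] by simp
qed

text \<open>The derivative in \<open>t\<close> of \<open>f\<close> along the conjugates is the bracket of the constraint on the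
  entry \<open>(\<beta>, \<alpha>)\<close> with \<open>f\<close>.\<close>

lemma gauge_invariant_elem_conj:
  assumes J: "J \<in> constraint_surface N p" and ab: "\<alpha> \<in> indices N p" "\<beta> \<in> indices N p" "snd \<alpha> < snd \<beta>"
    and f: "pvars f \<subseteq> gl_vars N p" "gauge_invariant N p f"
  shows "peval (elem_conj \<alpha> \<beta> t J) f = peval J f"
proof -
  let ?J = "\<lambda>t. elem_conj \<alpha> \<beta> t J"
  define D where "D t v = peval (?J t) (gl_gen_bracket (\<beta>, \<alpha>) v)" for t v
  have ne: "\<alpha> \<noteq> \<beta>" "\<beta> \<noteq> \<alpha>" using ab(3) by auto
  have "((\<lambda>t. peval (?J t) f) has_field_derivative 0) (at t)" for t
  proof -
    have "((\<lambda>t. peval (?J t) f) has_field_derivative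
        (\<Sum>v\<in>gl_vars N p. peval (?J t) (partial v f) * D t v)) (at t)"
    proof (rule has_field_derivative_peval[OF _ f(1)])
      fix v assume "v \<in> gl_vars N p"
      obtain \<gamma> \<delta> where v: "v = (\<gamma>, \<delta>)" by (cases v)
      \<comment> \<open>The bracket is evaluated at the conjugate, not at \<open>J\<close>. At
        position (\<alpha>, \<beta>) each of its two terms has a correction linear in t, and
        together they are the derivative of the term with t^2.\<close>
      have "D t v = (if \<gamma> = \<alpha> then J (\<beta>, \<delta>) else 0) - (if \<delta> = \<beta> then J (\<gamma>, \<alpha>) else 0)
          - (if \<gamma> = \<alpha> \<and> \<delta> = \<beta> then 2 * t * J (\<beta>, \<alpha>) else 0)"
        using ne by (auto simp: D_def v gl_gen_bracket_def elem_conj_def peval_simps)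
      moreover have "((\<lambda>t. ?J t v) has_field_derivative (if \<gamma> = \<alpha> then J (\<beta>, \<delta>) else 0)
          - (if \<delta> = \<beta> then J (\<gamma>, \<alpha>) else 0) - (if \<gamma> = \<alpha> \<and> \<delta> = \<beta> then 2 * t * J (\<beta>, \<alpha>) else 0)) (at t)"
        unfolding v elem_conj_def
        by (cases "\<gamma> = \<alpha>"; cases "\<delta> = \<beta>") (auto intro!: derivative_eq_intros)
      ultimately show "((\<lambda>t. ?J t v) has_field_derivative D t v) (at t)" by simp
    qed simp
    also have "(\<Sum>v\<in>gl_vars N p. peval (?J t) (partial v f) * D t v) =
        peval (?J t) (gl_bracket (pvar (\<beta>, \<alpha>)) f)"
      using poly_bracket_pvar_left[of "gl_vars N p" f gl_gen_bracket "(\<beta>, \<alpha>)"] f(1)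
      by (simp add: D_def peval_simps)
    also have "\<dots> = 0"
      by (rule gauge_invariantD[OF f(2) ab(2) ab(1) ab(3)]) (rule elem_conj_constraint_surface[OF J ab])
    finally show ?thesis .
  qed
  then obtain c where "\<And>t. peval (?J t) f = c"
    using has_field_derivative_zero_constant[of UNIV "\<lambda>t. peval (?J t) f"] by auto
  moreover have "?J 0 = J" by (auto simp: elem_conj_def)
  ultimately show ?thesis by metis
qed

section \<open>Reduction to block companion matrices\<close>

definition companion_slice :: "nat \<Rightarrow> nat \<Rightarrow> idx cmat set" where
  "companion_slice N p = {J \<in> constraint_surface N p.
     \<forall>\<alpha>\<in>indices N p. \<forall>\<beta>\<in>indices N p. snd \<alpha> \<le> snd \<beta> \<and> snd \<beta> < p \<longrightarrow> J (\<alpha>, \<beta>) = 0}"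

text \<open>Conjugation by \<open>1 + t E\<close> with \<open>E\<close> at position \<open>((a, k), (b, l + 1))\<close> changes, among
  the entries in the first \<open>l\<close> block columns, only the one at \<open>((a, k), (b, l))\<close>, which it shifts
  by \<open>t\<close>.  So the block columns before the last can be cleared from left to right.\<close>

lemma gauge_fixing:
  assumes J: "J \<in> constraint_surface N p"
  shows "\<exists>J'\<in>companion_slice N p. \<forall>f. pvars f \<subseteq> gl_vars N p \<longrightarrow> gauge_invariant N p f \<longrightarrow> peval J' f = peval J f"
proof -
  define good where "good J' \<longleftrightarrow> J' \<in> constraint_surface N p \<and>
    (\<forall>f. pvars f \<subseteq> gl_vars N p \<longrightarrow> gauge_invariant N p f \<longrightarrow> peval J' f = peval J f)" for J'
  define zero where "zero S J' \<longleftrightarrow> (\<forall>x\<in>S. J' x = (0 :: complex))" for S and J' :: "idx cmat"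
  define Z where "Z c = {(\<alpha>, \<beta>). \<alpha> \<in> indices N p \<and> \<beta> \<in> indices N p \<and> snd \<alpha> \<le> snd \<beta> \<and> snd \<beta> = c}" for c
  have finZ: "finite (Z c)" for c
    by (rule finite_subset[of _ "gl_vars N p"]) (auto simp: Z_def)
  \<comment> \<open>Inside block column c the entries are cleared one at a time; S collects those
    that are already 0.\<close>
  have step: "\<exists>J'. good J' \<and> zero (\<Union>c'\<in>{..<c}. Z c') J' \<and> zero S J'"
    if c: "c < p" "\<exists>J'. good J' \<and> zero (\<Union>c'\<in>{..<c}. Z c') J'" and S: "S \<subseteq> Z c" for c S
  proof -
    have "finite S" using S finZ finite_subset by blast
    then show ?thesis using S
    proof (induction rule: finite_induct)
      case empty
      then show ?case using c(2) by (auto simp: zero_def)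
    next
      case (insert x S)
      then obtain J1 where J1: "good J1" "zero (\<Union>c'\<in>{..<c}. Z c') J1" "zero S J1" by auto
      obtain \<alpha> b where x: "x = (\<alpha>, (b, c))" and \<alpha>: "\<alpha> \<in> indices N p" "snd \<alpha> \<le> c" and b: "(b, c) \<in> indices N p"
        using insert(4) by (auto simp: Z_def)
      let ?\<beta> = "(b, Suc c)"
      have \<beta>: "?\<beta> \<in> indices N p" "snd \<alpha> < snd ?\<beta>" using \<alpha> b c(1) by (auto simp: indices_def)
      have s1: "J1 \<in> constraint_surface N p" using J1(1) by (simp add: good_def)
      define J2 where "J2 = elem_conj \<alpha> ?\<beta> (- J1 x) J1"
      have "good J2"
        using J1(1) elem_conj_constraint_surface[OF s1 \<alpha>(1) \<beta>] gauge_invariant_elem_conj[OF s1 \<alpha>(1) \<beta>]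
        by (simp add: good_def J2_def)
      moreover have J2: "J2 (\<gamma>, \<delta>) = (if (\<gamma>, \<delta>) = x then 0 else J1 (\<gamma>, \<delta>))"
        if "\<gamma> \<in> indices N p" "\<delta> \<in> indices N p" "snd \<delta> \<le> c" for \<gamma> \<delta>
      proof -
        have "J1 (?\<beta>, \<delta>) = (if \<delta> = (b, c) then 1 else 0)"
          using constraint_surface_entry[OF s1 \<beta>(1) that(2)] that(3) by (cases \<delta>) auto
        moreover have "\<delta> \<noteq> ?\<beta>" using that(3) by auto
        ultimately show ?thesis by (auto simp: J2_def elem_conj_def x)
      qed
      have "zero (\<Union>c'\<in>{..<c}. Z c') J2"
        unfolding zero_def
      proof
        fix y assume y: "y \<in> (\<Union>c'\<in>{..<c}. Z c')"
        then obtain \<gamma> \<delta> where "y = (\<gamma>, \<delta>)" "\<gamma> \<in> indices N p" "\<delta> \<in> indices N p" "snd \<delta> \<le> c"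
          by (auto simp: Z_def)
        then show "J2 y = 0" using J2 J1(2) y by (auto simp: zero_def)
      qed
      moreover have "zero (insert x S) J2"
        unfolding zero_def
      proof
        fix y assume y: "y \<in> insert x S"
        then have "y \<in> Z c" using insert(4) by auto
        then obtain \<gamma> \<delta> where "y = (\<gamma>, \<delta>)" "\<gamma> \<in> indices N p" "\<delta> \<in> indices N p" "snd \<delta> \<le> c"
          by (auto simp: Z_def)
        then show "J2 y = 0" using J2 J1(3) y by (auto simp: zero_def)
      qed
      ultimately show ?case by blast
    qed
  qed
  have "\<exists>J'. good J' \<and> zero (\<Union>c'\<in>{..<c}. Z c') J'" if "c \<le> p" for c
    using that
  proof (induction c)
    case 0
    then show ?case using J by (auto simp: good_def zero_def)
  next
    case (Suc c)
    then have "\<exists>J'. good J' \<and> zero (\<Union>c'\<in>{..<c}. Z c') J' \<and> zero (Z c) J'" by (intro step) auto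
    then show ?case by (auto simp: zero_def lessThan_Suc)
  qed
  from this[of p] obtain J' where "good J'" "zero (\<Union>c'\<in>{..<p}. Z c') J'" by auto
  then have "J' \<in> companion_slice N p"
    by (auto simp: companion_slice_def good_def zero_def Z_def)
  with \<open>good J'\<close> show ?thesis by (auto simp: good_def)
qed


section \<open>The Yangian generators\<close>

text \<open>On the constraint surface, \<open>s_poly N p m\<close> is the coefficient of \<open>u\<^sup>-\<^sup>m\<close> in \<open>u\<^sup>p\<close> times the
  lower left \<open>N \<times> N\<close> block of the resolvent \<open>(u - J)\<^sup>-\<^sup>1\<close>, and \<open>x_poly\<close> gives the coefficients
  of the inverse series.\<close>

definition s_poly :: "nat \<Rightarrow> nat \<Rightarrow> nat \<Rightarrow> nat \<Rightarrow> nat \<Rightarrow> (idx \<times> idx) cpoly" where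
  "s_poly N p m i j = (if m = 0 then (if i = j then 1 else 0) else mat_power N p (p - 1 + m) (i, p) (j, 1))"

function x_poly :: "nat \<Rightarrow> nat \<Rightarrow> nat \<Rightarrow> nat \<Rightarrow> nat \<Rightarrow> (idx \<times> idx) cpoly" where
  "x_poly N p n i j = (if n = 0 then (if i = j then 1 else 0)
     else - (\<Sum>a=1..n. \<Sum>q=1..N. s_poly N p a i q * x_poly N p (n - a) q j))"
  by auto
termination by (relation "measure (\<lambda>(N, p, n, i, j). n)") auto

declare x_poly.simps [simp del]

definition t_poly :: "nat \<Rightarrow> nat \<Rightarrow> nat \<Rightarrow> nat \<Rightarrow> nat \<Rightarrow> (idx \<times> idx) cpoly" where
  "t_poly N p n i j = pconst ((- 1) ^ n) * x_poly N p n i j"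

lemma x_poly_0: "x_poly N p 0 i j = (if i = j then 1 else 0)"
  by (subst x_poly.simps) simp

lemma t_poly_0: "t_poly N p 0 i j = (if i = j then 1 else 0)"
  by (simp add: t_poly_def x_poly_0 pconst_1)

text \<open>For n > 0, the recursion of \<open>x_poly\<close> is this identity solved for its term
  with a = 0, where the coefficient of S is the identity.\<close>

lemma s_poly_x_poly:
  assumes "i \<in> {1..N}" "j \<in> {1..N}"
  shows "(\<Sum>q=1..N. \<Sum>a=0..n. s_poly N p a i q * x_poly N p (n - a) q j) = (if n = 0 \<and> i = j then 1 else 0)"
proof (cases "n = 0")
  case True
  then show ?thesis using assms
    by (simp add: s_poly_def x_poly_0 if_distrib[of "\<lambda>c. c * _"] cong: if_cong)
next
  case False
  have "(\<Sum>q=1..N. \<Sum>a=0..n. s_poly N p a i q * x_poly N p (n - a) q j) =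
      (\<Sum>q=1..N. s_poly N p 0 i q * x_poly N p n q j) +
      (\<Sum>q=1..N. \<Sum>a=1..n. s_poly N p a i q * x_poly N p (n - a) q j)"
    by (simp add: sum.atLeast_Suc_atMost[of 0 n] sum.distrib)
  also have "(\<Sum>q=1..N. s_poly N p 0 i q * x_poly N p n q j) = x_poly N p n i j"
    using assms by (simp add: s_poly_def if_distrib[of "\<lambda>c. c * _"] cong: if_cong)
  also have "(\<Sum>q=1..N. \<Sum>a=1..n. s_poly N p a i q * x_poly N p (n - a) q j) = - x_poly N p n i j"
    using False by (subst (2) x_poly.simps) (subst sum.swap, simp)
  finally show ?thesis using False by simp
qed

text \<open>A bracket with the entry (\<alpha>, \<beta>) can be nonzero only if \<beta> is the row
  or \<alpha> the column of the entry of the power. For \<alpha> in a lower block row than \<beta>,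
  neither fits row block p and column block 1.\<close>

lemma gauge_invariant_mat_power:
  assumes "p \<ge> 1" "i \<in> {1..N}" "j \<in> {1..N}"
  shows "gauge_invariant N p (mat_power N p n (i, p) (j, 1))"
  unfolding gauge_invariant_iff
  by (auto simp: gl_bracket_pvar_mat_power indices_def)

lemma s_poly_props:
  assumes "p \<ge> 1" "i \<in> {1..N}" "j \<in> {1..N}"
  shows "pvars (s_poly N p m i j) \<subseteq> gl_vars N p" "gauge_invariant N p (s_poly N p m i j)"
  using assms pvars_mat_power[of "(i, p)" N p "(j, 1)"] gauge_invariant_mat_power[OF assms]
  by (auto simp: s_poly_def indices_def)

lemma x_poly_props:
  assumes "p \<ge> 1" "i \<in> {1..N}" "j \<in> {1..N}"
  shows "pvars (x_poly N p n i j) \<subseteq> gl_vars N p \<and> gauge_invariant N p (x_poly N p n i j)"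
  using assms(2)
proof (induction n arbitrary: i rule: less_induct)
  case (less n)
  show ?case
  proof (cases "n = 0")
    case False
    have *: "pvars (s_poly N p a i q * x_poly N p (n - a) q j) \<subseteq> gl_vars N p"
      "gauge_invariant N p (s_poly N p a i q * x_poly N p (n - a) q j)"
      if "a \<in> {1..n}" "q \<in> {1..N}" for a q
      using less(1)[of "n - a" q] s_poly_props[OF assms(1) less(2) that(2), of a] that False
        pvars_mult[of "s_poly N p a i q" "x_poly N p (n - a) q j"]
      by (auto intro!: gauge_invariant_mult simp del: split_paired_All)
    have "pvars (\<Sum>a=1..n. \<Sum>q=1..N. s_poly N p a i q * x_poly N p (n - a) q j) \<subseteq> gl_vars N p"
      by (intro pvars_sum *)
    moreover have "gauge_invariant N p (- (\<Sum>a=1..n. \<Sum>q=1..N. s_poly N p a i q * x_poly N p (n - a) q j))"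
      by (intro gauge_invariant_uminus gauge_invariant_sum *)
    ultimately show ?thesis using False by (subst (1 2) x_poly.simps) simp
  qed (simp add: x_poly_0)
qed

lemma t_poly_props:
  assumes "p \<ge> 1" "i \<in> {1..N}" "j \<in> {1..N}"
  shows "pvars (t_poly N p n i j) \<subseteq> gl_vars N p" "gauge_invariant N p (t_poly N p n i j)"
  using x_poly_props[OF assms, of n] pvars_mult[of "pconst ((- 1) ^ n)" "x_poly N p n i j"]
  by (auto simp: t_poly_def intro!: gauge_invariant_mult)

text \<open>On the surface, \<open>J\<close> sends a basis vector of block k to its copy in block k
  + 1 plus terms in blocks up to k. Starting from block 1, the n-th power therefore reaches block n
  + 1 and no further, with coefficient 1.\<close>

lemma peval_mat_power_low:
  assumes J: "J \<in> constraint_surface N p" and "j \<in> {1..N}" "p \<ge> 1"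
    and "\<alpha> \<in> indices N p" "snd \<alpha> \<ge> Suc n"
  shows "peval J (mat_power N p n \<alpha> (j, 1)) = (if \<alpha> = (j, Suc n) then 1 else 0)"
  using assms(4,5)
proof (induction n arbitrary: \<alpha>)
  case 0
  then show ?case by simp
next
  case (Suc n)
  have j1: "(j, 1) \<in> indices N p" using assms by (simp add: indices_def)
  have "peval J (mat_power N p (Suc n) \<alpha> (j, 1)) =
      (\<Sum>\<gamma>\<in>indices N p. J (\<alpha>, \<gamma>) * peval J (mat_power N p n \<gamma> (j, 1)))"
    by (simp only: mat_power_Suc_left[OF Suc.prems(1) j1] peval_simps peval_pvar)
  also have "\<dots> = (\<Sum>\<gamma>\<in>indices N p. if \<gamma> = (j, Suc n) then (if \<alpha> = (j, Suc (Suc n)) then 1 else 0) else 0)"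
  proof (intro sum.cong refl)
    fix \<gamma> assume g: "\<gamma> \<in> indices N p"
    show "J (\<alpha>, \<gamma>) * peval J (mat_power N p n \<gamma> (j, 1)) =
        (if \<gamma> = (j, Suc n) then (if \<alpha> = (j, Suc (Suc n)) then 1 else 0) else 0)"
    proof (cases "snd \<gamma> \<ge> Suc n")
      case True
      then have "peval J (mat_power N p n \<gamma> (j, 1)) = (if \<gamma> = (j, Suc n) then 1 else 0)"
        using Suc.IH g by blast
      moreover have "J (\<alpha>, \<gamma>) = (if \<alpha> = (j, Suc (Suc n)) then 1 else 0)" if "\<gamma> = (j, Suc n)"
        using constraint_surface_entry[OF J Suc.prems(1) g] Suc.prems that by (cases \<alpha>) auto
      ultimately show ?thesis by simp
    next
      case False
      then have "J (\<alpha>, \<gamma>) = 0"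
        using constraint_surface_entry[OF J Suc.prems(1) g] Suc.prems by auto
      then show ?thesis using False by auto
    qed
  qed
  also have "\<dots> = (if \<alpha> = (j, Suc (Suc n)) then 1 else 0)"
    using Suc.prems assms by (auto simp: indices_def)
  finally show ?case .
qed

text \<open>The relation comes from \<open>gl_bracket_mat_power\<close>, but \<open>s_poly\<close>
  at index 0 is a constant and the corresponding block of the power p - 1 is not. The two agree on
  the surface and all polynomials involved are gauge invariant, so the exchange does not affect the
  brackets there.\<close>

lemma s_poly_bracket:
  assumes p: "p \<ge> 1" and ijkl: "i \<in> {1..N}" "j \<in> {1..N}" "k \<in> {1..N}" "l \<in> {1..N}"
    and J: "J \<in> constraint_surface N p"
  shows "peval J (gl_bracket (s_poly N p (Suc m) i j) (s_poly N p n k l))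
      - peval J (gl_bracket (s_poly N p m i j) (s_poly N p (Suc n) k l))
    = peval J (s_poly N p m k j) * peval J (s_poly N p n i l) - peval J (s_poly N p n k j) * peval J (s_poly N p m i l)"
proof -
  define M where "M m i j = mat_power N p (p - 1 + m) (i, p) (j, 1)" for m i j
  have inv: "gauge_invariant N p (M m i j)" "pvars (M m i j) \<subseteq> gl_vars N p"
    if "i \<in> {1..N}" "j \<in> {1..N}" for m i j
    using that p pvars_mat_power[of "(i, p)" N p "(j, 1)"] gauge_invariant_mat_power[of p i N j]
    by (auto simp: M_def indices_def)
  have M0: "peval K (M 0 i j) = (if i = j then 1 else 0)"
    if "i \<in> {1..N}" "j \<in> {1..N}" "K \<in> constraint_surface N p" for K i j
    using peval_mat_power_low[OF that(3,2) p, of "(i, p)" "p - 1"] that p by (auto simp: M_def indices_def)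
  have val: "peval J (s_poly N p m i j) = peval J (M m i j)" if "i \<in> {1..N}" "j \<in> {1..N}" for m i j
    using M0[OF that J] by (auto simp: s_poly_def M_def)
  have diff: "peval K (s_poly N p m i j - M m i j) = 0"
    if "i \<in> {1..N}" "j \<in> {1..N}" "K \<in> constraint_surface N p" for K m i j
    using M0[OF that] by (auto simp: s_poly_def M_def peval_diff)
  have pv: "pvars (s_poly N p m i j - M m i j) \<subseteq> gl_vars N p" if "i \<in> {1..N}" "j \<in> {1..N}" for m i j
    by (rule order_trans[OF pvars_diff Un_least[OF s_poly_props(1)[OF p that] inv(2)[OF that]]])
  have br: "peval J (gl_bracket (s_poly N p m i j) (s_poly N p n k l)) = peval J (gl_bracket (M m i j) (M n k l))"
    for m n
  proof -
    have 1: "peval J (gl_bracket (s_poly N p m i j - M m i j) (s_poly N p n k l)) = 0"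
      by (rule gl_bracket_vanishing[OF pv diff s_poly_props(2)[OF p] J]) (use ijkl in auto)
    have 2: "peval J (gl_bracket (s_poly N p n k l - M n k l) (M m i j)) = 0"
      by (rule gl_bracket_vanishing[OF pv diff inv(1) J]) (use ijkl in auto)
    show ?thesis using 1 2 gl_bracket_antisym[of "s_poly N p n k l" "M m i j"] gl_bracket_antisym[of "M n k l" "M m i j"]
      by (simp add: poly_bracket_simps peval_simps)
  qed
  have "gl_bracket (M (Suc m) i j) (M n k l) - gl_bracket (M m i j) (M (Suc n) k l) =
      M m k j * M n i l - M m i l * M n k j"
    using gl_bracket_mat_power[of "(i, p)" N p "(j, 1)" "(k, p)" "(l, 1)" "p - 1 + m" "p - 1 + n"] ijkl p
    by (simp add: M_def indices_def)
  then have "peval J (gl_bracket (M (Suc m) i j) (M n k l)) - peval J (gl_bracket (M m i j) (M (Suc n) k l)) =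
      peval J (M m k j) * peval J (M n i l) - peval J (M m i l) * peval J (M n k j)"
    by (metis peval_diff peval_mult)
  then show ?thesis
    unfolding br val[OF ijkl(3,2)] val[OF ijkl(1,4)] by (simp add: mult.commute)
qed


lemma t_poly_bracket:
  assumes p: "p \<ge> 1" and ijkl: "i \<in> {1..N}" "j \<in> {1..N}" "k \<in> {1..N}" "l \<in> {1..N}"
    and J: "J \<in> constraint_surface N p"
  defines "T \<equiv> \<lambda>n i j. peval J (t_poly N p n i j)"
  shows "peval J (gl_bracket (t_poly N p m i j) (t_poly N p n k l)) =
    (\<Sum>r<min m n. T r k j * T (m + n - r - 1) i l - T (m + n - r - 1) k j * T r i l)"
proof -
  let ?s = "s_poly N p" and ?x = "x_poly N p"
  have sx: "(\<Sum>q=1..N. Abs_fps (\<lambda>m. peval J (?s m i q)) * Abs_fps (\<lambda>m. peval J (?x m q j))) = (if i = j then 1 else 0)"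
    if "i \<in> {1..N}" "j \<in> {1..N}" for i j
  proof (rule fps_ext)
    fix n
    have "fps_nth (\<Sum>q=1..N. Abs_fps (\<lambda>m. peval J (?s m i q)) * Abs_fps (\<lambda>m. peval J (?x m q j))) n =
        peval J (\<Sum>q=1..N. \<Sum>a=0..n. ?s a i q * ?x (n - a) q j)"
      by (simp add: fps_sum_nth fps_mult_nth peval_simps)
    also have "\<dots> = fps_nth (if i = j then 1 else 0) n"
      unfolding s_poly_x_poly[OF that] by (simp add: fps_one_nth)
    finally show "fps_nth (\<Sum>q=1..N. Abs_fps (\<lambda>m. peval J (?s m i q)) * Abs_fps (\<lambda>m. peval J (?x m q j))) n =
        fps_nth (if i = j then 1 else 0) n" .
  qed
  \<comment> \<open>The coefficients of S X are constants, so their brackets vanish; expanded by the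
    Leibniz rule, this becomes the hypotheses \<open>L1\<close> and \<open>L2\<close> below.\<close>
  have const: "gl_bracket f (\<Sum>q=1..N. \<Sum>a=0..n. ?s a k q * ?x (n - a) q l) = 0"
    "gl_bracket (\<Sum>q=1..N. \<Sum>a=0..n. ?s a k q * ?x (n - a) q l) f = 0"
    if "k \<in> {1..N}" "l \<in> {1..N}" for k l n f
    unfolding s_poly_x_poly[OF that] by simp_all
  have rel: "peval J (gl_bracket (?x (Suc m) i j) (?x n k l)) - peval J (gl_bracket (?x m i j) (?x (Suc n) k l))
      = - (peval J (?x m k j) * peval J (?x n i l) - peval J (?x n k j) * peval J (?x m i l))" for m n
  proof -
    have "peval J (gl_bracket (?x (Suc m) i j) (?x n k l)) - peval J (gl_bracket (?x m i j) (?x (Suc n) k l))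
      = - (fps_nth (Abs_fps (\<lambda>m. peval J (?x m k j))) m * fps_nth (Abs_fps (\<lambda>m. peval J (?x m i l))) n
         - fps_nth (Abs_fps (\<lambda>m. peval J (?x m k j))) n * fps_nth (Abs_fps (\<lambda>m. peval J (?x m i l))) m)"
    proof (rule inverse_yangian_relation[where I = "{1..N}" and X = "\<lambda>i j. Abs_fps (\<lambda>m. peval J (?x m i j))"
          and S = "\<lambda>i j. Abs_fps (\<lambda>m. peval J (?s m i j))"
          and bss = "\<lambda>m i j n k l. peval J (gl_bracket (?s m i j) (?s n k l))"
          and bsx = "\<lambda>m i j n k l. peval J (gl_bracket (?s m i j) (?x n k l))"
          and bxx = "\<lambda>m i j n k l. peval J (gl_bracket (?x m i j) (?x n k l))", OF _ ijkl])
      fix m n i j k l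
      assume ij: "i \<in> {1..N}" "j \<in> {1..N}" and kl: "k \<in> {1..N}" "l \<in> {1..N}"
      have "peval J (gl_bracket (?s m i j) (\<Sum>q=1..N. \<Sum>a=0..n. ?s a k q * ?x (n - a) q l)) = 0"
        unfolding const[OF kl] by simp
      then show "(\<Sum>q\<in>{1..N}. \<Sum>a=0..n. fps_nth (Abs_fps (\<lambda>m. peval J (?s m k q))) a *
            peval J (gl_bracket (?s m i j) (?x (n - a) q l)) +
          peval J (gl_bracket (?s m i j) (?s a k q)) * fps_nth (Abs_fps (\<lambda>m. peval J (?x m q l))) (n - a)) = 0"
        by (simp add: poly_bracket_simps peval_simps add.commute)
      have "peval J (gl_bracket (\<Sum>q=1..N. \<Sum>a=0..m. ?s a i q * ?x (m - a) q j) (?x n k l)) = 0"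
        unfolding const[OF ij] by simp
      then show "(\<Sum>q\<in>{1..N}. \<Sum>a=0..m. fps_nth (Abs_fps (\<lambda>m. peval J (?s m i q))) a *
            peval J (gl_bracket (?x (m - a) q j) (?x n k l)) +
          peval J (gl_bracket (?s a i q) (?x n k l)) * fps_nth (Abs_fps (\<lambda>m. peval J (?x m q j))) (m - a)) = 0"
        by (simp add: poly_bracket_simps peval_simps add.commute)
      show "peval J (gl_bracket (?s (Suc m) i j) (?s n k l)) - peval J (gl_bracket (?s m i j) (?s (Suc n) k l)) =
        fps_nth (Abs_fps (\<lambda>m. peval J (?s m k j))) m * fps_nth (Abs_fps (\<lambda>m. peval J (?s m i l))) n -
        fps_nth (Abs_fps (\<lambda>m. peval J (?s m k j))) n * fps_nth (Abs_fps (\<lambda>m. peval J (?s m i l))) m"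
        using s_poly_bracket[OF p ij kl J] by simp
    qed (use sx in \<open>simp_all add: s_poly_def\<close>)
    then show ?thesis by simp
  qed
  define b where "b m n = peval J (gl_bracket (t_poly N p m i j) (t_poly N p n k l))" for m n
  define c where "c m n = T m k j * T n i l - T n k j * T m i l" for m n
  have "b m n = (\<Sum>r<min m n. c r (m + n - r - 1))"
  proof (rule yangian_telescope)
    show "b 0 n = 0" "b m 0 = 0" "c m n = - c n m" for m n by (simp_all add: b_def c_def t_poly_0)
    have b: "b m n = (- 1) ^ m * (- 1) ^ n * peval J (gl_bracket (?x m i j) (?x n k l))" for m n
      by (simp add: b_def t_poly_def poly_bracket_simps peval_simps)
    \<comment> \<open>Both brackets carry the sign (-1)^(m + n + 1), the products only (-1)^(m + n).
      The extra sign cancels the one produced by inversion.\<close>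
    show "b (Suc m) n - b m (Suc n) = c m n" for m n
    proof -
      have "b (Suc m) n - b m (Suc n) = - ((- 1) ^ m * (- 1) ^ n *
          (peval J (gl_bracket (?x (Suc m) i j) (?x n k l)) - peval J (gl_bracket (?x m i j) (?x (Suc n) k l))))"
        by (simp add: b algebra_simps)
      also have "\<dots> = c m n" unfolding rel by (simp add: c_def T_def t_poly_def peval_simps algebra_simps)
      finally show ?thesis .
    qed
  qed
  then show ?thesis by (simp add: b_def c_def)
qed


section \<open>The generators on the slice\<close>

text \<open>Before the last block column a companion matrix is a pure shift, so the basis vector at
  \<open>(b, l)\<close> is the power l - 1 of \<open>J\<close> applied to the one at
  \<open>(b, 1)\<close>.\<close>

lemma mat_power_slice:
  assumes J: "J \<in> companion_slice N p" and "\<alpha> \<in> indices N p" and b: "b \<in> {1..N}" and "1 \<le> l" "l \<le> p"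
  shows "peval J (mat_power N p r \<alpha> (b, l)) = peval J (mat_power N p (r + l - 1) \<alpha> (b, 1))"
  using assms(4,5)
proof (induction l arbitrary: r)
  case (Suc l)
  show ?case
  proof (cases "l = 0")
    case False
    with Suc have l: "(b, l) \<in> indices N p" "(b, Suc l) \<in> indices N p" "l < p"
      using b by (auto simp: indices_def)
    have e: "J (\<gamma>, (b, l)) = (if \<gamma> = (b, Suc l) then 1 else 0)" if "\<gamma> \<in> indices N p" for \<gamma>
    proof (cases "l < snd \<gamma>")
      case True
      then show ?thesis using J constraint_surface_entry[of J N p \<gamma> "(b, l)"] that l
        by (cases \<gamma>) (auto simp: companion_slice_def)
    next
      case False
      then show ?thesis using J that l by (auto simp: companion_slice_def)
    qed
    have "peval J (mat_power N p (Suc r) \<alpha> (b, l)) =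
        (\<Sum>\<gamma>\<in>indices N p. peval J (mat_power N p r \<alpha> \<gamma>) * (if \<gamma> = (b, Suc l) then 1 else 0))"
      by (simp add: peval_simps e)
    also have "\<dots> = peval J (mat_power N p r \<alpha> (b, Suc l))"
      using l by (simp add: if_distrib[of "\<lambda>c. _ * c"] cong: if_cong)
    finally show ?thesis using Suc.IH[of "Suc r"] Suc.prems False by simp
  qed simp
qed simp

text \<open>The last block column expresses \<open>J\<close> applied to block p through lower powers
  of \<open>J\<close> applied to block 1. Read in row block p, this is a linear recursion for the
  coefficients of S, which says S A = 1. Since also S X = 1, cancellation of S gives X = A.\<close>

lemma x_poly_slice:
  assumes J: "J \<in> companion_slice N p" and p: "p \<ge> 1" and "i \<in> {1..N}" "j \<in> {1..N}"
  shows "peval J (x_poly N p n i j) =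
    (if n = 0 then (if i = j then 1 else 0) else if n \<le> p then - J ((i, p + 1 - n), (j, p)) else 0)"
proof -
  define A where "A n i j = (if n = 0 then (if i = j then 1 else 0)
      else if n \<le> p then - J ((i, p + 1 - n), (j, p)) else 0)" for n i j
  have surf: "J \<in> constraint_surface N p" using J by (simp add: companion_slice_def)
  define s where "s n i j = peval J (s_poly N p n i j)" for n i j
  have s0: "s 0 i j = (if i = j then 1 else 0)" for i j by (simp add: s_def s_poly_def)
  \<comment> \<open>The index shift by p - 1 is the number of steps from block 1 to block p: smaller
    powers have no component there, and the power p - 1 gives the identity.\<close>
  have low: "peval J (mat_power N p r (i, p) (q, 1)) = (if r < p - 1 then 0 else s (r - (p - 1)) i q)"
    if "i \<in> {1..N}" "q \<in> {1..N}" for r i q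
  proof (cases "r \<le> p - 1")
    case True
    then show ?thesis
      using peval_mat_power_low[OF surf that(2) p, of "(i, p)" r] that p by (auto simp: s0 indices_def)
  next
    case False
    then show ?thesis by (simp add: s_def s_poly_def)
  qed
  \<comment> \<open>One factor of the n-th power supplies the last block column; in the remaining
    power n - 1, \<open>mat_power_slice\<close> trades column block k for k - 1 further
    factors.\<close>
  have rec: "s n i j = (\<Sum>q=1..N. \<Sum>a<n. if n - a \<le> p then s a i q * J ((q, p + 1 - (n - a)), (j, p)) else 0)"
    if n: "n \<ge> 1" and ij: "i \<in> {1..N}" "j \<in> {1..N}" for n i j
  proof -
    have ip: "(i, p) \<in> indices N p" using ij p by (simp add: indices_def)
    have "s n i j = peval J (mat_power N p (n + p - 1) (i, p) (j, 1))"
      using n p by (simp add: s_def s_poly_def add.commute)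
    also have "\<dots> = peval J (mat_power N p n (i, p) (j, p))"
      using mat_power_slice[OF J ip ij(2) p order_refl, of n] by simp
    also have "\<dots> = peval J (mat_power N p (Suc (n - 1)) (i, p) (j, p))" using n by simp
    also have "\<dots> = (\<Sum>\<gamma>\<in>indices N p. peval J (mat_power N p (n - 1) (i, p) \<gamma>) * J (\<gamma>, (j, p)))"
      by (simp add: peval_simps)
    also have "\<dots> = (\<Sum>q=1..N. \<Sum>k=1..p. peval J (mat_power N p (n - 1) (i, p) (q, k)) * J ((q, k), (j, p)))"
      unfolding indices_def by (simp add: sum.cartesian_product)
    also have "\<dots> = (\<Sum>q=1..N. \<Sum>k=1..p. if n + k \<ge> p + 1 then s (n + k - 1 - p) i q * J ((q, k), (j, p)) else 0)"
    proof (intro sum.cong refl)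
      fix q k assume q: "q \<in> {1..N}" and k: "k \<in> {1..p}"
      have "peval J (mat_power N p (n - 1) (i, p) (q, k)) = peval J (mat_power N p (n - 1 + k - 1) (i, p) (q, 1))"
        using mat_power_slice[OF J ip q, of k "n - 1"] k by simp
      also have "\<dots> = (if n + k \<ge> p + 1 then s (n + k - 1 - p) i q else 0)"
        unfolding low[OF ij(1) q] using n k p by (auto intro!: arg_cong[of _ _ "\<lambda>m. s m i q"])
      finally show "peval J (mat_power N p (n - 1) (i, p) (q, k)) * J ((q, k), (j, p)) =
          (if n + k \<ge> p + 1 then s (n + k - 1 - p) i q * J ((q, k), (j, p)) else 0)" by simp
    qed
    also have "\<dots> = (\<Sum>q=1..N. \<Sum>a<n. if n - a \<le> p then s a i q * J ((q, p + 1 - (n - a)), (j, p)) else 0)"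
    proof (rule sum.cong[OF refl])
      fix q
      have "(\<Sum>k=1..p. if n + k \<ge> p + 1 then s (n + k - 1 - p) i q * J ((q, k), (j, p)) else 0) =
          (\<Sum>k\<in>{k\<in>{1..p}. n + k \<ge> p + 1}. s (n + k - 1 - p) i q * J ((q, k), (j, p)))"
        by (rule sum.inter_filter[symmetric]) simp
      \<comment> \<open>The new index is a = n + k - 1 - p. Then a < n means k \<le> p, and n - a
        \<le> p means k \<ge> 1.\<close>
      also have "\<dots> = (\<Sum>a\<in>{a\<in>{..<n}. n - a \<le> p}. s a i q * J ((q, p + 1 - (n - a)), (j, p)))"
        by (rule sum.reindex_bij_witness[where i = "\<lambda>a. p + 1 - (n - a)" and j = "\<lambda>k. n + k - 1 - p"]) auto
      also have "\<dots> = (\<Sum>a<n. if n - a \<le> p then s a i q * J ((q, p + 1 - (n - a)), (j, p)) else 0)"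
        by (rule sum.inter_filter) simp
      finally show "(\<Sum>k=1..p. if n + k \<ge> p + 1 then s (n + k - 1 - p) i q * J ((q, k), (j, p)) else 0) =
          (\<Sum>a<n. if n - a \<le> p then s a i q * J ((q, p + 1 - (n - a)), (j, p)) else 0)" .
    qed
    finally show ?thesis .
  qed
  have sA: "(\<Sum>q=1..N. \<Sum>a=0..n. s a i q * A (n - a) q j) = (if n = 0 \<and> i = j then 1 else 0)"
    if ij: "i \<in> {1..N}" "j \<in> {1..N}" for n i j
  proof (cases "n = 0")
    case True
    then show ?thesis using ij by (simp add: s0 A_def if_distrib[of "\<lambda>c. c * _"] cong: if_cong)
  next
    case False
    have "(\<Sum>q=1..N. \<Sum>a=0..n. s a i q * A (n - a) q j) =
        (\<Sum>q=1..N. s n i q * A 0 q j) + (\<Sum>q=1..N. \<Sum>a<n. s a i q * A (n - a) q j)"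
      by (simp add: atLeast0AtMost lessThan_Suc_atMost[symmetric] sum.distrib add.commute)
    also have "(\<Sum>q=1..N. s n i q * A 0 q j) = s n i j"
      using ij by (simp add: A_def if_distrib[of "\<lambda>c. _ * c"] cong: if_cong)
    also have "(\<Sum>q=1..N. \<Sum>a<n. s a i q * A (n - a) q j) =
        - (\<Sum>q=1..N. \<Sum>a<n. if n - a \<le> p then s a i q * J ((q, p + 1 - (n - a)), (j, p)) else 0)"
      unfolding sum_negf[symmetric] by (intro sum.cong refl) (auto simp: A_def)
    also have "\<dots> = - s n i j" using rec[OF _ ij, of n] False by simp
    finally show ?thesis using False by simp
  qed
  have "Abs_fps (\<lambda>n. peval J (x_poly N p n i j) - A n i j) = 0"
  proof (rule fps_matrix_left_cancel[where I = "{1..N}" and F = "\<lambda>i j. Abs_fps (\<lambda>n. s n i j)"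
        and Z = "\<lambda>i j. Abs_fps (\<lambda>n. peval J (x_poly N p n i j) - A n i j)"])
    fix i j assume ij: "i \<in> {1..N}" "j \<in> {1..N}"
    show "(\<Sum>q\<in>{1..N}. Abs_fps (\<lambda>n. s n i q) * Abs_fps (\<lambda>n. peval J (x_poly N p n q j) - A n q j)) = 0"
    proof (rule fps_ext)
      fix n
      have "fps_nth (\<Sum>q\<in>{1..N}. Abs_fps (\<lambda>n. s n i q) * Abs_fps (\<lambda>n. peval J (x_poly N p n q j) - A n q j)) n =
          peval J (\<Sum>q=1..N. \<Sum>a=0..n. s_poly N p a i q * x_poly N p (n - a) q j)
          - (\<Sum>q=1..N. \<Sum>a=0..n. s a i q * A (n - a) q j)"
        by (simp add: fps_sum_nth fps_mult_nth peval_simps s_def right_diff_distrib sum_subtractf)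
      also have "\<dots> = 0" unfolding s_poly_x_poly[OF ij] sA[OF ij] by simp
      finally show "fps_nth (\<Sum>q\<in>{1..N}. Abs_fps (\<lambda>n. s n i q) * Abs_fps (\<lambda>n. peval J (x_poly N p n q j) - A n q j)) n
          = fps_nth 0 n" by simp
    qed
  qed (use assms in \<open>simp_all add: s0\<close>)
  then have "fps_nth (Abs_fps (\<lambda>n. peval J (x_poly N p n i j) - A n i j)) n = 0" by simp
  then show ?thesis by (simp add: A_def)
qed

lemma t_poly_slice:
  assumes "J \<in> companion_slice N p" "p \<ge> 1" "i \<in> {1..N}" "j \<in> {1..N}" "n \<ge> 1"
  shows "peval J (t_poly N p n i j) = (if n \<le> p then - ((- 1) ^ n) * J ((i, p + 1 - n), (j, p)) else 0)"
  using x_poly_slice[OF assms(1-4), of n] assms(5) by (simp add: t_poly_def peval_simps)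

text \<open>On the slice the inverse series stops at degree p, and gauge invariance carries the
  vanishing to the whole surface.\<close>

lemma t_poly_truncated:
  assumes "p \<ge> 1" "i \<in> {1..N}" "j \<in> {1..N}" "n > p" "J \<in> constraint_surface N p"
  shows "peval J (t_poly N p n i j) = 0"
proof -
  obtain J' where "J' \<in> companion_slice N p" "peval J' (t_poly N p n i j) = peval J (t_poly N p n i j)"
    using gauge_fixing[OF assms(5)] t_poly_props[OF assms(1-3)] by blast
  then show ?thesis using t_poly_slice[of J' N p i j n] assms by simp
qed


section \<open>The isomorphism\<close>

definition t_subst :: "nat \<Rightarrow> nat \<Rightarrow> yvar \<Rightarrow> (idx \<times> idx) cpoly" where
  "t_subst N p = (\<lambda>(n, i, j). t_poly N p n i j)"

definition yangian_to_W :: "nat \<Rightarrow> nat \<Rightarrow> yvar cpoly \<Rightarrow> idx cmat \<Rightarrow> complex" where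
  "yangian_to_W N p f = on_surface N p (psubst (t_subst N p) f)"

lemma psubst_sum: "psubst \<sigma> (sum f A) = (\<Sum>i\<in>A. psubst \<sigma> (f i))"
  by (induction A rule: infinite_finite_induct) (simp_all add: psubst_add)

lemma t_subst_props:
  assumes "p \<ge> 1" "v \<in> yangian_vars N"
  shows "pvars (t_subst N p v) \<subseteq> gl_vars N p" "gauge_invariant N p (t_subst N p v)"
proof -
  obtain n i j where "v = (n, i, j)" "i \<in> {1..N}" "j \<in> {1..N}"
    using assms(2) by (auto simp: yangian_vars_def)
  then show "pvars (t_subst N p v) \<subseteq> gl_vars N p" "gauge_invariant N p (t_subst N p v)"
    using t_poly_props[OF assms(1)] by (simp_all add: t_subst_def)
qed

lemma psubst_t_subst_props:
  assumes p: "p \<ge> 1" and f: "pvars f \<subseteq> yangian_vars N"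
  shows "pvars (psubst (t_subst N p) f) \<subseteq> gl_vars N p" "gauge_invariant N p (psubst (t_subst N p) f)"
proof -
  show "pvars (psubst (t_subst N p) f) \<subseteq> gl_vars N p"
    using pvars_psubst[OF f t_subst_props(1)[OF p]] .
  show "gauge_invariant N p (psubst (t_subst N p) f)"
    using f
    by (induction rule: cpoly_induct)
      (simp_all add: psubst_add psubst_mult gauge_invariant_add gauge_invariant_mult t_subst_props(2)[OF p])
qed

lemma psubst_yangian_T: "psubst (t_subst N p) (yangian_T n i j) = t_poly N p n i j"
  by (simp add: yangian_T_def t_subst_def t_poly_0)

lemma yangian_gen_bracket_t_subst:
  assumes p: "p \<ge> 1" and uv: "u \<in> yangian_vars N" "v \<in> yangian_vars N" and J: "J \<in> constraint_surface N p"
  shows "peval J (psubst (t_subst N p) (yangian_gen_bracket u v)) = peval J (gl_bracket (t_subst N p u) (t_subst N p v))"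
proof -
  obtain m i j n k l where u: "u = (m, i, j)" and v: "v = (n, k, l)" by (metis surj_pair)
  have "i \<in> {1..N}" "j \<in> {1..N}" "k \<in> {1..N}" "l \<in> {1..N}"
    using uv by (auto simp: u v yangian_vars_def)
  from t_poly_bracket[OF p this J, of m n] show ?thesis
    by (simp add: u v yangian_gen_bracket_def psubst_sum psubst_diff psubst_mult psubst_yangian_T peval_simps)
      (simp add: t_subst_def)
qed

lemma pvars_yangian_T: "\<lbrakk>i \<in> {1..N}; j \<in> {1..N}\<rbrakk> \<Longrightarrow> pvars (yangian_T n i j) \<subseteq> yangian_vars N"
  by (simp add: yangian_T_def yangian_vars_def pvars_pvar)

lemma pvars_yangian_gen_bracket:
  assumes uv: "u \<in> yangian_vars N" "v \<in> yangian_vars N"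
  shows "pvars (yangian_gen_bracket u v) \<subseteq> yangian_vars N"
proof -
  obtain m i j n k l where u: "u = (m, i, j)" and v: "v = (n, k, l)" by (metis surj_pair)
  have *: "pvars (yangian_T a k j * yangian_T b i l) \<subseteq> yangian_vars N" for a b
    using uv pvars_yangian_T[of k N j a] pvars_yangian_T[of i N l b] pvars_mult[of "yangian_T a k j" "yangian_T b i l"]
    by (simp add: u v yangian_vars_def del: split_paired_All) blast
  show ?thesis
    unfolding u v yangian_gen_bracket_def prod.case
    by (intro pvars_sum order_trans[OF pvars_diff] Un_least *)
qed

lemma carrier_poisson_yangian [simp]: "carrier (poisson_yangian N) = {f. pvars f \<subseteq> yangian_vars N}"
  by (simp add: poisson_yangian_def poly_poisson_def)

lemma poisson_yangian_ops [simp]: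
  "x \<otimes>\<^bsub>poisson_yangian N\<^esub> y = x * y" "x \<oplus>\<^bsub>poisson_yangian N\<^esub> y = x + y"
  "\<one>\<^bsub>poisson_yangian N\<^esub> = 1" "\<zero>\<^bsub>poisson_yangian N\<^esub> = 0"
  "c \<odot>\<^bsub>poisson_yangian N\<^esub> x = pconst c * x"
  "pbracket (poisson_yangian N) = poly_bracket yangian_gen_bracket"
  by (simp_all add: poisson_yangian_def poly_poisson_def)

lemma cring_poisson_yangian: "cring (poisson_yangian N)"
  using algebra_poly_poisson unfolding poisson_yangian_def algebra_def by blast

lemma yangian_to_W_hom:
  assumes p: "p \<ge> 1"
  shows "yangian_to_W N p \<in> ring_hom (poisson_yangian N) (W_algebra N p)"
  by (rule ring_hom_memI)
    (use psubst_t_subst_props[OF p] in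
      \<open>auto simp: yangian_to_W_def carrier_W_algebra W_algebra_ops psubst_add psubst_mult\<close>)

text \<open>Both sides expand over pairs of variables by \<open>poly_bracket_psubst\<close>, where
  the Yangian relation for \<open>t_poly\<close> applies. That relation holds on the surface, which
  is all that equality in the target asks for.\<close>

lemma yangian_to_W_bracket:
  assumes p: "p \<ge> 1" and f: "pvars f \<subseteq> yangian_vars N" and g: "pvars g \<subseteq> yangian_vars N"
  shows "yangian_to_W N p (poly_bracket yangian_gen_bracket f g) =
    pbracket (W_algebra N p) (yangian_to_W N p f) (yangian_to_W N p g)"
proof -
  let ?\<sigma> = "t_subst N p"
  have "peval J (psubst ?\<sigma> (poly_bracket yangian_gen_bracket f g)) =
      peval J (gl_bracket (psubst ?\<sigma> f) (psubst ?\<sigma> g))" if J: "J \<in> constraint_surface N p" for J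
    unfolding poly_bracket_psubst unfolding poly_bracket_def[of yangian_gen_bracket] psubst_sum peval_sum
    using f g by (intro sum.cong refl)
      (simp add: psubst_mult peval_mult yangian_gen_bracket_t_subst[OF p _ _ J] subset_iff del: split_paired_All)
  then show ?thesis
    using psubst_t_subst_props[OF p f] psubst_t_subst_props[OF p g]
    by (simp add: yangian_to_W_def pbracket_W_algebra on_surface_eq_iff)
qed

text \<open>The generic companion matrix over the Yangian: its last block column is
  \<open>t_poly_slice\<close> solved for the matrix entries, the other entries being those forced on
  the slice.\<close>

definition slice_subst :: "nat \<Rightarrow> idx \<times> idx \<Rightarrow> yvar cpoly" where
  "slice_subst p = (\<lambda>((a, k), (b, l)).
     if l = p then pconst (- ((- 1) ^ (p + 1 - k))) * pvar (p + 1 - k, a, b)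
     else if a = b \<and> k = Suc l then 1 else 0)"

lemma pvars_slice_subst: "v \<in> gl_vars N p \<Longrightarrow> pvars (slice_subst p v) \<subseteq> yangian_vars N"
  using pvars_mult[of "pconst c" "pvar w" for c w]
  by (fastforce simp: slice_subst_def indices_def yangian_vars_def pvars_pvar split: prod.splits if_splits)

lemma peval_slice_subst:
  assumes J: "J \<in> companion_slice N p" and p: "p \<ge> 1" and v: "v \<in> gl_vars N p"
  shows "peval (\<lambda>w. peval J (t_subst N p w)) (slice_subst p v) = J v"
proof -
  obtain a k b l where v': "v = ((a, k), (b, l))" by (metis surj_pair)
  have a: "a \<in> {1..N}" "b \<in> {1..N}" and kl: "1 \<le> k" "k \<le> p" "1 \<le> l" "l \<le> p"
    using v by (auto simp: v' indices_def)
  have surf: "J \<in> constraint_surface N p" using J by (simp add: companion_slice_def)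
  show ?thesis
  proof (cases "l = p")
    case True
    have "((- 1 :: complex) ^ (p + 1 - k)) * (- 1) ^ (p + 1 - k) = 1"
      by (simp flip: power_mult_distrib)
    then show ?thesis
      using t_poly_slice[OF J p a, of "p + 1 - k"] kl True
      by (simp add: v' slice_subst_def peval_simps t_subst_def mult.assoc[symmetric])
  next
    case False
    show ?thesis
    proof (cases "l < k")
      case True
      then show ?thesis using constraint_surface_entry[OF surf, of "(a, k)" "(b, l)"] v False
        by (simp add: v' slice_subst_def)
    next
      case le: False
      then have "J v = 0" using J v False kl by (auto simp: v' companion_slice_def)
      then show ?thesis using le False by (simp add: v' slice_subst_def)
    qed
  qed
qed

text \<open>A gauge invariant polynomial is determined on the surface by its values on the slice.
  There every matrix entry is a polynomial in the generators, and inserting these expressions gives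
  the preimage \<open>q\<close>.\<close>

lemma yangian_to_W_surj:
  assumes p: "p \<ge> 1"
  shows "yangian_to_W N p ` carrier (poisson_yangian N) = carrier (W_algebra N p)"
proof
  show "yangian_to_W N p ` carrier (poisson_yangian N) \<subseteq> carrier (W_algebra N p)"
    using yangian_to_W_hom[OF p] by (auto simp: ring_hom_def)
  show "carrier (W_algebra N p) \<subseteq> yangian_to_W N p ` carrier (poisson_yangian N)"
  proof
    fix F assume "F \<in> carrier (W_algebra N p)"
    then obtain f where F: "F = on_surface N p f" and f: "pvars f \<subseteq> gl_vars N p" "gauge_invariant N p f"
      by (auto simp: carrier_W_algebra)
    define q where "q = psubst (slice_subst p) f"
    have q: "pvars q \<subseteq> yangian_vars N"
      unfolding q_def by (rule pvars_psubst[OF f(1) pvars_slice_subst])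
    have "peval J f = peval J (psubst (t_subst N p) q)" if J: "J \<in> constraint_surface N p" for J
    proof -
      obtain J' where J': "J' \<in> companion_slice N p"
        and eq: "\<And>g. \<lbrakk>pvars g \<subseteq> gl_vars N p; gauge_invariant N p g\<rbrakk> \<Longrightarrow> peval J' g = peval J g"
        using gauge_fixing[OF J] by blast
      have "peval J (psubst (t_subst N p) q) = peval J' (psubst (t_subst N p) q)"
        using eq psubst_t_subst_props[OF p q] by simp
      also have "\<dots> = peval (\<lambda>v. peval (\<lambda>w. peval J' (t_subst N p w)) (slice_subst p v)) f"
        unfolding q_def by (simp add: peval_psubst)
      also have "\<dots> = peval J' f"
        using f(1) peval_slice_subst[OF J' p] by (intro peval_cong) blast
      finally show ?thesis using eq f by simp
    qed
    then have "F = yangian_to_W N p q" by (simp add: F yangian_to_W_def on_surface_eq_iff)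
    then show "F \<in> yangian_to_W N p ` carrier (poisson_yangian N)" using q by auto
  qed
qed

definition truncate_subst :: "nat \<Rightarrow> yvar \<Rightarrow> yvar cpoly" where
  "truncate_subst p = (\<lambda>(n, i, j). if n \<le> p then pvar (n, i, j) else 0)"

text \<open>Any values of the generators with n \<le> p occur at some companion matrix. If the image
  of \<open>f\<close> vanishes on the surface, the truncation of \<open>f\<close> thus vanishes at
  every point and is the zero polynomial.\<close>

lemma psubst_truncate_eq_zero:
  assumes p: "p \<ge> 1" and f: "pvars f \<subseteq> yangian_vars N"
    and vanish: "\<And>J. J \<in> constraint_surface N p \<Longrightarrow> peval J (psubst (t_subst N p) f) = 0"
  shows "psubst (truncate_subst p) f = 0"
proof (rule peval_eq_zero_imp_eq_zero)
  fix y
  \<comment> \<open>The companion matrix at which the generators take the values prescribed by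
    y.\<close>
  define J :: "idx cmat" where "J = (\<lambda>v. if v \<in> gl_vars N p then peval y (slice_subst p v) else 0)"
  have J: "J \<in> companion_slice N p"
    unfolding companion_slice_def mem_constraint_surface_iff matrices_def
    by (auto simp: J_def slice_subst_def indices_def)
  have "peval J (t_subst N p v) = peval y (truncate_subst p v)" if v: "v \<in> yangian_vars N" for v
  proof -
    obtain n i j where v': "v = (n, i, j)" by (metis surj_pair)
    have n: "n \<ge> 1" "i \<in> {1..N}" "j \<in> {1..N}" using v by (auto simp: v' yangian_vars_def)
    have "((- 1 :: complex) ^ n) * (- 1) ^ n = 1" by (simp flip: power_mult_distrib)
    moreover have "J ((i, p + 1 - n), (j, p)) = - ((- 1) ^ n) * y (n, i, j)" if "n \<le> p"
    proof -
      have "((i, p + 1 - n), (j, p)) \<in> gl_vars N p" "p + 1 - (p + 1 - n) = n"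
        using n that p by (auto simp: indices_def)
      then show ?thesis by (simp add: J_def slice_subst_def peval_simps)
    qed
    ultimately show ?thesis
      using t_poly_slice[OF J p n(2,3,1)]
      by (simp add: v' t_subst_def truncate_subst_def mult.assoc[symmetric])
  qed
  then have "peval y (psubst (truncate_subst p) f) = peval J (psubst (t_subst N p) f)"
    unfolding peval_psubst using f by (intro peval_cong) auto
  then show "peval y (psubst (truncate_subst p) f) = 0"
    using vanish J by (simp add: companion_slice_def)
qed

text \<open>Truncation is a normal form modulo the ideal. With bars for truncations, products use f
  g - f' g' = f (g - g') + (f - f') g', where f' and g' are those of f and g.\<close>

lemma diff_truncate_mem_ideal:
  assumes f: "pvars f \<subseteq> yangian_vars N"
  shows "f - psubst (truncate_subst p) f \<in> truncation_ideal N p"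
proof -
  let ?I = "truncation_ideal N p" and ?P = "poisson_yangian N"
  let ?G = "{yangian_T n i j | n i j. n > p \<and> i \<in> {1..N} \<and> j \<in> {1..N}}"
  interpret P: cring ?P by (rule cring_poisson_yangian)
  have G: "?G \<subseteq> carrier ?P" unfolding carrier_poisson_yangian using pvars_yangian_T by blast
  interpret ideal ?I ?P unfolding truncation_ideal_def by (rule P.genideal_ideal[OF G])
  have tr: "pvars (psubst (truncate_subst p) g) \<subseteq> yangian_vars N" if "pvars g \<subseteq> yangian_vars N" for g
    by (rule pvars_psubst[OF that]) (auto simp: truncate_subst_def pvars_pvar split: if_splits)
  show ?thesis
    using f
  proof (induction rule: cpoly_induct)
    case (const c)
    then show ?case using zero_closed by simp
  next
    case (var v)
    obtain n i j where v': "v = (n, i, j)" by (metis surj_pair)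
    show ?case
    proof (cases "n \<le> p")
      case True
      then show ?thesis using zero_closed by (simp add: v' truncate_subst_def)
    next
      case False
      with var have "pvar v = yangian_T n i j" "n > p" "i \<in> {1..N}" "j \<in> {1..N}"
        by (auto simp: v' yangian_vars_def yangian_T_def)
      then have "pvar v \<in> ?G" by blast
      then have "pvar v \<in> ?I" using P.genideal_self[OF G] by (auto simp: truncation_ideal_def)
      then show ?thesis using False by (simp add: v' truncate_subst_def)
    qed
  next
    case (add f g)
    from a_closed[OF add(3,4)] show ?case by (simp add: psubst_add algebra_simps)
  next
    case (mult f g)
    have "f * (g - psubst (truncate_subst p) g) \<in> ?I"
      using I_l_closed[OF mult(4), of f] mult(1) by simp
    moreover have "(f - psubst (truncate_subst p) f) * psubst (truncate_subst p) g \<in> ?I"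
      using I_r_closed[OF mult(3), of "psubst (truncate_subst p) g"] tr[OF mult(2)] by simp
    ultimately have "f * (g - psubst (truncate_subst p) g) +
        (f - psubst (truncate_subst p) f) * psubst (truncate_subst p) g \<in> ?I"
      using a_closed by fastforce
    then show ?case by (simp add: psubst_mult algebra_simps)
  qed
qed

text \<open>An element of the kernel has truncation 0, so it is its own difference from its
  truncation and lies in the ideal. Conversely, the kernel is an ideal that contains the generators
  with n > p.\<close>

lemma yangian_to_W_kernel:
  assumes p: "p \<ge> 1"
  shows "a_kernel (poisson_yangian N) (W_algebra N p) (yangian_to_W N p) = truncation_ideal N p"
proof
  let ?P = "poisson_yangian N"
  let ?G = "{yangian_T n i j | n i j. n > p \<and> i \<in> {1..N} \<and> j \<in> {1..N}}"
  interpret P: cring ?P by (rule cring_poisson_yangian)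
  interpret W: poisson_algebra "W_algebra N p" by (rule poisson_algebra_W_algebra)
  interpret \<psi>: ring_hom_ring ?P "W_algebra N p" "yangian_to_W N p"
    by (rule ring_hom_ringI2[OF P.ring_axioms W.ring_axioms yangian_to_W_hom[OF p]])
  have ker: "a_kernel ?P (W_algebra N p) (yangian_to_W N p) =
      {f. pvars f \<subseteq> yangian_vars N \<and> (\<forall>J\<in>constraint_surface N p. peval J (psubst (t_subst N p) f) = 0)}"
    unfolding a_kernel_def' by (simp add: W_algebra_ops yangian_to_W_def on_surface_eq_iff)
  show "a_kernel ?P (W_algebra N p) (yangian_to_W N p) \<subseteq> truncation_ideal N p"
  proof
    fix f assume "f \<in> a_kernel ?P (W_algebra N p) (yangian_to_W N p)"
    then have f: "pvars f \<subseteq> yangian_vars N" "psubst (truncate_subst p) f = 0"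
      using psubst_truncate_eq_zero[OF p, of f N] unfolding ker by auto
    then show "f \<in> truncation_ideal N p" using diff_truncate_mem_ideal[OF f(1), of p] by simp
  qed
  have "?G \<subseteq> a_kernel ?P (W_algebra N p) (yangian_to_W N p)"
  proof
    fix f assume "f \<in> ?G"
    then obtain n i j where f: "f = yangian_T n i j" "n > p" "i \<in> {1..N}" "j \<in> {1..N}" by blast
    show "f \<in> a_kernel ?P (W_algebra N p) (yangian_to_W N p)"
      using pvars_yangian_T[OF f(3,4), of n] t_poly_truncated[OF p f(3,4,2)]
      unfolding ker f(1) mem_Collect_eq psubst_yangian_T by blast
  qed
  then show "truncation_ideal N p \<subseteq> a_kernel ?P (W_algebra N p) (yangian_to_W N p)"
    unfolding truncation_ideal_def by (rule P.genideal_minimal[OF \<psi>.kernel_is_ideal])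
qed

theorem theorem4p5:
  fixes N p :: nat
  assumes "N \<ge> 1" and "p \<ge> 1"
  shows "poisson_isomorphic (W_algebra N p) (truncated_yangian N p)"
  unfolding truncated_yangian_def
proof (rule poisson_isomorphic_poisson_quot[OF poisson_algebra_W_algebra cring_poisson_yangian
      yangian_to_W_hom yangian_to_W_surj yangian_to_W_kernel])
  show "c \<odot>\<^bsub>poisson_yangian N\<^esub> f \<in> carrier (poisson_yangian N) \<and>
      yangian_to_W N p (c \<odot>\<^bsub>poisson_yangian N\<^esub> f) = c \<odot>\<^bsub>W_algebra N p\<^esub> yangian_to_W N p f"
    if "f \<in> carrier (poisson_yangian N)" for c f
    using that pvars_mult[of "pconst c" f]
    by (auto simp: yangian_to_W_def W_algebra_ops psubst_mult simp del: split_paired_All)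
  show "pbracket (poisson_yangian N) f g \<in> carrier (poisson_yangian N) \<and>
      yangian_to_W N p (pbracket (poisson_yangian N) f g) =
      pbracket (W_algebra N p) (yangian_to_W N p f) (yangian_to_W N p g)"
    if "f \<in> carrier (poisson_yangian N)" "g \<in> carrier (poisson_yangian N)" for f g
    using that yangian_to_W_bracket[OF assms(2)] pvars_poly_bracket[OF pvars_yangian_gen_bracket]
    by simp
qed (use assms in auto)

end
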